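(* For any object $[n;\mathbf{q}]\in\Theta_2$ with $[n;\mathbf{q}]\neq[0]$, the horizontal equivalence extension $$(\Theta_2[0]\overset{e}{\hookrightarrow}J)\,\hat\times\,(\partial\Theta_2[n;\mathbf{q}]\hookrightarrow\Theta_2[n;\mathbf{q}])$$ is contained in $\mathrm{cell}(\mathcal{H}_h)$.
   Context: **Cellular sets.** $\Delta$ is the category of ordinals $[n]=\{0,\dots,n\}$ ($n\ge 0$) and order-preserving maps; $\delta^i:[n-1]\to[n]$ is the injection omitting $i$. The category $\Theta_2$ has objects $[n;\mathbf{q}]=[n;q_1,\dots,q_n]$ with $n,q_1,\dots,q_n\in\mathbb{N}$ (the unique object with $n=0$ is written $[0]$). A morphism $[\alpha;\boldsymbol{\alpha}]:[m;\mathbf{p}]\to[n;\mathbf{q}]$ consists of an order-preserving $\alpha:[m]\to[n]$ and, for each $1\le\ell\le m$ and each $k$ with $\alpha(\ell-1)<k\le\alpha(\ell)$, an order-preserving $\alpha_k:[p_\ell]\to[q_k]$. Composition is $[\beta;\boldsymbol{\beta}][\alpha;\boldsymbol{\alpha}]=[\beta\alpha;\boldsymbol{\gamma}]$ with $\gamma_j=\beta_j\alpha_k$ when $\beta(k-1)<j\le\beta(k)$. $\widehat{\Theta_2}$ is the category of presheaves on $\Theta_2$ (cellular sets); $\Theta_2[n;\mathbf{q}]$ is the representable presheaf. A cellular subset is a subfunctor; the cellular subset generated by a set of cells is the smallest one containing them. Morphisms into $[n;\mathbf{q}]$ are identified with cells of $\Theta_2[n;\mathbf{q}]$. Simplicial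 sets are regarded as cellular sets by precomposing with the functor $\Theta_2\to\Delta$, $[n;\mathbf{q}]\mapsto[n]$, $[\alpha;\boldsymbol{\alpha}]\mapsto\alpha$. **Shuffles and hyperfaces.** An $(a,b)$-shuffle $\langle\alpha,\alpha'\rangle$ is a pair of order-preserving surjections $\alpha:[a+b]\to[a]$, $\alpha':[a+b]\to[b]$ with $\alpha(i)+\alpha'(i)=i$ for all $i$; $\mathrm{Shfl}(a,b)$ is the set of these. Let $\dim[n;\mathbf{q}]=n+\sum_k q_k$. The hyperfaces (codimension-1 face maps) of $[n;\mathbf{q}]$ are: - (if $n\ge1$, $q_1=0$) the 0-th horizontal one $\delta_h^0=[\delta^0;\mathbf{id}]:[n-1;q_2,\dots,q_n]\to[n;\mathbf{q}]$; - (if $n\ge1$, $q_n=0$) the $n$-th horizontal one $\delta_h^n=[\delta^n;\mathbf{id}]:[n-1;q_1,\dots,q_{n-1}]\to[n;\mathbf{q}]$; - for $1\le k\le n-1$ and $\langle\beta,\beta'\rangle\in\mathrm{Shfl}(q_k,q_{k+1})$, the $k$-th horizontal one $\delta_h^{k;\langle\beta,\beta'\rangle}=[\delta^k;\boldsymbol{\alpha}]:[n-1;q_1,\dots,q_k+q_{k+1},\dots,q_n]\to[n;\mathbf{q}]$ with $\alpha_k=\beta$, $\alpha_{k+1}=\beta'$, all other $\alpha_\ell=\mathrm{id}$; - for $1\le k\le n$ with $q_k\ge1$ and $0\le i\le q_k$, the $(k;i)$-th vertical one $\delta_v^{k;i}=[\mathrm{id};\boldsymbol{\alpha}]:[n;q_1,\dots,q_k-1,\dots,q_n]\to[n;\mathbf{q}]$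 with $\alpha_k=\delta^i$, all other $\alpha_\ell=\mathrm{id}$. **Boundaries, horns, extensions.** $\partial\Theta_2[n;\mathbf{q}]\subset\Theta_2[n;\mathbf{q}]$ is the cellular subset of maps into $[n;\mathbf{q}]$ that factor through objects of lower dimension. $\mathcal{H}_h$ is the set of all inner horizontal horn inclusions $\Lambda_h^k[n;\mathbf{q}]\hookrightarrow\Theta_2[n;\mathbf{q}]$, $1\le k\le n-1$, where $\Lambda_h^k[n;\mathbf{q}]$ is the cellular subset generated by all hyperfaces except the $k$-th horizontal ones. $J$ is the nerve of the chaotic category (unique isomorphism) on two objects $\lozenge,\bullet$, regarded as a cellular set, and $e:\Theta_2[0]\hookrightarrow J$ is the inclusion of $\lozenge$. The Leibniz product $f\hat\times g$ of $f:A\to B$, $g:C\to D$ is the induced map $(A\times D)\amalg_{A\times C}(B\times C)\to B\times D$. For a set $\mathcal{S}$ of maps in $\widehat{\Theta_2}$, $\mathrm{cell}(\mathcal{S})$ is the closure of $\mathcal{S}$ under transfinite composition and pushouts along arbitrary maps. *)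

theory Defs
  imports "HOL-Library.FuncSet"
begin

section \<open>Categories and presheaves\<close>

text \<open>Every element of the type \<open>'o\<close> is an object.  Morphisms carry their source and target, so the
  Hom-sets are disjoint.\<close>

record ('o, 'm) category =
  Hom :: "'o \<Rightarrow> 'o \<Rightarrow> 'm set"
  idm :: "'o \<Rightarrow> 'm"
  Comp :: "'m \<Rightarrow> 'm \<Rightarrow> 'm"

definition category :: "('o, 'm) category \<Rightarrow> bool" where
  "category C \<longleftrightarrow>
     (\<forall>a b a' b' f. f \<in> Hom C a b \<longrightarrow> f \<in> Hom C a' b' \<longrightarrow> a = a' \<and> b = b') \<and>
     (\<forall>a. idm C a \<in> Hom C a a) \<and>
     (\<forall>a b c f g. f \<in> Hom C a b \<longrightarrow> g \<in> Hom C b c \<longrightarrow> Comp C g f \<in> Hom C a c) \<and>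
     (\<forall>a b f. f \<in> Hom C a b \<longrightarrow> Comp C f (idm C a) = f \<and> Comp C (idm C b) f = f) \<and>
     (\<forall>a b c d f g h. f \<in> Hom C a b \<longrightarrow> g \<in> Hom C b c \<longrightarrow> h \<in> Hom C c d \<longrightarrow>
        Comp C h (Comp C g f) = Comp C (Comp C h g) f)"

text \<open>\<open>act X f x\<close> is the action of \<open>f\<close> on \<open>x\<close>, usually written \<open>x \<cdot> f\<close>.  Its values outside
  the sets of cells are irrelevant.\<close>

record ('o, 'm, 'a) presheaf =
  cells :: "'o \<Rightarrow> 'a set"
  act :: "'m \<Rightarrow> 'a \<Rightarrow> 'a"

definition is_presheaf :: "('o, 'm) category \<Rightarrow> ('o, 'm, 'a) presheaf \<Rightarrow> bool" where
  "is_presheaf C X \<longleftrightarrow>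
     (\<forall>a b f x. f \<in> Hom C a b \<longrightarrow> x \<in> cells X b \<longrightarrow> act X f x \<in> cells X a) \<and>
     (\<forall>a x. x \<in> cells X a \<longrightarrow> act X (idm C a) x = x) \<and>
     (\<forall>a b c f g x. f \<in> Hom C a b \<longrightarrow> g \<in> Hom C b c \<longrightarrow> x \<in> cells X c \<longrightarrow>
        act X (Comp C g f) x = act X f (act X g x))"

definition is_subfunctor ::
  "('o, 'm) category \<Rightarrow> ('o, 'm, 'a) presheaf \<Rightarrow> ('o \<Rightarrow> 'a set) \<Rightarrow> bool" where
  "is_subfunctor C X A \<longleftrightarrow>
     (\<forall>a. A a \<subseteq> cells X a) \<and>
     (\<forall>a b f x. f \<in> Hom C a b \<longrightarrow> x \<in> A b \<longrightarrow> act X f x \<in> A a)"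

definition generated_by ::
  "('o, 'm) category \<Rightarrow> ('o, 'm, 'a) presheaf \<Rightarrow> ('o \<Rightarrow> 'a set) \<Rightarrow> 'o \<Rightarrow> 'a set" where
  "generated_by C X G a = \<Inter> {A a | A. is_subfunctor C X A \<and> (\<forall>b. G b \<subseteq> A b)}"


section \<open>The category \<open>\<Delta>\<close>\<close>

text \<open>The order-preserving maps from \<open>[m] = {..m}\<close> to \<open>[n] = {..n}\<close>, as extensional functions.\<close>

definition ord_maps :: "nat \<Rightarrow> nat \<Rightarrow> (nat \<Rightarrow> nat) set" where
  "ord_maps m n = {\<alpha> \<in> {..m} \<rightarrow>\<^sub>E {..n}. mono_on {..m} \<alpha>}"

definition ord_id :: "nat \<Rightarrow> nat \<Rightarrow> nat" where
  "ord_id n = (\<lambda>i\<in>{..n}. i)"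

text \<open>The map \<open>\<delta>\<^sup>i : [n - 1] \<rightarrow> [n]\<close> that omits \<open>i\<close>, for \<open>n \<ge> 1\<close>.\<close>

definition coface :: "nat \<Rightarrow> nat \<Rightarrow> nat \<Rightarrow> nat" where
  "coface n i = (\<lambda>j\<in>{..n - 1}. if j < i then j else Suc j)"

datatype delta_mor = DMor (ddom: nat) (dcod: nat) (dfun: "nat \<Rightarrow> nat")

definition Delta :: "(nat, delta_mor) category" where
  "Delta =
     \<lparr> Hom = (\<lambda>m n. {f. ddom f = m \<and> dcod f = n \<and> dfun f \<in> ord_maps m n}),
       idm = (\<lambda>n. DMor n n (ord_id n)),
       Comp = (\<lambda>g f. DMor (ddom f) (dcod g) (compose {..ddom f} (dfun g) (dfun f))) \<rparr>"


section \<open>The category \<open>\<Theta>\<^sub>2\<close>\<close>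

text \<open>The object \<open>[n; q\<^sub>1, \<dots>, q\<^sub>n]\<close> is the list \<open>[q\<^sub>1, \<dots>, q\<^sub>n]\<close>; so \<open>[0]\<close> is the empty list.
  Lists are indexed from 0, whereas the \<open>q\<^sub>k\<close> are indexed from 1.\<close>

type_synonym theta_ob = "nat list"

abbreviation entry :: "theta_ob \<Rightarrow> nat \<Rightarrow> nat" where
  "entry q k \<equiv> q ! (k - 1)"

definition dim :: "theta_ob \<Rightarrow> nat" where
  "dim q = length q + sum_list q"

text \<open>In \<open>[\<alpha>; \<alpha>\<^sub>k] : [m; p] \<rightarrow> [n; q]\<close> the index \<open>k\<close> of a vertical component ranges over the
  disjoint union of the intervals \<open>\<alpha>(\<ell> - 1) < k \<le> \<alpha>(\<ell>)\<close>, that is over \<open>\<alpha>(0) < k \<le> \<alpha>(m)\<close>;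
  the family \<open>ver\<close> is \<open>undefined\<close> outside this range.\<close>

datatype theta_mor = ThMor
  (tdom: theta_ob) (tcod: theta_ob) (hor: "nat \<Rightarrow> nat") (ver: "nat \<Rightarrow> nat \<Rightarrow> nat")

definition theta_hom :: "theta_ob \<Rightarrow> theta_ob \<Rightarrow> theta_mor set" where
  "theta_hom p q =
     {f. tdom f = p \<and> tcod f = q \<and>
         hor f \<in> ord_maps (length p) (length q) \<and>
         (\<forall>l k. 1 \<le> l \<and> l \<le> length p \<and> hor f (l - 1) < k \<and> k \<le> hor f l \<longrightarrow>
            ver f k \<in> ord_maps (entry p l) (entry q k)) \<and>
         ver f \<in> extensional {hor f 0 <.. hor f (length p)}}"

text \<open>For \<open>\<alpha>\<close> defined on \<open>[m]\<close> and \<open>\<alpha>(0) < k \<le> \<alpha>(m)\<close>, the unique \<open>\<ell>\<close> with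
  \<open>\<alpha>(\<ell> - 1) < k \<le> \<alpha>(\<ell>)\<close>.\<close>

definition segment :: "nat \<Rightarrow> (nat \<Rightarrow> nat) \<Rightarrow> nat \<Rightarrow> nat" where
  "segment m \<alpha> k = (THE l. 1 \<le> l \<and> l \<le> m \<and> \<alpha> (l - 1) < k \<and> k \<le> \<alpha> l)"

definition theta_comp :: "theta_mor \<Rightarrow> theta_mor \<Rightarrow> theta_mor" where
  "theta_comp g f =
     (let m = length (tdom f); n = length (tdom g); \<gamma> = compose {..m} (hor g) (hor f)
      in ThMor (tdom f) (tcod g) \<gamma>
           (\<lambda>j\<in>{\<gamma> 0 <.. \<gamma> m}.
              let k = segment n (hor g) j; l = segment m (hor f) k
              in compose {..entry (tdom f) l} (ver g j) (ver f k)))"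

definition theta_id :: "theta_ob \<Rightarrow> theta_mor" where
  "theta_id q = ThMor q q (ord_id (length q)) (\<lambda>k\<in>{0<..length q}. ord_id (entry q k))"

definition Theta2 :: "(theta_ob, theta_mor) category" where
  "Theta2 = \<lparr> Hom = theta_hom, idm = theta_id, Comp = theta_comp \<rparr>"

text \<open>The functor \<open>\<Theta>\<^sub>2 \<rightarrow> \<Delta>\<close>, on morphisms.  On objects it is \<open>length\<close>.\<close>

definition theta_to_delta :: "theta_mor \<Rightarrow> delta_mor" where
  "theta_to_delta f = DMor (length (tdom f)) (length (tcod f)) (hor f)"


section \<open>Hyperfaces\<close>

definition Shfl :: "nat \<Rightarrow> nat \<Rightarrow> ((nat \<Rightarrow> nat) \<times> (nat \<Rightarrow> nat)) set" where
  "Shfl a b =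
     {(\<alpha>, \<alpha>'). \<alpha> \<in> ord_maps (a + b) a \<and> \<alpha> ` {..a + b} = {..a} \<and>
               \<alpha>' \<in> ord_maps (a + b) b \<and> \<alpha>' ` {..a + b} = {..b} \<and>
               (\<forall>i\<le>a + b. \<alpha> i + \<alpha>' i = i)}"

definition hface_first :: "theta_ob \<Rightarrow> theta_mor" where
  "hface_first q =
     ThMor (tl q) q (coface (length q) 0) (\<lambda>k\<in>{1<..length q}. ord_id (entry q k))"

definition hface_last :: "theta_ob \<Rightarrow> theta_mor" where
  "hface_last q =
     ThMor (butlast q) q (coface (length q) (length q))
       (\<lambda>k\<in>{0<..length q - 1}. ord_id (entry q k))"

definition hface_inner :: "theta_ob \<Rightarrow> nat \<Rightarrow> (nat \<Rightarrow> nat) \<Rightarrow> (nat \<Rightarrow> nat) \<Rightarrow> theta_mor" where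
  "hface_inner q k \<beta> \<beta>' =
     ThMor (take (k - 1) q @ [entry q k + entry q (k + 1)] @ drop (k + 1) q) q
       (coface (length q) k)
       (\<lambda>l\<in>{0<..length q}. if l = k then \<beta> else if l = k + 1 then \<beta>' else ord_id (entry q l))"

definition vface :: "theta_ob \<Rightarrow> nat \<Rightarrow> nat \<Rightarrow> theta_mor" where
  "vface q k i =
     ThMor (q[k - 1 := entry q k - 1]) q (ord_id (length q))
       (\<lambda>l\<in>{0<..length q}. if l = k then coface (entry q k) i else ord_id (entry q l))"

definition horizontal_hyperfaces :: "theta_ob \<Rightarrow> nat \<Rightarrow> theta_mor set" where
  "horizontal_hyperfaces q k =
     {f. k = 0 \<and> length q \<ge> 1 \<and> entry q 1 = 0 \<and> f = hface_first q} \<union>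
     {f. k = length q \<and> length q \<ge> 1 \<and> entry q (length q) = 0 \<and> f = hface_last q} \<union>
     {f. 1 \<le> k \<and> k < length q \<and>
         (\<exists>\<beta> \<beta>'. (\<beta>, \<beta>') \<in> Shfl (entry q k) (entry q (k + 1)) \<and> f = hface_inner q k \<beta> \<beta>')}"

definition vertical_hyperfaces :: "theta_ob \<Rightarrow> theta_mor set" where
  "vertical_hyperfaces q =
     {vface q k i | k i. 1 \<le> k \<and> k \<le> length q \<and> entry q k \<ge> 1 \<and> i \<le> entry q k}"

definition hyperfaces :: "theta_ob \<Rightarrow> theta_mor set" where
  "hyperfaces q = (\<Union>k\<le>length q. horizontal_hyperfaces q k) \<union> vertical_hyperfaces q"


section \<open>Cellular sets and their maps\<close>

text \<open>The cells of a cellular set are taken from a type \<open>'a\<close> that plays the role of the universe of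
  small sets.\<close>

type_synonym 'a cellular_set = "(theta_ob, theta_mor, 'a) presheaf"

abbreviation is_cellular_set :: "'a cellular_set \<Rightarrow> bool" where
  "is_cellular_set \<equiv> is_presheaf Theta2"

record 'a cellular_map =
  src :: "'a cellular_set"
  tgt :: "'a cellular_set"
  app :: "theta_ob \<Rightarrow> 'a \<Rightarrow> 'a"

text \<open>The components are extensional functions, so that equality of parallel maps is equality on
  cells.\<close>

definition maps :: "'a cellular_set \<Rightarrow> 'a cellular_set \<Rightarrow> 'a cellular_map set" where
  "maps X Y =
     {f. src f = X \<and> tgt f = Y \<and> is_cellular_set X \<and> is_cellular_set Y \<and>
         (\<forall>q. app f q \<in> cells X q \<rightarrow>\<^sub>E cells Y q) \<and>
         (\<forall>p q g x. g \<in> Hom Theta2 p q \<longrightarrow> x \<in> cells X q \<longrightarrow>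
            app f p (act X g x) = act Y g (app f q x))}"

definition cid :: "'a cellular_set \<Rightarrow> 'a cellular_map" where
  "cid X = \<lparr> src = X, tgt = X, app = (\<lambda>q. \<lambda>x\<in>cells X q. x) \<rparr>"

definition ccomp :: "'a cellular_map \<Rightarrow> 'a cellular_map \<Rightarrow> 'a cellular_map" (infixl "\<odot>" 70) where
  "g \<odot> f =
     \<lparr> src = src f, tgt = tgt g, app = (\<lambda>q. compose (cells (src f) q) (app g q) (app f q)) \<rparr>"

definition sub_cellular_set :: "'a cellular_set \<Rightarrow> (theta_ob \<Rightarrow> 'a set) \<Rightarrow> 'a cellular_set" where
  "sub_cellular_set X A = \<lparr> cells = A, act = act X \<rparr>"

definition inclusion :: "'a cellular_set \<Rightarrow> (theta_ob \<Rightarrow> 'a set) \<Rightarrow> 'a cellular_map" where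
  "inclusion X A = \<lparr> src = sub_cellular_set X A, tgt = X, app = (\<lambda>q. \<lambda>x\<in>A q. x) \<rparr>"


section \<open>Pushouts, transfinite compositions and \<open>cell\<close>\<close>

text \<open>The square
  \<open>A \<rightarrow>\<^sub>f B \<rightarrow>\<^sub>i P\<close>, \<open>A \<rightarrow>\<^sub>g C \<rightarrow>\<^sub>j P\<close> is a pushout.\<close>

definition is_pushout ::
  "'a cellular_map \<Rightarrow> 'a cellular_map \<Rightarrow> 'a cellular_map \<Rightarrow> 'a cellular_map \<Rightarrow> bool" where
  "is_pushout f g i j \<longleftrightarrow>
     (\<exists>A B C P. f \<in> maps A B \<and> g \<in> maps A C \<and> i \<in> maps B P \<and> j \<in> maps C P \<and>
        i \<odot> f = j \<odot> g \<and>
        (\<forall>Q u v. u \<in> maps B Q \<longrightarrow> v \<in> maps C Q \<longrightarrow> u \<odot> f = v \<odot> g \<longrightarrow>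
           (\<exists>!h. h \<in> maps P Q \<and> h \<odot> i = u \<and> h \<odot> j = v)))"

text \<open>\<open>\<iota>\<close> is a colimit cocone, with vertex \<open>P\<close>, of the diagram \<open>X, t\<close> restricted to the subset
  \<open>I\<close> of a linear order \<open>r\<close>.\<close>

definition is_cocone ::
  "'i rel \<Rightarrow> 'i set \<Rightarrow> ('i \<Rightarrow> 'a cellular_set) \<Rightarrow> ('i \<Rightarrow> 'i \<Rightarrow> 'a cellular_map) \<Rightarrow>
   'a cellular_set \<Rightarrow> ('i \<Rightarrow> 'a cellular_map) \<Rightarrow> bool" where
  "is_cocone r I X t P \<iota> \<longleftrightarrow>
     (\<forall>a\<in>I. \<iota> a \<in> maps (X a) P) \<and>
     (\<forall>a\<in>I. \<forall>b\<in>I. (a, b) \<in> r \<longrightarrow> \<iota> b \<odot> t a b = \<iota> a)"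

definition is_colimit ::
  "'i rel \<Rightarrow> 'i set \<Rightarrow> ('i \<Rightarrow> 'a cellular_set) \<Rightarrow> ('i \<Rightarrow> 'i \<Rightarrow> 'a cellular_map) \<Rightarrow>
   'a cellular_set \<Rightarrow> ('i \<Rightarrow> 'a cellular_map) \<Rightarrow> bool" where
  "is_colimit r I X t P \<iota> \<longleftrightarrow>
     is_cocone r I X t P \<iota> \<and>
     (\<forall>Q u. is_cocone r I X t Q u \<longrightarrow> (\<exists>!h. h \<in> maps P Q \<and> (\<forall>a\<in>I. h \<odot> \<iota> a = u a)))"

definition is_least :: "'i rel \<Rightarrow> 'i \<Rightarrow> bool" where
  "is_least r a \<longleftrightarrow> a \<in> Field r \<and> (\<forall>b\<in>Field r. (a, b) \<in> r)"

definition is_successor :: "'i rel \<Rightarrow> 'i \<Rightarrow> 'i \<Rightarrow> bool" where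
  "is_successor r a b \<longleftrightarrow>
     (a, b) \<in> r \<and> a \<noteq> b \<and> (\<forall>c\<in>Field r. (c, a) \<in> r \<or> (b, c) \<in> r)"

definition is_limit :: "'i rel \<Rightarrow> 'i \<Rightarrow> bool" where
  "is_limit r c \<longleftrightarrow> c \<in> Field r \<and> \<not> is_least r c \<and> (\<nexists>a. is_successor r a c)"

text \<open>A colimit-preserving functor from the nonempty ordinal represented by the well-order \<open>r\<close>,
  with objects \<open>X a\<close> and transition maps \<open>t a b\<close>.\<close>

definition is_transfinite_sequence ::
  "'i rel \<Rightarrow> ('i \<Rightarrow> 'a cellular_set) \<Rightarrow> ('i \<Rightarrow> 'i \<Rightarrow> 'a cellular_map) \<Rightarrow> bool" where
  "is_transfinite_sequence r X t \<longleftrightarrow>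
     Well_order r \<and> Field r \<noteq> {} \<and>
     (\<forall>a b. (a, b) \<in> r \<longrightarrow> t a b \<in> maps (X a) (X b)) \<and>
     (\<forall>a\<in>Field r. t a a = cid (X a)) \<and>
     (\<forall>a b c. (a, b) \<in> r \<longrightarrow> (b, c) \<in> r \<longrightarrow> t b c \<odot> t a b = t a c) \<and>
     (\<forall>c. is_limit r c \<longrightarrow> is_colimit r (underS r c) X t (X c) (\<lambda>a. t a c))"

text \<open>The ordinals along which one composes are the small ones, that is the order types of
  well-orders on subsets of the universe \<open>'a\<close>.\<close>

inductive_set cell :: "'a cellular_map set \<Rightarrow> 'a cellular_map set" for S where
  base: "f \<in> S \<Longrightarrow> f \<in> cell S"
| pushout: "f \<in> cell S \<Longrightarrow> is_pushout f g i j \<Longrightarrow> j \<in> cell S"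
| transfinite: "is_transfinite_sequence (r :: 'a rel) X t \<Longrightarrow>
    (\<forall>a b. is_successor r a b \<longrightarrow> t a b \<in> cell S) \<Longrightarrow>
    is_colimit r (Field r) X t P \<iota> \<Longrightarrow> is_least r z \<Longrightarrow> \<iota> z \<in> cell S"


section \<open>The cellular sets \<open>\<Theta>\<^sub>2[n; q]\<close>, \<open>J\<close> and products\<close>

datatype job = Lozenge | Bullet

text \<open>A universe that contains the cells of \<open>\<Theta>\<^sub>2[n; q]\<close> and of \<open>J\<close> and is closed under pairing.  The
  parameter \<open>'u\<close> makes it arbitrarily large.\<close>

datatype 'u univ =
    Atom 'u
  | Mor (the_mor: theta_mor)
  | Simp (the_simp: "nat \<Rightarrow> job")
  | Pair (pfst: "'u univ") (psnd: "'u univ")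

definition Theta_rep :: "theta_ob \<Rightarrow> 'u univ cellular_set" where
  "Theta_rep q =
     \<lparr> cells = (\<lambda>p. Mor ` Hom Theta2 p q),
       act = (\<lambda>f x. Mor (Comp Theta2 (the_mor x) f)) \<rparr>"

text \<open>\<open>J\<close> as a simplicial set.  A functor from \<open>[n]\<close> to the chaotic category is the same thing as
  an arbitrary function from \<open>{0, \<dots>, n}\<close> to the set of its two objects.\<close>

definition J_simplicial :: "(nat, delta_mor, 'u univ) presheaf" where
  "J_simplicial =
     \<lparr> cells = (\<lambda>n. Simp ` ({..n} \<rightarrow>\<^sub>E UNIV)),
       act = (\<lambda>f x. Simp (compose {..ddom f} (the_simp x) (dfun f))) \<rparr>"

definition cellular_of_simplicial :: "(nat, delta_mor, 'a) presheaf \<Rightarrow> 'a cellular_set" where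
  "cellular_of_simplicial X =
     \<lparr> cells = (\<lambda>q. cells X (length q)), act = (\<lambda>f. act X (theta_to_delta f)) \<rparr>"

definition J :: "'u univ cellular_set" where
  "J = cellular_of_simplicial J_simplicial"

text \<open>The inclusion \<open>\<Theta>\<^sub>2[0] \<rightarrow> J\<close> corresponding by the Yoneda lemma to the vertex \<open>Lozenge\<close>.\<close>

definition e_map :: "'u univ cellular_map" where
  "e_map =
     \<lparr> src = Theta_rep [], tgt = J,
       app = (\<lambda>q. \<lambda>x\<in>cells (Theta_rep []) q.
                act J (the_mor x) (Simp (\<lambda>i\<in>{..0}. Lozenge))) \<rparr>"

definition cprod :: "'u univ cellular_set \<Rightarrow> 'u univ cellular_set \<Rightarrow> 'u univ cellular_set"
    (infixr "\<otimes>" 75) where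
  "X \<otimes> Y =
     \<lparr> cells = (\<lambda>q. {Pair x y | x y. x \<in> cells X q \<and> y \<in> cells Y q}),
       act = (\<lambda>f z. Pair (act X f (pfst z)) (act Y f (psnd z))) \<rparr>"

definition cprod_map :: "'u univ cellular_map \<Rightarrow> 'u univ cellular_map \<Rightarrow> 'u univ cellular_map"
    (infixr "\<otimes>\<^sub>m" 75) where
  "f \<otimes>\<^sub>m g =
     \<lparr> src = src f \<otimes> src g, tgt = tgt f \<otimes> tgt g,
       app = (\<lambda>q. \<lambda>z\<in>cells (src f \<otimes> src g) q. Pair (app f q (pfst z)) (app g q (psnd z))) \<rparr>"

text \<open>Like the pushout in its source, the Leibniz product of \<open>f : A \<rightarrow> B\<close> and \<open>g : C \<rightarrow> D\<close> is
  defined up to isomorphism: \<open>h\<close> is a Leibniz product if its source is a pushout of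
  \<open>A \<otimes> D \<leftarrow> A \<otimes> C \<rightarrow> B \<otimes> C\<close> and \<open>h\<close> is the induced map to \<open>B \<otimes> D\<close>.\<close>

definition is_leibniz_product ::
  "'u univ cellular_map \<Rightarrow> 'u univ cellular_map \<Rightarrow> 'u univ cellular_map \<Rightarrow> bool" where
  "is_leibniz_product f g h \<longleftrightarrow>
     (\<exists>A B C D P i j. f \<in> maps A B \<and> g \<in> maps C D \<and>
        is_pushout (cid A \<otimes>\<^sub>m g) (f \<otimes>\<^sub>m cid C) i j \<and>
        i \<in> maps (A \<otimes> D) P \<and> j \<in> maps (B \<otimes> C) P \<and> h \<in> maps P (B \<otimes> D) \<and>
        h \<odot> i = f \<otimes>\<^sub>m cid D \<and> h \<odot> j = cid B \<otimes>\<^sub>m g)"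


section \<open>Boundaries and inner horizontal horns\<close>

definition boundary :: "theta_ob \<Rightarrow> theta_ob \<Rightarrow> 'u univ set" where
  "boundary q p =
     {Mor (Comp Theta2 g f) | f g r. f \<in> Hom Theta2 p r \<and> g \<in> Hom Theta2 r q \<and> dim r < dim q}"

definition boundary_inclusion :: "theta_ob \<Rightarrow> 'u univ cellular_map" where
  "boundary_inclusion q = inclusion (Theta_rep q) (boundary q)"

definition horizontal_horn :: "theta_ob \<Rightarrow> nat \<Rightarrow> theta_ob \<Rightarrow> 'u univ set" where
  "horizontal_horn q k =
     generated_by Theta2 (Theta_rep q)
       (\<lambda>p. {Mor f | f. f \<in> hyperfaces q - horizontal_hyperfaces q k \<and> tdom f = p})"

definition inner_horizontal_horn_inclusions :: "'u univ cellular_map set" ("\<H>\<^sub>h") where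
  "\<H>\<^sub>h = {inclusion (Theta_rep q) (horizontal_horn q k) | q k. 1 \<le> k \<and> k < length q}"


section \<open>Well-definedness\<close>

subsection \<open>\<open>\<Theta>\<^sub>2\<close> and \<open>\<Delta>\<close> are categories\<close>

lemma ord_maps_comp:
  assumes "f \<in> ord_maps a b" "g \<in> ord_maps b c"
  shows "compose {..a} g f \<in> ord_maps a c"
  using assms unfolding ord_maps_def mono_on_def compose_def
  by (auto simp: PiE_iff)

lemma ord_id_in: "ord_id n \<in> ord_maps n n"
  by (auto simp: ord_maps_def ord_id_def mono_on_def)

lemma ord_maps_id:
  assumes "f \<in> ord_maps a b"
  shows "compose {..a} f (ord_id a) = f" "compose {..a} (ord_id b) f = f"
  using assms unfolding ord_maps_def ord_id_def
  by (auto simp: compose_def PiE_iff extensional_def fun_eq_iff)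

lemma ord_maps_le: "f \<in> ord_maps a b \<Longrightarrow> i \<le> a \<Longrightarrow> f i \<le> b"
  by (auto simp: ord_maps_def PiE_iff)

lemma ord_maps_mono: "f \<in> ord_maps a b \<Longrightarrow> i \<le> j \<Longrightarrow> j \<le> a \<Longrightarrow> f i \<le> f j"
  by (auto simp: ord_maps_def mono_on_def)

lemma ord_maps_assoc:
  assumes "f \<in> ord_maps a b"
  shows "compose {..a} h (compose {..a} g f) = compose {..a} (compose {..b} h g) f"
  using assms by (auto simp: compose_def fun_eq_iff ord_maps_def PiE_iff)

lemma segment_eq:
  assumes f: "f \<in> ord_maps m n" and l: "1 \<le> l" "l \<le> m" "f (l - 1) < k" "k \<le> f l"
  shows "segment m f k = l"
  unfolding segment_def
proof (rule the_equality)
  fix l' assume l': "1 \<le> l' \<and> l' \<le> m \<and> f (l' - 1) < k \<and> k \<le> f l'"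
  have "\<not> l' < l" using ord_maps_mono[OF f, of l' "l - 1"] l l' by force
  moreover have "\<not> l < l'" using ord_maps_mono[OF f, of l "l' - 1"] l l' by force
  ultimately show "l' = l" by simp
qed (use l in auto)

lemma segment_ex:
  assumes f: "f \<in> ord_maps m n" and k: "f 0 < k" "k \<le> f m"
  obtains l where "1 \<le> l" "l \<le> m" "f (l - 1) < k" "k \<le> f l" "segment m f k = l"
proof -
  define l where "l = (LEAST l. k \<le> f l)"
  have 1: "k \<le> f l" unfolding l_def by (rule LeastI) (rule k)
  have 2: "l \<le> m" unfolding l_def by (rule Least_le) (rule k)
  have 3: "1 \<le> l" using 1 k by (cases l) auto
  have "\<not> k \<le> f (l - 1)" using 3 not_less_Least[of "l - 1" "\<lambda>l. k \<le> f l"] unfolding l_def by auto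
  then show ?thesis using that 1 2 3 segment_eq[OF f] by force
qed

lemma theta_homD:
  assumes "f \<in> theta_hom p q"
  shows "tdom f = p" "tcod f = q" "hor f \<in> ord_maps (length p) (length q)"
    "\<And>l k. 1 \<le> l \<Longrightarrow> l \<le> length p \<Longrightarrow> hor f (l - 1) < k \<Longrightarrow> k \<le> hor f l \<Longrightarrow>
       ver f k \<in> ord_maps (entry p l) (entry q k)"
    "ver f \<in> extensional {hor f 0 <.. hor f (length p)}"
  using assms by (auto simp: theta_hom_def)

lemma segment_comp:
  assumes f: "f \<in> ord_maps a b" and g: "g \<in> ord_maps b c"
    and l: "1 \<le> l" "l \<le> a" "g (f (l - 1)) < j" "j \<le> g (f l)"
  shows "f (l - 1) < segment b g j" "segment b g j \<le> f l"
    "1 \<le> segment b g j" "segment b g j \<le> b"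
    "g (segment b g j - 1) < j" "j \<le> g (segment b g j)"
    "segment a f (segment b g j) = l"
proof -
  have fl: "f l \<le> b" "f (l - 1) \<le> b" using ord_maps_le[OF f] l by auto
  have "g 0 < j" using ord_maps_mono[OF g, of 0 "f (l - 1)"] fl l by auto
  moreover have "j \<le> g b" using ord_maps_mono[OF g, of "f l" b] fl l by auto
  ultimately obtain k where k: "1 \<le> k" "k \<le> b" "g (k - 1) < j" "j \<le> g k" "segment b g j = k"
    using segment_ex[OF g] by metis
  have 1: "f (l - 1) < k" using ord_maps_mono[OF g, of k "f (l - 1)"] fl l k by force
  have 2: "k \<le> f l" using ord_maps_mono[OF g, of "f l" "k - 1"] fl l k by force
  show "f (l - 1) < segment b g j" "segment b g j \<le> f l" "1 \<le> segment b g j" "segment b g j \<le> b"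
    "g (segment b g j - 1) < j" "j \<le> g (segment b g j)"
    "segment a f (segment b g j) = l"
    using 1 2 k segment_eq[OF f l(1,2)] by auto
qed

lemma theta_comp_sel [simp]:
  "tdom (theta_comp g f) = tdom f" "tcod (theta_comp g f) = tcod g"
  "hor (theta_comp g f) = compose {..length (tdom f)} (hor g) (hor f)"
  by (simp_all add: theta_comp_def Let_def)

lemma theta_comp_ver:
  assumes f: "f \<in> theta_hom p q" and g: "g \<in> theta_hom q r"
    and l: "1 \<le> l" "l \<le> length p" "hor g (hor f (l - 1)) < j" "j \<le> hor g (hor f l)"
  shows "ver (theta_comp g f) j =
    compose {..entry p l} (ver g j) (ver f (segment (length q) (hor g) j))"
proof -
  note F = theta_homD[OF f] and G = theta_homD[OF g]
  note H = ord_maps_comp[OF F(3) G(3)]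
  have "hor g (hor f 0) < j" "j \<le> hor g (hor f (length p))"
    using ord_maps_mono[OF H, of 0 "l - 1"] ord_maps_mono[OF H, of l "length p"] l
      diff_le_self[of l 1, THEN le_trans, OF l(2)]
    by (auto simp: compose_def)
  then show ?thesis
    using segment_comp[OF F(3) G(3) l] F(1,2) G(1,2)
    by (auto simp: theta_comp_def Let_def compose_def)
qed

lemma theta_comp_in:
  assumes f: "f \<in> theta_hom p q" and g: "g \<in> theta_hom q r"
  shows "theta_comp g f \<in> theta_hom p r"
proof -
  note F = theta_homD[OF f] and G = theta_homD[OF g]
  have "ver (theta_comp g f) j \<in> ord_maps (entry p l) (entry r j)"
    if l: "1 \<le> l" "l \<le> length p" "hor g (hor f (l - 1)) < j" "j \<le> hor g (hor f l)" for l j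
  proof -
    note S = segment_comp[OF F(3) G(3) l]
    show ?thesis unfolding theta_comp_ver[OF f g l]
      by (rule ord_maps_comp[OF F(4)[OF l(1,2) S(1,2)] G(4)[OF S(3-6)]])
  qed
  moreover have "ver (theta_comp g f) \<in> extensional {hor g (hor f 0) <.. hor g (hor f (length p))}"
    using F(1) by (auto simp: theta_comp_def Let_def compose_def)
  ultimately show ?thesis
    using ord_maps_comp[OF F(3) G(3)] F(1) G(2)
    by (auto simp: theta_hom_def compose_def)
qed

lemma theta_eqI:
  assumes f: "f \<in> theta_hom p q" and g: "g \<in> theta_hom p q"
    and h: "\<And>i. i \<le> length p \<Longrightarrow> hor f i = hor g i"
    and v: "\<And>l k. 1 \<le> l \<Longrightarrow> l \<le> length p \<Longrightarrow> hor f (l - 1) < k \<Longrightarrow> k \<le> hor f l \<Longrightarrow> ver f k = ver g k"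
  shows "f = g"
proof -
  note F = theta_homD[OF f] and G = theta_homD[OF g]
  have H: "hor f = hor g"
    using F(3) G(3) h by (intro PiE_ext[of "hor f" "{..length p}" "\<lambda>_. {..length q}" "hor g"])
      (auto simp: ord_maps_def)
  have "ver f = ver g"
  proof (rule extensionalityI[OF F(5)])
    show "ver g \<in> extensional {hor f 0 <.. hor f (length p)}" using G(5) H by simp
    fix k assume "k \<in> {hor f 0 <.. hor f (length p)}"
    then obtain l where "1 \<le> l" "l \<le> length p" "hor f (l - 1) < k" "k \<le> hor f l"
      using segment_ex[OF F(3), of k] by auto
    then show "ver f k = ver g k" by (rule v)
  qed
  with H F(1,2) G(1,2) show ?thesis by (metis theta_mor.expand)
qed

lemma theta_id_in: "theta_id q \<in> theta_hom q q"
proof -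
  have "ver (theta_id q) k \<in> ord_maps (entry q l) (entry q k)"
    if "1 \<le> l" "l \<le> length q" "hor (theta_id q) (l - 1) < k" "k \<le> hor (theta_id q) l" for l k
  proof -
    have "l - Suc 0 \<le> length q" using that by simp
    then have "k = l" "0 < k" using that by (auto simp: theta_id_def ord_id_def)
    then show ?thesis using that(2) ord_id_in by (simp add: theta_id_def)
  qed
  then show ?thesis
    unfolding theta_hom_def by (auto simp: theta_id_def ord_id_in) (auto simp: ord_id_def)
qed

lemma theta_comp_id:
  assumes f: "f \<in> theta_hom p q"
  shows "theta_comp f (theta_id p) = f" "theta_comp (theta_id q) f = f"
proof -
  note F = theta_homD[OF f]
  have hid: "hor (theta_id p) i = i" if "i \<le> length p" for i p
    using that by (simp add: theta_id_def ord_id_def)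
  have vid: "ver (theta_id q) k = ord_id (entry q k)" if "0 < k" "k \<le> length q" for k q
    using that by (simp add: theta_id_def)
  have hid': "tdom (theta_id p) = p" for p by (simp add: theta_id_def)
  show "theta_comp f (theta_id p) = f"
  proof (rule theta_eqI[OF theta_comp_in[OF theta_id_in f] f])
    show "hor (theta_comp f (theta_id p)) i = hor f i" if "i \<le> length p" for i
      using that by (simp add: hid hid' compose_def)
    fix l k assume l: "1 \<le> l" "l \<le> length p" and
      "hor (theta_comp f (theta_id p)) (l - 1) < k" "k \<le> hor (theta_comp f (theta_id p)) l"
    then have k: "hor f (l - 1) < k" "k \<le> hor f l" using l diff_le_self[of l 1, THEN le_trans, OF l(2)]
      by (simp_all add: hid hid' compose_def)
    have k0: "hor f (hor (theta_id p) (l - 1)) < k" "k \<le> hor f (hor (theta_id p) l)"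
      using k l diff_le_self[of l 1, THEN le_trans, OF l(2)] by (simp_all add: hid)
    have "segment (length p) (hor f) k = l" by (rule segment_eq[OF F(3) l k])
    then show "ver (theta_comp f (theta_id p)) k = ver f k"
      using l k F(4)[OF l k]
k0 ord_maps_le[OF F(3), of l] vid[of l p]
      by (subst theta_comp_ver[OF theta_id_in f l])
        (simp_all add: hid ord_maps_id)
  qed
  show "theta_comp (theta_id q) f = f"
  proof (rule theta_eqI[OF theta_comp_in[OF f theta_id_in] f])
    have hq: "hor (theta_id q) (hor f i) = hor f i" if "i \<le> length p" for i
      using ord_maps_le[OF F(3) that] by (rule hid)
    show "hor (theta_comp (theta_id q) f) i = hor f i" if "i \<le> length p" for i
      using that by (simp add: hq F(1) compose_def)
    fix l k assume l: "1 \<le> l" "l \<le> length p" and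
      "hor (theta_comp (theta_id q) f) (l - 1) < k" "k \<le> hor (theta_comp (theta_id q) f) l"
    then have k: "hor f (l - 1) < k" "k \<le> hor f l" using l diff_le_self[of l 1, THEN le_trans, OF l(2)]
      by (simp_all add: hq F(1) compose_def)
    have k0: "hor (theta_id q) (hor f (l - 1)) < k" "k \<le> hor (theta_id q) (hor f l)"
      using k l diff_le_self[of l 1, THEN le_trans, OF l(2)] by (simp_all add: hq)
    have kq: "k \<le> length q" using k ord_maps_le[OF F(3) l(2)] by simp
    have "segment (length q) (hor (theta_id q)) k = k"
      by (rule segment_eq[OF theta_homD(3)[OF theta_id_in]]) (use k kq in \<open>auto simp: hid\<close>)
    then show "ver (theta_comp (theta_id q) f) k = ver f k"
      using l k kq F(4)[OF l k] k0 vid[of k q]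
      by (subst theta_comp_ver[OF f theta_id_in l]) (simp_all add: ord_maps_id)
  qed
qed

lemma theta_comp_assoc:
  assumes f: "f \<in> theta_hom p q" and g: "g \<in> theta_hom q r" and h: "h \<in> theta_hom r s"
  shows "theta_comp h (theta_comp g f) = theta_comp (theta_comp h g) f"
proof (rule theta_eqI)
  note F = theta_homD[OF f] and G = theta_homD[OF g] and H = theta_homD[OF h]
  note gf = theta_comp_in[OF f g] and hg = theta_comp_in[OF g h]
  show "theta_comp h (theta_comp g f) \<in> theta_hom p s" by (rule theta_comp_in[OF gf h])
  show "theta_comp (theta_comp h g) f \<in> theta_hom p s" by (rule theta_comp_in[OF f hg])
  have fq: "hor f i \<le> length q" if "i \<le> length p" for i using that ord_maps_le[OF F(3)] by simp
  show "hor (theta_comp h (theta_comp g f)) i = hor (theta_comp (theta_comp h g) f) i"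
    if "i \<le> length p" for i
    using that fq by (simp add: compose_def F(1) G(1))
  fix l j assume l: "1 \<le> l" "l \<le> length p" and
    j0: "hor (theta_comp h (theta_comp g f)) (l - 1) < j" "j \<le> hor (theta_comp h (theta_comp g f)) l"
  have l1: "l - Suc 0 \<le> length p" using l by simp
  from j0 have j: "hor h (hor g (hor f (l - 1))) < j" "j \<le> hor h (hor g (hor f l))"
    using l l1 by (simp_all add: compose_def F(1))
  have j1: "hor h (hor (theta_comp g f) (l - 1)) < j" "j \<le> hor h (hor (theta_comp g f) l)"
    using j l l1 by (simp_all add: compose_def F(1))
  have j2: "hor (theta_comp h g) (hor f (l - 1)) < j" "j \<le> hor (theta_comp h g) (hor f l)"
    using j l l1 fq by (simp_all add: compose_def F(1) G(1))
  define k where "k = segment (length r) (hor h) j"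
  note K = segment_comp[OF theta_homD(3)[OF gf] H(3) l j1, folded k_def]
  have k: "hor g (hor f (l - 1)) < k" "k \<le> hor g (hor f l)"
    using K(1,2) l l1 by (simp_all add: compose_def F(1))
  define i where "i = segment (length q) (hor g) k"
  note I = segment_comp[OF F(3) G(3) l k, folded i_def]
  have ij: "hor (theta_comp h g) (i - 1) < j" "j \<le> hor (theta_comp h g) i"
  proof -
    have "hor g (i - 1) \<le> k - 1" "k \<le> hor g i" using I by auto
    moreover have "hor g i \<le> length r" using ord_maps_le[OF G(3)] I by simp
    moreover have "k - Suc 0 \<le> length r" using K(4) by simp
    ultimately show "hor (theta_comp h g) (i - 1) < j" "j \<le> hor (theta_comp h g) i"
      using K(3-6) I(3,4) ord_maps_mono[OF H(3), of "hor g (i - 1)" "k - 1"]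
        ord_maps_mono[OF H(3), of k "hor g i"]
      by (auto simp: compose_def G(1))
  qed
  have si: "segment (length q) (hor (theta_comp h g)) j = i"
    by (rule segment_eq[OF theta_homD(3)[OF hg] I(3,4) ij])
  have "ver (theta_comp h (theta_comp g f)) j =
      compose {..entry p l} (ver h j) (compose {..entry p l} (ver g k) (ver f i))"
    by (subst theta_comp_ver[OF gf h l j1], subst k_def[symmetric],
        subst theta_comp_ver[OF f g l k], simp add: i_def)
  also have "\<dots> = compose {..entry p l} (compose {..entry q i} (ver h j) (ver g k)) (ver f i)"
    by (rule ord_maps_assoc[OF F(4)[OF l I(1,2)]])
  also have "compose {..entry q i} (ver h j) (ver g k) = ver (theta_comp h g) j"
  proof -
    have "hor h (hor g (i - 1)) < j" "j \<le> hor h (hor g i)"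
      using ij I(3,4) diff_le_self[of i 1, THEN le_trans, OF I(4)] by (simp_all add: compose_def G(1))
    then show ?thesis by (simp only: theta_comp_ver[OF g h I(3,4)] k_def)
  qed
  also have "compose {..entry p l} (ver (theta_comp h g) j) (ver f i) =
      ver (theta_comp (theta_comp h g) f) j"
    by (simp only: theta_comp_ver[OF f hg l j2] si)
  finally show "ver (theta_comp h (theta_comp g f)) j = ver (theta_comp (theta_comp h g) f) j" .
qed

lemma category_Theta2: "category Theta2"
  unfolding category_def Theta2_def
  by (auto simp: theta_comp_in theta_id_in theta_comp_id theta_comp_assoc dest: theta_homD(1,2))

lemma category_Delta: "category Delta"
  unfolding category_def Delta_def
  by (auto simp: ord_id_in ord_maps_id ord_maps_comp ord_maps_assoc)

subsection \<open>The cellular sets and maps above are well-defined\<close>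

lemma presheafD:
  assumes "is_presheaf C X"
  shows "\<And>a b f x. f \<in> Hom C a b \<Longrightarrow> x \<in> cells X b \<Longrightarrow> act X f x \<in> cells X a"
    "\<And>a x. x \<in> cells X a \<Longrightarrow> act X (idm C a) x = x"
    "\<And>a b c f g x. f \<in> Hom C a b \<Longrightarrow> g \<in> Hom C b c \<Longrightarrow> x \<in> cells X c \<Longrightarrow>
        act X (Comp C g f) x = act X f (act X g x)"
  using assms unfolding is_presheaf_def by blast+

lemma is_presheaf_sub:
  assumes "is_presheaf Theta2 X" "is_subfunctor Theta2 X A"
  shows "is_presheaf Theta2 (sub_cellular_set X A)"
  using assms unfolding is_presheaf_def is_subfunctor_def sub_cellular_set_def
  by simp (meson subsetD)

lemma inclusion_in_maps:
  assumes "is_presheaf Theta2 X" "is_subfunctor Theta2 X A"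
  shows "inclusion X A \<in> maps (sub_cellular_set X A) X"
  using assms is_presheaf_sub[OF assms]
  by (auto simp: maps_def inclusion_def sub_cellular_set_def is_subfunctor_def)

lemma is_subfunctor_generated:
  assumes X: "is_presheaf C X" and G: "\<And>a. G a \<subseteq> cells X a"
  shows "is_subfunctor C X (generated_by C X G)"
proof -
  have "is_subfunctor C X (cells X)" using presheafD[OF X] by (auto simp: is_subfunctor_def)
  with G have "generated_by C X G a \<subseteq> cells X a" for a
    unfolding generated_by_def by blast
  moreover have "act X f x \<in> generated_by C X G a"
    if "f \<in> Hom C a b" "x \<in> generated_by C X G b" for a b f x
    using that unfolding generated_by_def is_subfunctor_def by blast
  ultimately show ?thesis by (auto simp: is_subfunctor_def)
qed

lemma is_presheaf_Theta_rep: "is_presheaf Theta2 (Theta_rep q)"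
  unfolding is_presheaf_def Theta_rep_def Theta2_def
  by (auto simp: theta_comp_in theta_comp_id theta_comp_assoc)

lemma theta_to_delta_functor:
  "theta_to_delta (theta_id q) = idm Delta (length q)"
  "f \<in> theta_hom p q \<Longrightarrow> theta_to_delta f \<in> Hom Delta (length p) (length q)"
  "f \<in> theta_hom p q \<Longrightarrow> g \<in> theta_hom q r \<Longrightarrow>
    theta_to_delta (theta_comp g f) = Comp Delta (theta_to_delta g) (theta_to_delta f)"
  by (auto simp: theta_to_delta_def theta_id_def Delta_def theta_hom_def)

lemma is_presheaf_cellular:
  assumes "is_presheaf Delta X"
  shows "is_presheaf Theta2 (cellular_of_simplicial X)"
  using presheafD[OF assms]
  unfolding is_presheaf_def cellular_of_simplicial_def Theta2_def
  by (auto simp: theta_to_delta_functor(1) dest: theta_to_delta_functor(2))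
    (metis theta_to_delta_functor(2,3))

lemma is_presheaf_J_simplicial: "is_presheaf Delta J_simplicial"
  unfolding is_presheaf_def J_simplicial_def Delta_def
  by (auto simp: compose_def ord_maps_def ord_id_def fun_eq_iff PiE_iff extensional_def
      intro!: imageI split: if_splits)

lemma is_presheaf_J: "is_presheaf Theta2 J"
  unfolding J_def by (intro is_presheaf_cellular is_presheaf_J_simplicial)

lemma e_map_in_maps: "(e_map :: 'u univ cellular_map) \<in> maps (Theta_rep []) J"
proof -
  let ?v = "Simp (\<lambda>i\<in>{..0}. Lozenge) :: 'u univ"
  have v: "?v \<in> cells J []"
    by (auto simp: J_def cellular_of_simplicial_def J_simplicial_def simp del: atMost_0)
  note P = presheafD[OF is_presheaf_J]
  have "app (e_map :: 'u univ cellular_map) q \<in> cells (Theta_rep []) q \<rightarrow>\<^sub>E cells J q" for q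
    using P(1)[OF _ v] by (auto simp: e_map_def Theta_rep_def simp del: atMost_0)
  moreover have "app (e_map :: 'u univ cellular_map) p (act (Theta_rep []) g x) = act J g (app e_map q x)"
    if g: "g \<in> Hom Theta2 p q" and x: "x \<in> cells (Theta_rep []) q" for p q g and x :: "'u univ"
  proof -
    obtain f where f: "f \<in> Hom Theta2 q []" "x = Mor f" using x by (auto simp: Theta_rep_def)
    then show ?thesis
      using presheafD(1)[OF is_presheaf_Theta_rep g x] x P(3)[OF g f(1) v]
      by (simp add: e_map_def Theta_rep_def del: atMost_0)
  qed
  ultimately show ?thesis
    using is_presheaf_J is_presheaf_Theta_rep unfolding maps_def
    by (intro CollectI conjI allI impI) (simp_all add: e_map_def)
qed

lemma is_subfunctor_boundary: "is_subfunctor Theta2 (Theta_rep q) (boundary q :: _ \<Rightarrow> 'u univ set)"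
proof -
  have "act (Theta_rep q) \<phi> x \<in> boundary q a"
    if \<phi>: "\<phi> \<in> theta_hom a b" and x: "x \<in> boundary q b" for a b \<phi> and x :: "'u univ"
  proof -
    obtain f g r where x: "x = Mor (theta_comp g f)" "f \<in> theta_hom b r" "g \<in> theta_hom r q"
      "dim r < dim q"
      using x by (auto simp: boundary_def Theta2_def)
    have "act (Theta_rep q) \<phi> x = Mor (theta_comp g (theta_comp f \<phi>))"
      using theta_comp_assoc[OF \<phi> x(2,3)] by (simp add: x Theta_rep_def Theta2_def)
    with theta_comp_in[OF \<phi> x(2)] x(3,4) show ?thesis
      unfolding boundary_def Theta2_def by auto
  qed
  moreover have "(boundary q a :: 'u univ set) \<subseteq> cells (Theta_rep q) a" for a
    by (auto simp: boundary_def Theta_rep_def Theta2_def theta_comp_in)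
  ultimately show ?thesis by (simp add: is_subfunctor_def Theta2_def)
qed

lemma boundary_inclusion_in_maps:
  "boundary_inclusion q \<in> maps (sub_cellular_set (Theta_rep q) (boundary q)) (Theta_rep q)"
  unfolding boundary_inclusion_def
  by (intro inclusion_in_maps is_presheaf_Theta_rep is_subfunctor_boundary)

subsection \<open>Leibniz products of monomorphisms exist\<close>

lemma mapsD:
  assumes "f \<in> maps X Y"
  shows "src f = X" "tgt f = Y" "is_presheaf Theta2 X" "is_presheaf Theta2 Y"
    "\<And>q x. x \<in> cells X q \<Longrightarrow> app f q x \<in> cells Y q"
    "\<And>q. app f q \<in> extensional (cells X q)"
    "\<And>p q g x. g \<in> Hom Theta2 p q \<Longrightarrow> x \<in> cells X q \<Longrightarrow> app f p (act X g x) = act Y g (app f q x)"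
  using assms unfolding maps_def by (auto simp: PiE_iff)

lemma mapsI:
  assumes "src f = X" "tgt f = Y" "is_presheaf Theta2 X" "is_presheaf Theta2 Y"
    "\<And>q x. x \<in> cells X q \<Longrightarrow> app f q x \<in> cells Y q"
    "\<And>q. app f q \<in> extensional (cells X q)"
    "\<And>p q g x. g \<in> Hom Theta2 p q \<Longrightarrow> x \<in> cells X q \<Longrightarrow> app f p (act X g x) = act Y g (app f q x)"
  shows "f \<in> maps X Y"
  using assms unfolding maps_def by (auto simp: PiE_iff)

lemma map_eqI:
  assumes "f \<in> maps X Y" "g \<in> maps X Y" "\<And>q x. x \<in> cells X q \<Longrightarrow> app f q x = app g q x"
  shows "f = g"
proof -
  have "app f q = app g q" for q
    using assms(3) mapsD(6)[OF assms(1)] mapsD(6)[OF assms(2)] by (rule extensionalityI[rotated 2])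
  then show ?thesis using mapsD(1,2)[OF assms(1)] mapsD(1,2)[OF assms(2)]
    by (intro cellular_map.equality) auto
qed

lemma cid_in_maps: "is_presheaf Theta2 X \<Longrightarrow> cid X \<in> maps X X"
  using presheafD(1)[of Theta2 X] by (intro mapsI) (auto simp: cid_def)

lemma ccomp_in_maps:
  assumes f: "f \<in> maps X Y" and g: "g \<in> maps Y Z"
  shows "g \<odot> f \<in> maps X Z"
  using presheafD(1)[OF mapsD(3)[OF f]]
  by (intro mapsI) (auto simp: ccomp_def compose_def mapsD[OF f] mapsD[OF g])

lemma ccomp_app: "x \<in> cells (src f) q \<Longrightarrow> app (g \<odot> f) q x = app g q (app f q x)"
  by (simp add: ccomp_def compose_def)

lemma cprod_cells: "Pair x y \<in> cells (X \<otimes> Y) q \<longleftrightarrow> x \<in> cells X q \<and> y \<in> cells Y q"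
  by (auto simp: cprod_def)

lemma cprod_cellsE:
  assumes "z \<in> cells (X \<otimes> Y) q"
  obtains x y where "z = Pair x y" "x \<in> cells X q" "y \<in> cells Y q"
  using assms by (auto simp: cprod_def)

lemma cprod_act [simp]: "act (X \<otimes> Y) f (Pair x y) = Pair (act X f x) (act Y f y)"
  by (simp add: cprod_def)

lemma is_presheaf_cprod:
  assumes "is_presheaf Theta2 X" "is_presheaf Theta2 Y"
  shows "is_presheaf Theta2 (X \<otimes> Y)"
  using presheafD[OF assms(1)] presheafD[OF assms(2)]
  unfolding is_presheaf_def by (auto elim!: cprod_cellsE simp: cprod_cells)

lemma cprod_map_app:
  "x \<in> cells (src f) q \<Longrightarrow> y \<in> cells (src g) q \<Longrightarrow>
    app (f \<otimes>\<^sub>m g) q (Pair x y) = Pair (app f q x) (app g q y)"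
  by (simp add: cprod_map_def cprod_cells)

lemma cprod_map_in_maps:
  assumes f: "f \<in> maps X Y" and g: "g \<in> maps X' Y'"
  shows "f \<otimes>\<^sub>m g \<in> maps (X \<otimes> X') (Y \<otimes> Y')"
proof -
  note F = mapsD[OF f] and G = mapsD[OF g]
  have app: "app (f \<otimes>\<^sub>m g) q (Pair x y) = Pair (app f q x) (app g q y)"
    if "x \<in> cells X q" "y \<in> cells X' q" for x y q
    using that F(1) G(1) by (simp add: cprod_map_app)
  show ?thesis
  proof (rule mapsI)
    show "src (f \<otimes>\<^sub>m g) = X \<otimes> X'" "tgt (f \<otimes>\<^sub>m g) = Y \<otimes> Y'"
      using F G by (simp_all add: cprod_map_def)
    show "app (f \<otimes>\<^sub>m g) q \<in> extensional (cells (X \<otimes> X') q)" for q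
      using F G by (simp add: cprod_map_def)
    show "app (f \<otimes>\<^sub>m g) q z \<in> cells (Y \<otimes> Y') q" if "z \<in> cells (X \<otimes> X') q" for q z
      using that by (rule cprod_cellsE) (simp add: app F G cprod_cells)
    show "app (f \<otimes>\<^sub>m g) p (act (X \<otimes> X') k z) = act (Y \<otimes> Y') k (app (f \<otimes>\<^sub>m g) q z)"
      if k: "k \<in> Hom Theta2 p q" and z: "z \<in> cells (X \<otimes> X') q" for p q k z
      using z by (rule cprod_cellsE)
        (simp add: app F(7)[OF k] G(7)[OF k] presheafD(1)[OF F(3) k] presheafD(1)[OF G(3) k])
  qed (intro is_presheaf_cprod F G)+
qed

lemma leibniz_product_mono:
  fixes f g :: "'u univ cellular_map"
  assumes f: "f \<in> maps A B" and g: "g \<in> maps C D"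
    and injf: "\<And>q. inj_on (app f q) (cells A q)" and injg: "\<And>q. inj_on (app g q) (cells C q)"
  shows "is_leibniz_product f g (inclusion (B \<otimes> D)
    (\<lambda>q. {Pair b d | b d. b \<in> cells B q \<and> d \<in> cells D q \<and>
            (b \<in> app f q ` cells A q \<or> d \<in> app g q ` cells C q)}))"
proof -
  note F = mapsD[OF f] and G = mapsD[OF g]
  define M where "M q = {Pair b d | b d. b \<in> cells B q \<and> d \<in> cells D q \<and>
            (b \<in> app f q ` cells A q \<or> d \<in> app g q ` cells C q)}" for q
  define P where "P = sub_cellular_set (B \<otimes> D) M"
  have BD: "is_presheaf Theta2 (B \<otimes> D)" by (intro is_presheaf_cprod F G)
  have imf: "act B k b \<in> app f p ` cells A p" if "k \<in> Hom Theta2 p q" "b \<in> app f q ` cells A q" for k p q b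
    using that(2) by (auto simp: F(7)[OF that(1), symmetric] presheafD(1)[OF F(3) that(1)])
  have img: "act D k d \<in> app g p ` cells C p" if "k \<in> Hom Theta2 p q" "d \<in> app g q ` cells C q" for k p q d
    using that(2) by (auto simp: G(7)[OF that(1), symmetric] presheafD(1)[OF G(3) that(1)])
  have sub: "is_subfunctor Theta2 (B \<otimes> D) M"
    unfolding is_subfunctor_def
  proof (intro conjI allI impI)
    show "M a \<subseteq> cells (B \<otimes> D) a" for a by (auto simp: M_def cprod_cells)
    fix a b k x assume k: "k \<in> Hom Theta2 a b" and x: "x \<in> M b"
    then show "act (B \<otimes> D) k x \<in> M a"
      using presheafD(1)[OF F(4) k] presheafD(1)[OF G(4) k] imf[OF k] img[OF k]
      unfolding M_def by (auto simp del: image_iff)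
  qed
  have cellsP: "cells P = M" "act P = act (B \<otimes> D)" by (simp_all add: P_def sub_cellular_set_def)
  have Pp: "is_presheaf Theta2 P" unfolding P_def by (intro is_presheaf_sub BD sub)
  have lift: "u\<lparr>tgt := P\<rparr> \<in> maps X P"
    if u: "u \<in> maps X (B \<otimes> D)" and M: "\<And>q x. x \<in> cells X q \<Longrightarrow> app u q x \<in> M q" for u X
    using mapsD[OF u] M Pp by (intro mapsI) (simp_all add: cellsP)
  have fD: "f \<otimes>\<^sub>m cid D \<in> maps (A \<otimes> D) (B \<otimes> D)" and Bg: "cid B \<otimes>\<^sub>m g \<in> maps (B \<otimes> C) (B \<otimes> D)"
    and Ag: "cid A \<otimes>\<^sub>m g \<in> maps (A \<otimes> C) (A \<otimes> D)" and fC: "f \<otimes>\<^sub>m cid C \<in> maps (A \<otimes> C) (B \<otimes> C)"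
    by (intro cprod_map_in_maps cid_in_maps f g F G)+
  have cid [simp]: "src (cid X) = X" "x \<in> cells X q \<Longrightarrow> app (cid X) q x = x" for X :: "'u univ cellular_set" and x q
    by (simp_all add: cid_def)
  define i where "i = (f \<otimes>\<^sub>m cid D)\<lparr>tgt := P\<rparr>"
  define j where "j = (cid B \<otimes>\<^sub>m g)\<lparr>tgt := P\<rparr>"
  define h where "h = inclusion (B \<otimes> D) M"
  have iapp: "app i q (Pair a d) = Pair (app f q a) d" if "a \<in> cells A q" "d \<in> cells D q" for a d q
    using that F(1) by (simp add: i_def cprod_map_app)
  have japp: "app j q (Pair b c) = Pair b (app g q c)" if "b \<in> cells B q" "c \<in> cells C q" for b c q
    using that G(1) by (simp add: j_def cprod_map_app)
  have Agapp: "app (cid A \<otimes>\<^sub>m g) q (Pair a c) = Pair a (app g q c)" if "a \<in> cells A q" "c \<in> cells C q" for a c q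
    using that G(1) by (simp add: cprod_map_app)
  have fCapp: "app (f \<otimes>\<^sub>m cid C) q (Pair a c) = Pair (app f q a) c" if "a \<in> cells A q" "c \<in> cells C q" for a c q
    using that F(1) by (simp add: cprod_map_app)
  have i: "i \<in> maps (A \<otimes> D) P" unfolding i_def
    by (intro lift fD) (erule cprod_cellsE, simp add: iapp[unfolded i_def, simplified] M_def F(5))
  have j: "j \<in> maps (B \<otimes> C) P" unfolding j_def
    by (intro lift Bg) (erule cprod_cellsE, simp add: japp[unfolded j_def, simplified] M_def G(5))
  have h: "h \<in> maps P (B \<otimes> D)" unfolding h_def P_def by (intro inclusion_in_maps BD sub)
  have happ: "app h q z = z" if "z \<in> M q" for q z using that by (simp add: h_def inclusion_def)
  have hi: "h \<odot> i = f \<otimes>\<^sub>m cid D"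
  proof (rule map_eqI[OF ccomp_in_maps[OF i h] fD])
    fix q z assume z: "z \<in> cells (A \<otimes> D) q"
    then show "app (h \<odot> i) q z = app (f \<otimes>\<^sub>m cid D) q z"
      using mapsD(5)[OF i z] mapsD(1)[OF i] by (simp add: ccomp_app happ cellsP) (simp add: i_def)
  qed
  have hj: "h \<odot> j = cid B \<otimes>\<^sub>m g"
  proof (rule map_eqI[OF ccomp_in_maps[OF j h] Bg])
    fix q z assume z: "z \<in> cells (B \<otimes> C) q"
    then show "app (h \<odot> j) q z = app (cid B \<otimes>\<^sub>m g) q z"
      using mapsD(5)[OF j z] mapsD(1)[OF j] by (simp add: ccomp_app happ cellsP) (simp add: j_def)
  qed
  have comm: "i \<odot> (cid A \<otimes>\<^sub>m g) = j \<odot> (f \<otimes>\<^sub>m cid C)"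
  proof (rule map_eqI[OF ccomp_in_maps[OF Ag i] ccomp_in_maps[OF fC j]])
    fix q z assume "z \<in> cells (A \<otimes> C) q"
    then show "app (i \<odot> (cid A \<otimes>\<^sub>m g)) q z = app (j \<odot> (f \<otimes>\<^sub>m cid C)) q z"
      by (elim cprod_cellsE)
        (simp add: ccomp_app mapsD(1)[OF Ag] mapsD(1)[OF fC] cprod_cells Agapp fCapp iapp japp F(5) G(5))
  qed
  have "\<exists>!k. k \<in> maps P Q \<and> k \<odot> i = u \<and> k \<odot> j = v"
    if u: "u \<in> maps (A \<otimes> D) Q" and v: "v \<in> maps (B \<otimes> C) Q"
      and uv: "u \<odot> (cid A \<otimes>\<^sub>m g) = v \<odot> (f \<otimes>\<^sub>m cid C)" for Q u v
  proof -
    note U = mapsD[OF u] and V = mapsD[OF v]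
    have uv': "app u q (Pair a (app g q c)) = app v q (Pair (app f q a) c)"
      if "a \<in> cells A q" "c \<in> cells C q" for a c q
      using arg_cong[OF uv, of "\<lambda>w. app w q (Pair a c)"] that
      by (simp add: ccomp_app mapsD(1)[OF Ag] mapsD(1)[OF fC] cprod_cells Agapp fCapp)
    define k where "k = \<lparr>src = P, tgt = Q, app = (\<lambda>q. \<lambda>z\<in>M q.
      if pfst z \<in> app f q ` cells A q then app u q (Pair (inv_into (cells A q) (app f q) (pfst z)) (psnd z))
      else app v q (Pair (pfst z) (inv_into (cells C q) (app g q) (psnd z))))\<rparr>"
    have k1: "app k q (Pair (app f q a) d) = app u q (Pair a d)" if "a \<in> cells A q" "d \<in> cells D q" for a d q
      using that F(5) injf by (auto simp: k_def M_def)
    have k2: "app k q (Pair b (app g q c)) = app v q (Pair b c)" if "b \<in> cells B q" "c \<in> cells C q" for b c q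
    proof (cases "b \<in> app f q ` cells A q")
      case True
      then show ?thesis using k1 uv' G(5) that by force
    next
      case False
      then show ?thesis using that G(5) injg by (auto simp: k_def M_def)
    qed
    have Mcases: "(\<exists>a d. a \<in> cells A q \<and> d \<in> cells D q \<and> z = Pair (app f q a) d) \<or>
        (\<exists>b c. b \<in> cells B q \<and> c \<in> cells C q \<and> z = Pair b (app g q c))" if "z \<in> M q" for z q
      using that by (auto simp: M_def)
    have k: "k \<in> maps P Q"
    proof (rule mapsI)
      show "app k q z \<in> cells Q q" if "z \<in> cells P q" for q z
        using Mcases[of z q] that U(5) V(5) by (auto simp: cellsP k1 k2 cprod_cells)
      show "app k p (act P t z) = act Q t (app k q z)"
        if t: "t \<in> Hom Theta2 p q" and z: "z \<in> cells P q" for p q t z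
        using Mcases[OF z[unfolded cellsP]] unfolding cellsP
      proof (elim disjE exE conjE)
        fix a d assume ad: "a \<in> cells A q" "d \<in> cells D q" "z = Pair (app f q a) d"
        then show "app k p (act (B \<otimes> D) t z) = act Q t (app k q z)"
          using U(7)[OF t, of "Pair a d"] presheafD(1)[OF F(3) t ad(1)] presheafD(1)[OF G(4) t ad(2)]
          by (simp add: k1 F(7)[OF t, symmetric] cprod_cells)
      next
        fix b c assume bc: "b \<in> cells B q" "c \<in> cells C q" "z = Pair b (app g q c)"
        then show "app k p (act (B \<otimes> D) t z) = act Q t (app k q z)"
          using V(7)[OF t, of "Pair b c"] presheafD(1)[OF F(4) t bc(1)] presheafD(1)[OF G(3) t bc(2)]
          by (simp add: k2 G(7)[OF t, symmetric] cprod_cells)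
      qed
    qed (use Pp U in \<open>simp_all add: k_def cellsP\<close>)
    have ki: "k \<odot> i = u"
      by (rule map_eqI[OF ccomp_in_maps[OF i k] u], erule cprod_cellsE)
        (simp add: ccomp_app mapsD(1)[OF i] cprod_cells iapp k1)
    have kj: "k \<odot> j = v"
      by (rule map_eqI[OF ccomp_in_maps[OF j k] v], erule cprod_cellsE)
        (simp add: ccomp_app mapsD(1)[OF j] cprod_cells japp k2)
    have "k' = k" if k': "k' \<in> maps P Q" "k' \<odot> i = u" "k' \<odot> j = v" for k'
    proof (rule map_eqI[OF k'(1) k])
      fix q z assume z: "z \<in> cells P q"
      show "app k' q z = app k q z" using Mcases[OF z[unfolded cellsP]]
      proof (elim disjE exE conjE)
        fix a d assume ad: "a \<in> cells A q" "d \<in> cells D q" "z = Pair (app f q a) d"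
        have "app (k' \<odot> i) q (Pair a d) = app (k \<odot> i) q (Pair a d)" using k' ki by simp
        then show ?thesis using ad by (simp add: ccomp_app mapsD(1)[OF i] cprod_cells iapp)
      next
        fix b c assume bc: "b \<in> cells B q" "c \<in> cells C q" "z = Pair b (app g q c)"
        have "app (k' \<odot> j) q (Pair b c) = app (k \<odot> j) q (Pair b c)" using k' kj by simp
        then show ?thesis using bc by (simp add: ccomp_app mapsD(1)[OF j] cprod_cells japp)
      qed
    qed
    with k ki kj show ?thesis by blast
  qed
  then have "is_pushout (cid A \<otimes>\<^sub>m g) (f \<otimes>\<^sub>m cid C) i j"
    unfolding is_pushout_def using Ag fC i j comm by blast
  then have "is_leibniz_product f g h"
    unfolding is_leibniz_product_def using f g i j h hi hj by blast
  then show ?thesis unfolding h_def M_def .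
qed

lemma leibniz_product_exists:
  "\<exists>h. is_leibniz_product (e_map :: 'u univ cellular_map) (boundary_inclusion q) h"
proof -
  let ?e = "e_map :: 'u univ cellular_map"
  have e: "inj_on (app ?e p) (cells (Theta_rep []) p)" for p
  proof (rule inj_onI)
    fix x y :: "'u univ" assume "x \<in> cells (Theta_rep []) p" "y \<in> cells (Theta_rep []) p"
    moreover have "f = g" if f: "f \<in> theta_hom p []" and g: "g \<in> theta_hom p []" for f g
    proof (rule theta_eqI[OF f g])
      show "hor f i = hor g i" if "i \<le> length p" for i
        using ord_maps_le[OF theta_homD(3)[OF f] that] ord_maps_le[OF theta_homD(3)[OF g] that] by simp
      show "ver f k = ver g k" if "1 \<le> l" "l \<le> length p" "hor f (l - 1) < k" "k \<le> hor f l" for l k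
        using that ord_maps_le[OF theta_homD(3)[OF f], of l] by simp
    qed
    ultimately show "x = y" by (auto simp: Theta_rep_def Theta2_def)
  qed
  have *: "inj_on (app (boundary_inclusion q :: 'u univ cellular_map) p) (boundary q p)" for p
    by (auto simp: boundary_inclusion_def inclusion_def inj_on_def)
  show ?thesis
    by (rule exI, rule leibniz_product_mono[OF e_map_in_maps boundary_inclusion_in_maps e])
      (simp add: * sub_cellular_set_def)
qed

subsection \<open>Hyperfaces are morphisms of codimension 1\<close>

lemma coface_in: "1 \<le> n \<Longrightarrow> i \<le> n \<Longrightarrow> coface n i \<in> ord_maps (n - 1) n"
  by (auto simp: coface_def ord_maps_def mono_on_def)

lemma coface_val: "j \<le> n - 1 \<Longrightarrow> coface n i j = (if j < i then j else Suc j)"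
  by (simp add: coface_def)

lemma hface_first_in:
  assumes "1 \<le> length q"
  shows "hface_first q \<in> theta_hom (tl q) q"
proof -
  have "ver (hface_first q) k \<in> ord_maps (entry (tl q) l) (entry q k)"
    if "1 \<le> l" "l \<le> length q - 1" "hor (hface_first q) (l - 1) < k" "k \<le> hor (hface_first q) l" for l k
  proof -
    have "k = l + 1" "l + 1 \<le> length q" using that by (auto simp: hface_first_def coface_val)
    then show ?thesis using that ord_id_in[of "q ! l"] by (simp add: hface_first_def nth_tl)
  qed
  moreover have "hor (hface_first q) 0 = 1" "hor (hface_first q) (length q - 1) = length q"
    using assms by (auto simp: hface_first_def coface_val)
  moreover have "ver (hface_first q) \<in> extensional {1<..length q}" "tcod (hface_first q) = q"
    "tdom (hface_first q) = tl q" "hor (hface_first q) \<in> ord_maps (length q - 1) (length q)"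
    using assms by (simp_all add: hface_first_def coface_in[of _ 0, simplified])
  ultimately show ?thesis unfolding theta_hom_def by simp
qed

lemma hface_last_in:
  assumes "1 \<le> length q"
  shows "hface_last q \<in> theta_hom (butlast q) q"
proof -
  have "ver (hface_last q) k \<in> ord_maps (entry (butlast q) l) (entry q k)"
    if "1 \<le> l" "l \<le> length q - 1" "hor (hface_last q) (l - 1) < k" "k \<le> hor (hface_last q) l" for l k
  proof -
    have "l < length q" using that by linarith
    then have "k = l" using that by (auto simp: hface_last_def coface_val split: if_splits)
    then show ?thesis using that ord_id_in[of "q ! (l - 1)"] by (simp add: hface_last_def nth_butlast)
  qed
  moreover have "hor (hface_last q) 0 = 0" "hor (hface_last q) (length q - 1) = length q - 1"
    using assms by (auto simp: hface_last_def coface_val)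
  moreover have "ver (hface_last q) \<in> extensional {0<..length q - 1}" "tcod (hface_last q) = q"
    "tdom (hface_last q) = butlast q" "hor (hface_last q) \<in> ord_maps (length q - 1) (length q)"
    using assms coface_in[of "length q" "length q"] by (simp_all add: hface_last_def)
  ultimately show ?thesis unfolding theta_hom_def by simp
qed

lemma hface_inner_in:
  assumes k: "1 \<le> k" "k < length q" and b: "(\<beta>, \<beta>') \<in> Shfl (entry q k) (entry q (k + 1))"
  shows "hface_inner q k \<beta> \<beta>' \<in> theta_hom (tdom (hface_inner q k \<beta> \<beta>')) q"
proof -
  let ?f = "hface_inner q k \<beta> \<beta>'"
  let ?p = "take (k - 1) q @ [entry q k + entry q (k + 1)] @ drop (k + 1) q"
  have p: "tdom ?f = ?p" "length ?p = length q - 1"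
    using k by (auto simp: hface_inner_def)
  have B: "\<beta> \<in> ord_maps (entry q k + entry q (k + 1)) (entry q k)"
    "\<beta>' \<in> ord_maps (entry q k + entry q (k + 1)) (entry q (k + 1))"
    using b by (auto simp: Shfl_def)
  have h: "hor ?f i = (if i < k then i else Suc i)" if "i \<le> length q - 1" for i
    using that by (simp add: hface_inner_def coface_val)
  have "ver ?f j \<in> ord_maps (entry ?p l) (entry q j)"
    if l: "1 \<le> l" "l \<le> length q - 1" and j: "hor ?f (l - 1) < j" "j \<le> hor ?f l" for l j
  proof -
    have v: "ver ?f j = (if j = k then \<beta> else if j = k + 1 then \<beta>' else ord_id (entry q j))"
      using j l h[of l] by (auto simp: hface_inner_def split: if_splits)
    have j': "(if l - 1 < k then l - 1 else l) < j" "j \<le> (if l < k then l else Suc l)"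
      using j l h[of l] h[of "l - 1"] by (auto split: if_splits)
    consider "l < k" | "l = k" | "l > k" by linarith
    then show ?thesis
    proof cases
      case 1
      then have "l - 1 < k" by simp
      with 1 have "j = l" "entry ?p l = entry q l" using j' l by (auto simp: nth_append)
      then show ?thesis using 1 v ord_id_in by simp
    next
      case 2
      then have "j = k \<or> j = k + 1" "entry ?p l = entry q k + entry q (k + 1)"
        using j' l k by (auto simp: nth_append)
      then show ?thesis using 2 v B by auto
    next
      case 3
      then have "\<not> l - 1 < k" "l - k = Suc (l - k - 1)" "Suc (k + (l - k - 1)) = l"
        "\<not> l - 1 < k - 1" by auto
      with 3 have "j = l + 1" "entry ?p l = entry q (l + 1)" using not_less_iff_gr_or_eq[of l k] j' l k
        by (auto simp: nth_append)
      then show ?thesis using 3 v ord_id_in by simp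
    qed
  qed
  moreover have "hor ?f 0 = 0" "hor ?f (length q - 1) = length q" using k h by auto
  moreover have "ver ?f \<in> extensional {0<..length q}" by (simp add: hface_inner_def)
  moreover have "hor ?f \<in> ord_maps (length q - 1) (length q)" "tcod ?f = q"
    using k coface_in[of "length q" k] by (simp_all add: hface_inner_def)
  moreover have "length (tdom ?f) = length q - 1" using p by simp
  ultimately show ?thesis unfolding p(1)[symmetric] theta_hom_def by simp
qed

lemma vface_in:
  assumes k: "1 \<le> k" "k \<le> length q" "entry q k \<ge> 1" "i \<le> entry q k"
  shows "vface q k i \<in> theta_hom (tdom (vface q k i)) q"
proof -
  let ?f = "vface q k i"
  have p: "tdom ?f = q[k - 1 := entry q k - 1]" by (simp add: vface_def)
  have h: "hor ?f i = i" if "i \<le> length q" for i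
    using that by (simp add: vface_def ord_id_def)
  have "ver ?f j \<in> ord_maps (entry (tdom ?f) l) (entry q j)"
    if l: "1 \<le> l" "l \<le> length q" and j: "hor ?f (l - 1) < j" "j \<le> hor ?f l" for l j
  proof -
    have "j = l" using l j h[of l] h[of "l - 1"] by simp
    then show ?thesis
      using l k coface_in[of "entry q k" i] ord_id_in
      by (auto simp: vface_def nth_list_update)
  qed
  moreover have "hor ?f 0 = 0" "hor ?f (length q) = length q" using h by auto
  moreover have "ver ?f \<in> extensional {0<..length q}" by (simp add: vface_def)
  moreover have "hor ?f \<in> ord_maps (length q) (length q)" "tcod ?f = q"
    by (auto simp: vface_def ord_id_in)
  moreover have "length (tdom ?f) = length q" by (simp add: p)
  ultimately show ?thesis unfolding theta_hom_def by simp
qed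

lemma hyperfaces_in: "f \<in> hyperfaces q \<Longrightarrow> f \<in> theta_hom (tdom f) q"
  unfolding hyperfaces_def horizontal_hyperfaces_def vertical_hyperfaces_def
  using hface_first_in hface_last_in hface_inner_in vface_in
  by (auto dest: theta_homD(1) simp: theta_homD(1)[OF hface_first_in] theta_homD(1)[OF hface_last_in])

lemma hyperfaces_dim: "f \<in> hyperfaces q \<Longrightarrow> dim (tdom f) + 1 = dim q"
proof -
  have 0: "dim (tl q) + 1 = dim q" if "q \<noteq> []" "q ! 0 = 0" 
    using that by (cases q) (auto simp: dim_def)
  have 1: "dim (butlast q) + 1 = dim q" if "q \<noteq> []" "q ! (length q - 1) = 0" 
    using that by (cases q rule: rev_cases) (auto simp: dim_def)
  have 2: "dim (take (k - 1) q @ [entry q k + entry q (k + 1)] @ drop (k + 1) q) + 1 = dim q"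
    if k: "1 \<le> k" "k < length q" for k
  proof -
    have "q = take (k - 1) q @ [entry q k, entry q (k+1)] @ drop (k + 1) q"
      using k id_take_nth_drop[of "k-1" q] Cons_nth_drop_Suc[of k q] by simp
    then have "sum_list q = sum_list (take (k - 1) q) + (entry q k + entry q (k+1)) + sum_list (drop (k + 1) q)"
      by (metis (no_types, lifting) sum_list.append sum_list_simps(2) add.assoc add_0_right sum_list.Nil)
    then show ?thesis using k by (simp add: dim_def)
  qed
  have 3: "dim (q[k - 1 := entry q k - 1]) + 1 = dim q" if "1 \<le> k" "k \<le> length q" "entry q k \<ge> 1" for k
  proof -
    have "k - 1 < length q" using that by simp
    from elem_le_sum_list[OF this] sum_list_update[OF this] that show ?thesis
      by (simp add: dim_def)
  qed
  show "f \<in> hyperfaces q \<Longrightarrow> dim (tdom f) + 1 = dim q"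
    unfolding hyperfaces_def horizontal_hyperfaces_def vertical_hyperfaces_def
      hface_first_def hface_last_def hface_inner_def vface_def
    using 0 1 2 3 by fastforce
qed

lemma is_subfunctor_horn: "is_subfunctor Theta2 (Theta_rep q) (horizontal_horn q k)"
  unfolding horizontal_horn_def
  by (intro is_subfunctor_generated is_presheaf_Theta_rep)
     (auto simp: Theta_rep_def Theta2_def dest: hyperfaces_in)

lemma horn_inclusion_in_maps:
  "inclusion (Theta_rep q) (horizontal_horn q k)
     \<in> maps (sub_cellular_set (Theta_rep q) (horizontal_horn q k)) (Theta_rep q)"
  by (intro inclusion_in_maps is_presheaf_Theta_rep is_subfunctor_horn)

end

theory Submission
  imports Defs "HOL-Library.Countable_Set" "HOL-Library.Sublist"
begin

text \<open>
  A cell of \<open>J \<times> \<Theta>\<^sub>2[n; q]\<close> outside the corner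
  \<open>{\<lozenge>} \<times> \<Theta>\<^sub>2[n; q] \<union> J \<times> \<partial>\<Theta>\<^sub>2[n; q]\<close> is surjective onto \<open>[n; q]\<close>, horizontally and
  vertically, and is not constant at \<open>\<lozenge>\<close> in \<open>J\<close>.  Reading off its vertices
  in \<open>{\<lozenge>, \<bullet>} \<times> [n]\<close> and deleting repetitions gives a word, that is a nonempty alternating word in
  \<open>\<lozenge>, \<bullet>\<close> for each column \<open>0, \<dots>, n\<close>; words correspond to the nondegenerate cells outside
  the corner.  Let \<open>i\<close> be the first column that contains \<open>\<bullet>\<close>.  Inserting or deleting
  a \<open>\<lozenge>\<close>, at the end of column \<open>i\<close> if \<open>i = 0\<close> and at its beginning otherwise, pairs
  off the words.  The distinguished vertex is inner because \<open>n \<ge> 1\<close>, and the smaller word of a pair is the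
  only missing face, so the pair is attached along an inner horizontal horn.  Attach
  the pairs by increasing length of the larger word and, for equal length, by decreasing \<open>i\<close>: every
  other face of the larger word then lies in the corner or belongs to an earlier pair.
\<close>

section \<open>Cell complexes of subobjects\<close>

text \<open>The insertion point depends on i because neither end of the column is safe throughout: a
  \<open>Lozenge\<close> at the beginning of column 0 would be the first vertex, one at the end of
  column n the last, and both would give outer horns. Next to the inserted letter stands a
  \<open>Bullet\<close> of its own column, so one of the two entries around this vertex is 0. Hence
  only one shuffle exists there, and the horizontal faces omitted by the horn reduce to a single
  one.

  The order has to settle one conflict: a face of a larger word may be the smaller word of another
  pair of the same length, for instance after losing the only \<open>Bullet\<close> of column i. Its
  first \<open>Bullet\<close> then lies further right, whence the decreasing order in i.

  \<open>cell\<close> is closed under pushouts and transfinite compositions only. Pairs that could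
  be attached simultaneously are therefore attached one after another, which calls for an injective
  enumeration, and the passage from the corner inclusion to an arbitrary Leibniz product is written
  as a pushout too.\<close>

lemma sub_sub [simp]: "sub_cellular_set (sub_cellular_set X A) B = sub_cellular_set X B"
  by (simp add: sub_cellular_set_def)

lemma sub_sel [simp]:
  "cells (sub_cellular_set X A) = A" "act (sub_cellular_set X A) = act X"
  by (simp_all add: sub_cellular_set_def)

lemma inclusion_sel [simp]:
  "src (inclusion X A) = sub_cellular_set X A" "tgt (inclusion X A) = X"
  "x \<in> A q \<Longrightarrow> app (inclusion X A) q x = x"
  by (simp_all add: inclusion_def)

lemma inclusion_self: "inclusion (sub_cellular_set X A) A = cid (sub_cellular_set X A)"
  by (simp add: inclusion_def cid_def)

lemma subfunctorD:
  assumes "is_subfunctor C X A"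
  shows "x \<in> A a \<Longrightarrow> x \<in> cells X a"
    "f \<in> Hom C a b \<Longrightarrow> x \<in> A b \<Longrightarrow> act X f x \<in> A a"
  using assms unfolding is_subfunctor_def by blast+

lemma is_subfunctor_sub:
  assumes "is_subfunctor C X A" "\<And>q. A q \<subseteq> B q"
  shows "is_subfunctor C (sub_cellular_set X B) A"
  using assms by (auto simp: is_subfunctor_def)

lemma sub_inclusion_in_maps:
  assumes X: "is_presheaf Theta2 X" and A: "is_subfunctor Theta2 X A"
    and B: "is_subfunctor Theta2 X B" and AB: "\<And>q. A q \<subseteq> B q"
  shows "inclusion (sub_cellular_set X B) A \<in> maps (sub_cellular_set X A) (sub_cellular_set X B)"
  using inclusion_in_maps[OF is_presheaf_sub[OF X B] is_subfunctor_sub[OF A AB]] by simp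

lemma ccomp_cid:
  assumes "f \<in> maps X Y"
  shows "f \<odot> cid X = f" "cid Y \<odot> f = f"
proof -
  note F = mapsD[OF assms]
  show "f \<odot> cid X = f"
    by (rule map_eqI[OF ccomp_in_maps[OF cid_in_maps[OF F(3)] assms] assms])
      (simp add: ccomp_def compose_def cid_def)
  show "cid Y \<odot> f = f"
    by (rule map_eqI[OF ccomp_in_maps[OF assms cid_in_maps[OF F(4)]] assms])
      (simp add: ccomp_def compose_def cid_def F)
qed

lemma ccomp_assoc:
  assumes "f \<in> maps X Y" "g \<in> maps Y Z" "h \<in> maps Z W"
  shows "h \<odot> (g \<odot> f) = (h \<odot> g) \<odot> f"
  using mapsD[OF assms(1)] mapsD[OF assms(2)]
    ccomp_in_maps[OF ccomp_in_maps[OF assms(1,2)] assms(3)]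
    ccomp_in_maps[OF assms(1) ccomp_in_maps[OF assms(2,3)]]
  by (intro map_eqI) (auto simp: ccomp_def compose_def)

section \<open>Attaching a representable along a subfunctor\<close>

definition yoneda :: "'u univ cellular_set \<Rightarrow> theta_ob \<Rightarrow> 'u univ \<Rightarrow> 'u univ cellular_map" where
  "yoneda Y p x = \<lparr> src = Theta_rep p, tgt = Y,
     app = (\<lambda>r. \<lambda>z\<in>cells (Theta_rep p) r. act Y (the_mor z) x) \<rparr>"

lemma Theta_rep_cells: "Mor g \<in> cells (Theta_rep p) r \<longleftrightarrow> g \<in> theta_hom r p"
  by (auto simp: Theta_rep_def Theta2_def)

lemma Theta_rep_cellsE:
  assumes "z \<in> cells (Theta_rep p) r"
  obtains g where "z = Mor g" "g \<in> theta_hom r p"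
  using assms by (auto simp: Theta_rep_def Theta2_def)

lemma Theta_rep_act [simp]: "act (Theta_rep p) f (Mor g) = Mor (theta_comp g f)"
  by (simp add: Theta_rep_def Theta2_def)

lemma Hom_Theta2 [simp]: "Hom Theta2 = theta_hom" "Comp Theta2 = theta_comp"
  by (simp_all add: Theta2_def)

text \<open>Hypotheses \<open>in_horn\<close> and \<open>off_horn\<close> say that the preimage of \<open>B\<close> under
  \<open>x : \<Theta>\<^sub>2[p] \<rightarrow> B'\<close> is \<open>H\<close>.\<close>

lemma attach_cell:
  fixes Y :: "'u univ cellular_set"
  assumes Y: "is_presheaf Theta2 Y" and x: "x \<in> cells Y p"
    and H: "is_subfunctor Theta2 (Theta_rep p) H"
    and B: "is_subfunctor Theta2 Y B" and B': "is_subfunctor Theta2 Y B'" and BB': "\<And>r. B r \<subseteq> B' r"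
    and in_horn: "\<And>r g. Mor g \<in> H r \<Longrightarrow> act Y g x \<in> B r"
    and off_horn: "\<And>r g. g \<in> theta_hom r p \<Longrightarrow> Mor g \<notin> H r \<Longrightarrow> act Y g x \<in> B' r - B r"
    and inj: "\<And>r g g'. g \<in> theta_hom r p \<Longrightarrow> g' \<in> theta_hom r p \<Longrightarrow> Mor g \<notin> H r \<Longrightarrow> Mor g' \<notin> H r \<Longrightarrow>
      act Y g x = act Y g' x \<Longrightarrow> g = g'"
    and cover: "\<And>r y. y \<in> B' r \<Longrightarrow> y \<notin> B r \<Longrightarrow> \<exists>g \<in> theta_hom r p. y = act Y g x"
  shows "\<exists>g i. is_pushout (inclusion (Theta_rep p) H) g i (inclusion (sub_cellular_set Y B') B)"
proof -
  let ?T = "Theta_rep p :: 'u univ cellular_set"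
  let ?H = "sub_cellular_set ?T H" and ?B = "sub_cellular_set Y B" and ?B' = "sub_cellular_set Y B'"
  define f where "f = inclusion ?T H"
  define j where "j = inclusion ?B' B"
  define i where "i = (yoneda Y p x)\<lparr>tgt := ?B'\<rparr>"
  define g where "g = \<lparr>src = ?H, tgt = ?B, app = (\<lambda>r. \<lambda>z\<in>H r. act Y (the_mor z) x)\<rparr>"
  note T = is_presheaf_Theta_rep[of p]
  have pB: "is_presheaf Theta2 ?B" and pB': "is_presheaf Theta2 ?B'" and pH: "is_presheaf Theta2 ?H"
    using is_presheaf_sub T Y B B' H by auto
  have act_comp: "act Y (theta_comp h' h) x = act Y h (act Y h' x)"
    if "h \<in> theta_hom a b" "h' \<in> theta_hom b p" for h h' a b
    using presheafD(3)[OF Y _ _ x] that by simp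
  have Hsub: "z \<in> cells ?T r" if "z \<in> H r" for z r
    using subfunctorD(1)[OF H that] .
  have xB': "act Y h x \<in> B' r" if "h \<in> theta_hom r p" for h r
    using in_horn off_horn that BB' by blast
  have f: "f \<in> maps ?H ?T" unfolding f_def by (rule inclusion_in_maps[OF T H])
  have j: "j \<in> maps ?B ?B'" unfolding j_def by (rule sub_inclusion_in_maps[OF Y B B' BB'])
  have i: "i \<in> maps ?T ?B'"
    by (rule mapsI)
      (auto simp: i_def yoneda_def T pB' Theta_rep_cells theta_comp_in xB' act_comp
        elim!: Theta_rep_cellsE)
  have g: "g \<in> maps ?H ?B"
  proof (rule mapsI)
    show "app g r z \<in> cells ?B r" if z: "z \<in> cells ?H r" for r z
    proof -
      obtain h where "z = Mor h" using Theta_rep_cellsE[OF Hsub[OF z[unfolded sub_sel]]] by metis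
      then show ?thesis using z in_horn by (simp add: g_def)
    qed
    show "app g a (act ?H h z) = act ?B h (app g b z)"
      if h: "h \<in> Hom Theta2 a b" and z: "z \<in> cells ?H b" for a b h z
    proof -
      obtain h' where h': "z = Mor h'" "h' \<in> theta_hom b p" using Theta_rep_cellsE[OF Hsub[OF z[unfolded sub_sel]]] by metis
      then show ?thesis using z subfunctorD(2)[OF H h, of z] h act_comp by (auto simp: g_def)
    qed
  qed (auto simp: g_def pB pH)
  have iapp: "app i r (Mor h) = act Y h x" if "h \<in> theta_hom r p" for h r
    using that by (simp add: i_def yoneda_def Theta_rep_cells)
  have comm: "i \<odot> f = j \<odot> g"
  proof (rule map_eqI[OF ccomp_in_maps[OF f i] ccomp_in_maps[OF g j]])
    fix r z assume z: "z \<in> cells ?H r"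
    then obtain h where h: "z = Mor h" "h \<in> theta_hom r p" using Theta_rep_cellsE[OF Hsub[OF z[unfolded sub_sel]]] by metis
    with z show "app (i \<odot> f) r z = app (j \<odot> g) r z"
      using mapsD(1)[OF f] mapsD(1)[OF g] in_horn
      by (simp add: ccomp_app iapp) (simp add: f_def g_def j_def iapp)
  qed
  have "\<exists>!k. k \<in> maps ?B' Q \<and> k \<odot> i = u \<and> k \<odot> j = v"
    if u: "u \<in> maps ?T Q" and v: "v \<in> maps ?B Q" and uv: "u \<odot> f = v \<odot> g" for Q u v
  proof -
    note U = mapsD[OF u] and V = mapsD[OF v]
    have uv': "app u r (Mor h) = app v r (act Y h x)" if "Mor h \<in> H r" for h r
      using arg_cong[OF uv, of "\<lambda>w. app w r (Mor h)"] that mapsD(1)[OF f] mapsD(1)[OF g]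
      by (simp add: ccomp_app) (simp add: f_def g_def)
    \<comment> \<open>Outside \<open>B\<close> the value is read off along a chosen
      \<open>h\<close>. By \<open>off_horn\<close> and \<open>in_horn\<close> every candidate lies
      off \<open>H\<close>, where \<open>inj\<close> leaves only one; on \<open>H\<close> itself
      \<open>uv'\<close> ensures agreement.\<close>
    define k where "k = \<lparr>src = ?B', tgt = Q, app = (\<lambda>r. \<lambda>y\<in>B' r. if y \<in> B r then app v r y
      else app u r (Mor (SOME h. h \<in> theta_hom r p \<and> y = act Y h x)))\<rparr>"
    have k2: "app k r y = app v r y" if "y \<in> B r" for y r
      using that BB' by (auto simp: k_def)
    have k1: "app k r (act Y h x) = app u r (Mor h)" if h: "h \<in> theta_hom r p" for h r
    proof (cases "Mor h \<in> H r")
      case True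
      then show ?thesis using k2 in_horn uv' by simp
    next
      case False
      have "(SOME h'. h' \<in> theta_hom r p \<and> act Y h x = act Y h' x) = h"
      proof (rule some_equality)
        fix h' assume h': "h' \<in> theta_hom r p \<and> act Y h x = act Y h' x"
        then have "Mor h' \<notin> H r" using in_horn off_horn[OF h False] by auto
        then show "h' = h" using inj[OF h, of h'] h' False by auto
      qed (use h in auto)
      then show ?thesis using off_horn[OF h False] by (simp add: k_def)
    qed
    have cases: "y \<in> B r \<or> (\<exists>h\<in>theta_hom r p. y = act Y h x)" if "y \<in> B' r" for y r
      using that cover by blast
    have k: "k \<in> maps ?B' Q"
    proof (rule mapsI)
      show "app k r y \<in> cells Q r" if "y \<in> cells ?B' r" for r y
        using cases[of y r] that V(5) U(5) by (auto simp: k1 k2 Theta_rep_cells)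
      show "app k a (act ?B' h y) = act Q h (app k b y)"
        if h: "h \<in> Hom Theta2 a b" and y: "y \<in> cells ?B' b" for a b h y
        using cases[OF y[unfolded sub_sel]]
      proof
        assume "y \<in> B b"
        then show ?thesis using subfunctorD(2)[OF B h] V(7)[OF h] by (simp add: k2)
      next
        assume "\<exists>h\<in>theta_hom b p. y = act Y h x"
        then obtain h' where h': "h' \<in> theta_hom b p" "y = act Y h' x" by blast
        have "app k a (act Y h y) = app u a (Mor (theta_comp h' h))"
          using h h' act_comp[of h a b h'] k1[OF theta_comp_in[of h a b h' p]] by simp
        also have "\<dots> = act Q h (app k b y)"
          using U(7)[OF h, of "Mor h'"] h' by (simp add: Theta_rep_cells k1)
        finally show ?thesis by simp
      qed
    qed (auto simp: k_def pB' U)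
    have ki: "k \<odot> i = u"
      by (rule map_eqI[OF ccomp_in_maps[OF i k] u])
        (auto simp: ccomp_app mapsD(1)[OF i] iapp k1 elim!: Theta_rep_cellsE
          intro!: ccomp_app[THEN trans] simp: Theta_rep_cells)
    have kj: "k \<odot> j = v"
      by (rule map_eqI[OF ccomp_in_maps[OF j k] v])
        (simp add: ccomp_app mapsD(1)[OF j], simp add: j_def k2)
    have "k' = k" if k': "k' \<in> maps ?B' Q" "k' \<odot> i = u" "k' \<odot> j = v" for k'
    proof (rule map_eqI[OF k'(1) k])
      fix r y assume "y \<in> cells ?B' r"
      then have "y \<in> B r \<or> (\<exists>h\<in>theta_hom r p. y = act Y h x)" using cases by simp
      then show "app k' r y = app k r y"
      proof
        assume y: "y \<in> B r"
        then have "app (k' \<odot> j) r y = app k' r y"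
          by (simp add: ccomp_app mapsD(1)[OF j]) (simp add: j_def)
        then show ?thesis using k' y k2 by simp
      next
        assume "\<exists>h\<in>theta_hom r p. y = act Y h x"
        then obtain h where h: "h \<in> theta_hom r p" "y = act Y h x" by blast
        then have "app (k' \<odot> i) r (Mor h) = app k' r y"
          by (simp add: ccomp_app mapsD(1)[OF i] Theta_rep_cells iapp)
        then show ?thesis using k' h k1 by simp
      qed
    qed
    with k ki kj show ?thesis by blast
  qed
  then have "is_pushout f g i j" unfolding is_pushout_def using f g i j comm by blast
  then show ?thesis unfolding f_def j_def by blast
qed

section \<open>Compositions of length one and of length omega\<close>

lemma cid_in_cell:
  fixes X :: "'u univ cellular_set"
  assumes X: "is_presheaf Theta2 X"
  shows "cid X \<in> cell S"
proof -
  \<comment> \<open>The ordinal 1: the composite of a sequence with a single object is its identity.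
    It serves for stages of the filtration at which nothing is attached.\<close>
  let ?r = "{(Atom undefined, Atom undefined)} :: 'u univ rel"
  let ?X = "\<lambda>_. X" and ?t = "\<lambda>_ _. cid X"
  note id = cid_in_maps[OF X]
  have Field: "Field ?r = {Atom undefined}" by (auto simp: Field_def)
  have wo: "Well_order ?r"
    by (auto simp: well_order_on_def linear_order_on_def partial_order_on_def preorder_on_def
        refl_on_def trans_def antisym_def total_on_def Field_def)
  have "is_transfinite_sequence ?r ?X ?t"
    unfolding is_transfinite_sequence_def Field is_limit_def is_least_def
    using wo id by (auto simp: ccomp_cid[OF id] well_order_on_def)
  moreover have "\<forall>a b. is_successor ?r a b \<longrightarrow> ?t a b \<in> cell S"
    by (auto simp: is_successor_def)
  moreover have "is_colimit ?r (Field ?r) ?X ?t X (\<lambda>_. cid X)"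
    unfolding is_colimit_def is_cocone_def Field
    using id by (auto simp: ccomp_cid[OF id] ccomp_cid)
  moreover have "is_least ?r (Atom undefined)"
    by (auto simp: is_least_def Field_def)
  ultimately show ?thesis by (rule cell.transfinite)
qed

lemma infinite_univ: "infinite (UNIV :: 'u univ set)"
proof -
  have "inj (\<lambda>n::nat. Mor (ThMor [n] [] undefined undefined) :: 'u univ)" by (rule injI) simp
  then show ?thesis using finite_subset infinite_UNIV_nat finite_imageD subset_UNIV by metis
qed

text \<open>\<open>cell\<close> composes along well-orders whose elements come from the universe of
  cells, so omega is transported there along an injection \<open>e\<close>. It has no limit
  elements; the only colimit to check is that of the whole chain, and the union of an increasing
  chain of subfunctors is one.\<close>

lemma omega_composition:
  fixes Y :: "'u univ cellular_set"
  assumes Y: "is_presheaf Theta2 Y" and B: "\<And>i::nat. is_subfunctor Theta2 Y (B i)"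
    and mono: "\<And>i r. B i r \<subseteq> B (Suc i) r" and union: "\<And>r. cells Y r \<subseteq> (\<Union>i. B i r)"
    and step: "\<And>i. inclusion (sub_cellular_set Y (B (Suc i))) (B i) \<in> cell S"
  shows "inclusion Y (B 0) \<in> cell S"
proof -
  obtain e :: "nat \<Rightarrow> 'u univ" where e: "inj e"
    using infinite_countable_subset[OF infinite_univ] by blast
  define d where "d = inv e"
  have de [simp]: "d (e i) = i" for i using e by (simp add: d_def)
  define r where "r = dir_image natLeq e"
  have r: "(a, b) \<in> r \<longleftrightarrow> (\<exists>i j. a = e i \<and> b = e j \<and> i \<le> j)" for a b
    by (auto simp: r_def dir_image_def natLeq_def)
  have wo: "Well_order r"
    unfolding r_def by (rule Well_order_dir_image[OF natLeq_Well_order])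
      (use e in \<open>auto simp: inj_on_def\<close>)
  have Field: "Field r = range e"
    unfolding r_def by (simp add: dir_image_Field Field_natLeq)
  have le: "B i q \<subseteq> B j q" if "i \<le> j" for i j q
    using lift_Suc_mono_le[of "\<lambda>i. B i q", OF mono that] .
  define X where "X a = sub_cellular_set Y (B (d a))" for a
  define t where "t a b = inclusion (sub_cellular_set Y (B (d b))) (B (d a))" for a b
  define \<iota> where "\<iota> a = inclusion Y (B (d a))" for a
  have pX: "is_presheaf Theta2 (X a)" for a unfolding X_def by (rule is_presheaf_sub[OF Y B])
  have t: "t a b \<in> maps (X a) (X b)" if "(a, b) \<in> r" for a b
    unfolding t_def X_def by (intro sub_inclusion_in_maps Y B le) (use that r in auto)
  have \<iota>: "\<iota> a \<in> maps (X a) Y" for a unfolding \<iota>_def X_def by (rule inclusion_in_maps[OF Y B])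
  have nolim: "\<not> is_limit r c" for c
  proof
    assume c: "is_limit r c"
    then obtain i where i: "c = e i" unfolding is_limit_def Field by blast
    show False
    proof (cases i)
      case 0
      then show ?thesis using c i unfolding is_limit_def is_least_def Field by (auto simp: r)
    next
      case (Suc i')
      then have "is_successor r (e i') c"
        using i unfolding is_successor_def Field by (auto simp: r inj_eq[OF e] not_less_eq_eq)
      then show ?thesis using c unfolding is_limit_def by blast
    qed
  qed
  have tcomp: "t b c \<odot> t a b = t a c" if "(a, b) \<in> r" "(b, c) \<in> r" for a b c
  proof (rule map_eqI[OF ccomp_in_maps[OF t t] t])
    show "(a, c) \<in> r" using that e by (auto simp: r inj_eq intro: order_trans)
    show "app (t b c \<odot> t a b) q x = app (t a c) q x" if "x \<in> cells (X a) q" for q x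
      using that \<open>(a, b) \<in> r\<close> le
      by (auto simp: t_def X_def r ccomp_app subset_eq)
  qed (use that in auto)
  have "is_transfinite_sequence r X t"
    unfolding is_transfinite_sequence_def
    using wo nolim t tcomp by (auto simp: Field inclusion_self X_def t_def)
  moreover have "\<forall>a b. is_successor r a b \<longrightarrow> t a b \<in> cell S"
  proof (intro allI impI)
    fix a b assume ab: "is_successor r a b"
    then obtain i j where ij: "a = e i" "b = e j" "i \<le> j" "i \<noteq> j" unfolding is_successor_def r by blast
    then have "(e (Suc i), a) \<in> r \<or> (b, e (Suc i)) \<in> r"
      using ab unfolding is_successor_def Field by blast
    then have "j = Suc i" using ij by (auto simp: r inj_eq[OF e])
    then show "t a b \<in> cell S" using step ij by (simp add: t_def)
  qed
  moreover have "is_colimit r (Field r) X t Y \<iota>"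
    unfolding is_colimit_def
  proof (intro conjI allI impI)
    have "\<iota> b \<odot> t a b = \<iota> a" if "(a, b) \<in> r" for a b
    proof (rule map_eqI[OF ccomp_in_maps[OF t[OF that] \<iota>] \<iota>])
      show "app (\<iota> b \<odot> t a b) q x = app (\<iota> a) q x" if "x \<in> cells (X a) q" for q x
        using that \<open>(a, b) \<in> r\<close> le by (auto simp: t_def \<iota>_def X_def r ccomp_app subset_eq)
    qed
    then show "is_cocone r (Field r) X t Y \<iota>" unfolding is_cocone_def using \<iota> by blast
    fix Q u assume "is_cocone r (Field r) X t Q u"
    then have u: "u (e i) \<in> maps (X (e i)) Q"
      and ut': "(e i, e j) \<in> r \<Longrightarrow> u (e j) \<odot> t (e i) (e j) = u (e i)" for i j
      unfolding is_cocone_def Field by blast+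
    have ut: "u (e j) \<odot> t (e i) (e j) = u (e i)" if "i \<le> j" for i j
      using ut' that r by blast
    have uu: "app (u (e j)) q x = app (u (e i)) q x" if "i \<le> j" "x \<in> B i q" for i j q x
      using arg_cong[OF ut[OF that(1)], of "\<lambda>w. app w q x"] that
      by (simp add: ccomp_app t_def)
    \<comment> \<open>The first stage that contains \<open>x\<close>. By \<open>uu\<close> all later
      components of the cocone agree with the one at this stage, so they glue.\<close>
    define m where "m q x = (LEAST i. x \<in> B i q)" for q x
    have m: "x \<in> B (m q x) q" if "x \<in> cells Y q" for q x
      using that union[of q] LeastI[of "\<lambda>i. x \<in> B i q"] unfolding m_def by blast
    have ml: "m q x \<le> i" if "x \<in> B i q" for i q x unfolding m_def using that by (rule Least_le)
    define h where "h = \<lparr>src = Y, tgt = Q, app = (\<lambda>q. \<lambda>x\<in>cells Y q. app (u (e (m q x))) q x)\<rparr>"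
    have happ: "app h q x = app (u (e i)) q x" if "x \<in> B i q" for i q x
      using uu[OF ml[OF that] m] subfunctorD(1)[OF B that] by (simp add: h_def)
    have h: "h \<in> maps Y Q"
    proof (rule mapsI)
      show "app h q x \<in> cells Q q" if "x \<in> cells Y q" for q x
        using mapsD(5)[OF u, of x "m q x" q] m[OF that] happ[OF m[OF that]] by (simp add: X_def)
      show "app h a (act Y f x) = act Q f (app h b x)"
        if f: "f \<in> Hom Theta2 a b" and x: "x \<in> cells Y b" for a b f x
        using mapsD(7)[OF u f, of x "m b x"] m[OF x] happ[OF m[OF x]]
          happ[OF subfunctorD(2)[OF B f m[OF x]]] by (simp add: X_def)
    qed (use Y mapsD(4)[OF u] in \<open>auto simp: h_def\<close>)
    have "h \<odot> \<iota> a = u a" if a: "a \<in> Field r" for a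
    proof -
      obtain i where i: "a = e i" using a Field by blast
      show ?thesis unfolding i
        by (rule map_eqI[OF ccomp_in_maps[OF \<iota> h] u])
          (simp add: ccomp_app \<iota>_def X_def happ)
    qed
    moreover have "k = h" if k: "k \<in> maps Y Q" "\<forall>a\<in>Field r. k \<odot> \<iota> a = u a" for k
    proof (rule map_eqI[OF k(1) h])
      fix q x assume x: "x \<in> cells Y q"
      have "k \<odot> \<iota> (e (m q x)) = u (e (m q x))" using k Field by simp
      then have "app (k \<odot> \<iota> (e (m q x))) q x = app (u (e (m q x))) q x" by simp
      then show "app k q x = app h q x" using m[OF x] happ[OF m[OF x]]
        by (simp add: ccomp_app \<iota>_def)
    qed
    ultimately show "\<exists>!h. h \<in> maps Y Q \<and> (\<forall>a\<in>Field r. h \<odot> \<iota> a = u a)" using h by blast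
  qed
  moreover have "is_least r (e 0)" unfolding is_least_def Field by (auto simp: r)
  ultimately have "\<iota> (e 0) \<in> cell S" by (rule cell.transfinite)
  then show ?thesis by (simp add: \<iota>_def)
qed

section \<open>Independence of the chosen Leibniz product\<close>

lemma pushout_unique:
  assumes 1: "is_pushout f g i j" and 2: "is_pushout f g i' j'"
  shows "\<exists>\<phi> \<psi>. \<phi> \<in> maps (tgt i) (tgt i') \<and> \<psi> \<in> maps (tgt i') (tgt i) \<and>
    \<phi> \<odot> i = i' \<and> \<phi> \<odot> j = j' \<and> \<phi> \<odot> \<psi> = cid (tgt i')"
proof -
  obtain A B C P where f: "f \<in> maps A B" and g: "g \<in> maps A C" and i: "i \<in> maps B P"
    and j: "j \<in> maps C P" and ij: "i \<odot> f = j \<odot> g"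
    and u: "\<And>Q u v. u \<in> maps B Q \<Longrightarrow> v \<in> maps C Q \<Longrightarrow> u \<odot> f = v \<odot> g \<Longrightarrow>
           (\<exists>!h. h \<in> maps P Q \<and> h \<odot> i = u \<and> h \<odot> j = v)"
    using 1 unfolding is_pushout_def by blast
  obtain P' where i': "i' \<in> maps B P'"
    and j': "j' \<in> maps C P'" and ij': "i' \<odot> f = j' \<odot> g"
    and u': "\<And>Q u v. u \<in> maps B Q \<Longrightarrow> v \<in> maps C Q \<Longrightarrow> u \<odot> f = v \<odot> g \<Longrightarrow>
           (\<exists>!h. h \<in> maps P' Q \<and> h \<odot> i' = u \<and> h \<odot> j' = v)"
    using 2 mapsD(1,2)[OF f] mapsD(1,2)[OF g] unfolding is_pushout_def
    by (smt (verit, best) mapsD(1,2))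
  obtain \<phi> where p: "\<phi> \<in> maps P P'" "\<phi> \<odot> i = i'" "\<phi> \<odot> j = j'" using u[OF i' j' ij'] by blast
  obtain \<psi> where s: "\<psi> \<in> maps P' P" "\<psi> \<odot> i' = i" "\<psi> \<odot> j' = j" using u'[OF i j ij] by blast
  have "\<phi> \<odot> \<psi> \<in> maps P' P'" "(\<phi> \<odot> \<psi>) \<odot> i' = i'" "(\<phi> \<odot> \<psi>) \<odot> j' = j'"
    using ccomp_in_maps[OF s(1) p(1)] ccomp_assoc[OF i' s(1) p(1)] ccomp_assoc[OF j' s(1) p(1)] p s
    by simp_all
  moreover have "cid P' \<in> maps P' P'" "cid P' \<odot> i' = i'" "cid P' \<odot> j' = j'"
    using cid_in_maps mapsD(4)[OF i'] ccomp_cid i' j' by auto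
  ultimately have "\<phi> \<odot> \<psi> = cid P'" using u'[OF i' j' ij'] by blast
  then show ?thesis using p s mapsD(2)[OF i] mapsD(2)[OF i'] by blast
qed

text \<open>The section \<psi> makes \<open>h\<close> the pushout of \<open>c\<close> along \<phi>,
  with \<open>cid Y\<close> as the other leg: if \<open>u \<odot> c = v \<odot> \<phi>\<close>, then
  composing with \<psi> gives \<open>u \<odot> h = v\<close>, so \<open>u\<close> is the only
  possible induced map. Closure under isomorphism thus becomes an instance of closure under
  pushout.\<close>

lemma cell_precompose_iso:
  assumes c: "c \<in> cell S" and cm: "c \<in> maps A Y" and \<phi>: "\<phi> \<in> maps A P" and \<psi>: "\<psi> \<in> maps P A"
    and inv: "\<phi> \<odot> \<psi> = cid P" and h: "h \<in> maps P Y" and hc: "h \<odot> \<phi> = c"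
  shows "h \<in> cell S"
proof (rule cell.pushout[OF c])
  note id = cid_in_maps[OF mapsD(4)[OF h]]
  have "\<exists>!k. k \<in> maps Y Q \<and> k \<odot> cid Y = u \<and> k \<odot> h = v"
    if u: "u \<in> maps Y Q" and v: "v \<in> maps P Q" and uv: "u \<odot> c = v \<odot> \<phi>" for Q u v
  proof -
    have "u \<odot> h = u \<odot> (h \<odot> (\<phi> \<odot> \<psi>))" using inv ccomp_cid[OF h] by simp
    also have "\<dots> = (u \<odot> c) \<odot> \<psi>"
      using ccomp_assoc[OF \<psi> \<phi> h] ccomp_assoc[OF \<psi> cm u] hc by simp
    also have "\<dots> = v" using uv ccomp_assoc[OF \<psi> \<phi> v] inv ccomp_cid[OF v] by simp
    finally have "u \<odot> h = v" .
    then show ?thesis using u ccomp_cid(1) by metis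
  qed
  then show "is_pushout c \<phi> (cid Y) h"
    unfolding is_pushout_def using cm \<phi> h id hc ccomp_cid(2)[OF cm] by blast
qed

lemma leibniz_product_cell:
  assumes h: "is_leibniz_product f g h" and h': "is_leibniz_product f g h'" and c: "h' \<in> cell S"
  shows "h \<in> cell S"
proof -
  obtain A B C D P i j where 1: "f \<in> maps A B" "g \<in> maps C D"
    and po: "is_pushout (cid A \<otimes>\<^sub>m g) (f \<otimes>\<^sub>m cid C) i j"
    and i: "i \<in> maps (A \<otimes> D) P" and j: "j \<in> maps (B \<otimes> C) P" and hm: "h \<in> maps P (B \<otimes> D)"
    and hi: "h \<odot> i = f \<otimes>\<^sub>m cid D" and hj: "h \<odot> j = cid B \<otimes>\<^sub>m g"
    using h unfolding is_leibniz_product_def by blast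
  obtain P' i' j' where
        po': "is_pushout (cid A \<otimes>\<^sub>m g) (f \<otimes>\<^sub>m cid C) i' j'"
    and i': "i' \<in> maps (A \<otimes> D) P'" and j': "j' \<in> maps (B \<otimes> C) P'" and hm': "h' \<in> maps P' (B \<otimes> D)"
    and hi': "h' \<odot> i' = f \<otimes>\<^sub>m cid D" and hj': "h' \<odot> j' = cid B \<otimes>\<^sub>m g"
    using h' mapsD(1,2)[OF 1(1)] mapsD(1,2)[OF 1(2)] unfolding is_leibniz_product_def
    by (metis mapsD(1,2))
  obtain \<phi> \<psi> where p: "\<phi> \<in> maps P' P" and s: "\<psi> \<in> maps P P'" and e: "\<phi> \<odot> i' = i" "\<phi> \<odot> j' = j"
    and ps: "\<phi> \<odot> \<psi> = cid P"
    using pushout_unique[OF po' po] mapsD(2)[OF i] mapsD(2)[OF i'] by auto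
  have "h \<odot> \<phi> = h'"
  proof -
    have hp: "h \<odot> \<phi> \<in> maps P' (B \<otimes> D)" by (rule ccomp_in_maps[OF p hm])
    have "(h \<odot> \<phi>) \<odot> i' = h' \<odot> i'" "(h \<odot> \<phi>) \<odot> j' = h' \<odot> j'"
      using ccomp_assoc[OF i' p hm] ccomp_assoc[OF j' p hm] e hi hj hi' hj' by simp_all
    moreover have "\<exists>!k. k \<in> maps P' (B \<otimes> D) \<and> k \<odot> i' = h' \<odot> i' \<and> k \<odot> j' = h' \<odot> j'"
    proof -
      have f': "cid A \<otimes>\<^sub>m g \<in> maps (A \<otimes> C) (A \<otimes> D)" "f \<otimes>\<^sub>m cid C \<in> maps (A \<otimes> C) (B \<otimes> C)"
        by (intro cprod_map_in_maps cid_in_maps 1 mapsD(3)[OF 1(1)] mapsD(3)[OF 1(2)])+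
      have "(h' \<odot> i') \<odot> (cid A \<otimes>\<^sub>m g) = (h' \<odot> j') \<odot> (f \<otimes>\<^sub>m cid C)"
        using po' ccomp_assoc[OF f'(1) i' hm'] ccomp_assoc[OF f'(2) j' hm']
        unfolding is_pushout_def by auto
      then show ?thesis using po' ccomp_in_maps[OF i' hm'] ccomp_in_maps[OF j' hm']
          mapsD(1,2)[OF f'(1)] mapsD(1,2)[OF f'(2)] mapsD(2)[OF i']
        unfolding is_pushout_def by (smt (verit, best) mapsD(1,2))
    qed
    ultimately show ?thesis using hp hm' by blast
  qed
  then show ?thesis using cell_precompose_iso[OF c hm' p s ps hm] by blast
qed

section \<open>Factoring morphisms of \<open>\<Theta>\<^sub>2\<close> through hyperfaces\<close>

lemma ord_mapsI:
  assumes "f \<in> extensional {..m}" "\<And>i. i \<le> m \<Longrightarrow> f i \<le> n" "\<And>i j. i \<le> j \<Longrightarrow> j \<le> m \<Longrightarrow> f i \<le> f j"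
  shows "f \<in> ord_maps m n"
  using assms by (auto simp: ord_maps_def mono_on_def PiE_iff)

lemma ord_maps_ext: "f \<in> ord_maps m n \<Longrightarrow> f \<in> extensional {..m}"
  by (auto simp: ord_maps_def PiE_iff)

lemma ord_maps_eqI:
  assumes "f \<in> ord_maps m n" "g \<in> ord_maps m n" "\<And>i. i \<le> m \<Longrightarrow> f i = g i"
  shows "f = g"
  using assms by (intro extensionalityI[OF ord_maps_ext ord_maps_ext]) auto

text \<open>A lift through \<phi> can be built componentwise: \<open>h\<close> is its horizontal
  part and \<open>v k\<close> its vertical component over column \<open>k\<close> of
  \<open>s\<close>. Each \<open>j\<close> between \<open>hor \<phi> (k - 1)\<close> and
  \<open>hor \<phi> k\<close> imposes one condition on \<open>v k\<close>; at the merged column of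
  an inner horizontal face there are two, which is where shuffles enter.\<close>

lemma theta_factor:
  assumes \<phi>: "\<phi> \<in> theta_hom s p" and f: "f \<in> theta_hom r p"
    and h: "h \<in> ord_maps (length r) (length s)"
    and hor: "\<And>i. i \<le> length r \<Longrightarrow> hor \<phi> (h i) = hor f i"
    and v: "\<And>l k. 1 \<le> l \<Longrightarrow> l \<le> length r \<Longrightarrow> h (l - 1) < k \<Longrightarrow> k \<le> h l \<Longrightarrow>
      v k \<in> ord_maps (entry r l) (entry s k)"
    and ver: "\<And>l k j. 1 \<le> l \<Longrightarrow> l \<le> length r \<Longrightarrow> h (l - 1) < k \<Longrightarrow> k \<le> h l \<Longrightarrow>
      hor \<phi> (k - 1) < j \<Longrightarrow> j \<le> hor \<phi> k \<Longrightarrow> ver f j = compose {..entry r l} (ver \<phi> j) (v k)"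
  shows "\<exists>g \<in> theta_hom r s. hor g = h \<and> f = theta_comp \<phi> g"
proof -
  define g where "g = ThMor r s h (restrict v {h 0 <.. h (length r)})"
  note P = theta_homD[OF \<phi>] and F = theta_homD[OF f]
  have rng: "k \<in> {h 0 <.. h (length r)}"
    if "1 \<le> l" "l \<le> length r" "h (l - 1) < k" "k \<le> h l" for l k
  proof -
    have "l - 1 \<le> length r" using that by simp
    then show ?thesis
      using that ord_maps_mono[OF h, of 0 "l - 1"] ord_maps_mono[OF h, of l "length r"] by auto
  qed
  have g: "g \<in> theta_hom r s"
    unfolding theta_hom_def using h v rng by (auto simp: g_def)
  have "f = theta_comp \<phi> g"
  proof (rule theta_eqI[OF f theta_comp_in[OF g \<phi>]])
    show "hor f i = hor (theta_comp \<phi> g) i" if "i \<le> length r" for i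
      using that hor by (simp add: g_def compose_def)
    fix l j assume l: "1 \<le> l" "l \<le> length r" and j: "hor f (l - 1) < j" "j \<le> hor f l"
    have "l - 1 \<le> length r" using l by simp
    then have j': "hor \<phi> (hor g (l - 1)) < j" "j \<le> hor \<phi> (hor g l)"
      using j l hor[of l] hor[of "l - 1"] by (simp_all add: g_def)
    define k where "k = segment (length s) (hor \<phi>) j"
    have hg: "hor g = h" by (simp add: g_def)
    note S = segment_comp[OF h P(3) l j'[unfolded hg], folded k_def]
    show "ver f j = ver (theta_comp \<phi> g) j"
      unfolding theta_comp_ver[OF g \<phi> l j'] k_def[symmetric]
      using ver[OF l S(1,2,5,6)] rng[OF l S(1,2)] by (simp add: g_def)
  qed
  moreover have "hor g = h" by (simp add: g_def)
  ultimately show ?thesis using g by blast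
qed

text \<open>The maximal chain through the points \<open>(c t, d t)\<close> that moves first in the direction of \<open>a\<close>
  between two consecutive points.\<close>

lemma shuffle_factor:
  assumes c: "c \<in> ord_maps r a" and d: "d \<in> ord_maps r b"
  obtains \<beta> \<beta>' s where "(\<beta>, \<beta>') \<in> Shfl a b" "s \<in> ord_maps r (a + b)"
    "c = compose {..r} \<beta> s" "d = compose {..r} \<beta>' s"
proof -
  \<comment> \<open>\<open>m t\<close> is the largest \<open>x\<close> below \<open>a\<close> and
    \<open>t\<close> such that for each \<open>i\<close> either \<open>x \<le> c i\<close> or the
    height \<open>t - x\<close> is at least \<open>d i\<close>: the chain does not pass column
    \<open>c i\<close> before it has reached height \<open>d i\<close>. The elements
    \<open>a\<close> and \<open>t\<close> of \<open>F t\<close> keep it inside the grid.\<close>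
  define F where "F t = insert a (insert t ((\<lambda>i. max (c i) (t - d i)) ` {..r}))" for t
  have fin: "finite (F t)" and ne: "F t \<noteq> {}" for t by (simp_all add: F_def)
  define m where "m t = Min (F t)" for t
  define s where "s = (\<lambda>i\<in>{..r}. c i + d i)"
  have ma: "m t \<le> a" and mt: "m t \<le> t" for t
    unfolding m_def by (rule Min_le[OF fin], simp add: F_def)+
  have mi: "m t \<le> max (c i) (t - d i)" if "i \<le> r" for t i
    unfolding m_def by (rule Min_le[OF fin]) (use that in \<open>simp add: F_def\<close>)
  have mgeI: "x \<le> m t" if "x \<le> a" "x \<le> t" "\<And>i. i \<le> r \<Longrightarrow> x \<le> max (c i) (t - d i)" for x t
    unfolding m_def using that by (intro Min.boundedI[OF fin ne]) (auto simp: F_def)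
  have m1: "m t \<le> m (Suc t)" for t
    by (rule mgeI) (use ma mt[of t] mi[of _ t] in \<open>auto intro: le_SucI order_trans\<close>, fastforce)
  have m2: "m (Suc t) \<le> Suc (m t)" for t
  proof -
    have "m t \<in> F t" unfolding m_def by (rule Min_in[OF fin ne])
    then show ?thesis unfolding F_def
      using ma[of "Suc t"] mt[of "Suc t"] mi[of _ "Suc t"] by fastforce
  qed
  have mono: "m t \<le> m t'" if "t \<le> t'" for t t'
    by (rule lift_Suc_mono_le[of m, OF _ that]) (rule m1)
  have "t - m t \<le> Suc t - m (Suc t)" for t using m2[of t] by linarith
  then have mono': "t - m t \<le> t' - m t'" if "t \<le> t'" for t t'
    by (rule lift_Suc_mono_le[of "\<lambda>t. t - m t", OF _ that])
  have m0: "m 0 = 0" using mt[of 0] by simp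
  have mab: "m (a + b) = a"
  proof (intro antisym ma mgeI)
    show "a \<le> max (c i) (a + b - d i)" if "i \<le> r" for i using ord_maps_le[OF d that] by simp
  qed auto
  \<comment> \<open>At time \<open>c i + d i\<close> the constraint of \<open>i\<close> caps
    \<open>m\<close> at \<open>c i\<close>. A point \<open>j\<close> after \<open>i\<close> permits
    this value through its first coordinate, one before \<open>i\<close> through its second.\<close>
  have ms: "m (c i + d i) = c i" if i: "i \<le> r" for i
  proof (intro antisym mgeI)
    show "m (c i + d i) \<le> c i" using mi[OF i, of "c i + d i"] by simp
    show "c i \<le> max (c j) (c i + d i - d j)" if "j \<le> r" for j
      using ord_maps_mono[OF c, of i j] ord_maps_mono[OF d, of j i] that i
      by (cases "i \<le> j") auto
  qed (use ord_maps_le[OF c i] in auto)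
  define \<beta> \<beta>' where "\<beta> = restrict m {..a + b}" and "\<beta>' = (\<lambda>t\<in>{..a + b}. t - m t)"
  have bb: "t - m t \<le> b" if "t \<le> a + b" for t using mono'[OF that] mab by simp
  have onto: "g ` {..N} = {..g N}" if "g 0 = 0" "\<And>t. g t \<le> g (Suc t)" "\<And>t. g (Suc t) \<le> Suc (g t)"
    for g :: "nat \<Rightarrow> nat" and N
  proof (induction N)
    case (Suc N)
    have "g (Suc N) = g N \<or> g (Suc N) = Suc (g N)" using that(2)[of N] that(3)[of N] by linarith
    then show ?case using Suc by (auto simp: atMost_Suc)
  qed (use that in auto)
  have "m ` {..a + b} = {..a}" using onto[of m "a + b"] m0 m1 m2 mab by simp
  moreover have "(\<lambda>t. t - m t) ` {..a + b} = {..b}"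
  proof -
    have "t - m t \<le> Suc t - m (Suc t)" "Suc t - m (Suc t) \<le> Suc (t - m t)" for t
      using mono'[of t "Suc t"] m1[of t] by auto
    then show ?thesis using onto[of "\<lambda>t. t - m t" "a + b"] mab by simp
  qed
  ultimately have "(\<beta>, \<beta>') \<in> Shfl a b"
    unfolding Shfl_def using ma mono mono' bb mt
    by (auto simp: \<beta>_def \<beta>'_def intro!: ord_mapsI)
  moreover have "s \<in> ord_maps r (a + b)"
    using ord_maps_le[OF c] ord_maps_le[OF d] ord_maps_mono[OF c] ord_maps_mono[OF d]
    by (auto simp: s_def intro!: ord_mapsI add_mono)
  moreover have "c = compose {..r} \<beta> s" "d = compose {..r} \<beta>' s"
    using ord_maps_ext[OF c] ord_maps_ext[OF d] ord_maps_le[OF c] ord_maps_le[OF d] ms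
    by (auto simp: \<beta>_def \<beta>'_def s_def compose_def fun_eq_iff extensional_def add_mono)
  ultimately show ?thesis using that by blast
qed

lemma coface_factor:
  assumes f: "f \<in> ord_maps r n" and i: "i \<le> n" "i \<notin> f ` {..r}"
  shows "(\<lambda>t\<in>{..r}. if f t < i then f t else f t - 1) \<in> ord_maps r (n - 1)"
    "f = compose {..r} (coface n i) (\<lambda>t\<in>{..r}. if f t < i then f t else f t - 1)"
proof -
  have ne: "f t \<noteq> i" if "t \<le> r" for t using that i(2) by auto
  show 1: "(\<lambda>t\<in>{..r}. if f t < i then f t else f t - 1) \<in> ord_maps r (n - 1)"
  proof (rule ord_mapsI)
    show "(\<lambda>t\<in>{..r}. if f t < i then f t else f t - 1) t \<le> n - 1" if "t \<le> r" for t
      using ord_maps_le[OF f that] ne[OF that] i(1) that by auto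
    show "(\<lambda>t\<in>{..r}. if f t < i then f t else f t - 1) t \<le> (\<lambda>t\<in>{..r}. if f t < i then f t else f t - 1) t'"
      if "t \<le> t'" "t' \<le> r" for t t'
      using ord_maps_mono[OF f that] ne[of t'] ne[of t] that by auto
  qed auto
  have "coface n i (if f t < i then f t else f t - 1) = f t" if "t \<le> r" for t
    using ord_maps_le[OF f that] ne[OF that] i(1) by (auto simp: coface_def)
  then show "f = compose {..r} (coface n i) (\<lambda>t\<in>{..r}. if f t < i then f t else f t - 1)"
    using ord_maps_ext[OF f] by (auto simp: compose_def fun_eq_iff extensional_def)
qed

lemma vface_factor:
  assumes f: "f \<in> theta_hom r p" and k: "1 \<le> k" "k \<le> length p" "entry p k \<ge> 1" "i \<le> entry p k"
    and miss: "\<And>l t. 1 \<le> l \<Longrightarrow> l \<le> length r \<Longrightarrow> hor f (l - 1) < k \<Longrightarrow> k \<le> hor f l \<Longrightarrow>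
      i \<notin> ver f k ` {..entry r l}"
  shows "\<exists>\<phi> \<in> vertical_hyperfaces p. \<exists>g \<in> theta_hom r (tdom \<phi>). f = theta_comp \<phi> g"
proof -
  note F = theta_homD[OF f]
  have hv: "hor (vface p k i) t = t" if "t \<le> length p" for t
    using that by (simp add: vface_def ord_id_def)
  have dv: "tdom (vface p k i) = p[k - 1 := entry p k - 1]" by (simp add: vface_def)
  define v where "v j = (if j = k then \<lambda>t\<in>{..entry r (segment (length r) (hor f) k)}.
      if ver f k t < i then ver f k t else ver f k t - 1 else ver f j)" for j
  have "\<exists>g \<in> theta_hom r (tdom (vface p k i)). hor g = hor f \<and> f = theta_comp (vface p k i) g"
  proof (rule theta_factor[OF vface_in[OF k] f, of "hor f" v])
    show "hor f \<in> ord_maps (length r) (length (tdom (vface p k i)))" using F(3) by (simp add: dv)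
    show "hor (vface p k i) (hor f t) = hor f t" if "t \<le> length r" for t
      using hv ord_maps_le[OF F(3) that] by simp
    fix l j assume l: "1 \<le> l" "l \<le> length r" and j: "hor f (l - 1) < j" "j \<le> hor f l"
    have jp: "j \<le> length p" "1 \<le> j" using j ord_maps_le[OF F(3) l(2)] by auto
    have seg: "segment (length r) (hor f) j = l" by (rule segment_eq[OF F(3) l j])
    note V = F(4)[OF l j]
    show "v j \<in> ord_maps (entry r l) (entry (tdom (vface p k i)) j)"
    proof (cases "j = k")
      case True
      then have "entry (tdom (vface p k i)) j = entry p k - 1" using k by (simp add: dv)
      then show ?thesis
        using V coface_factor(1)[of "ver f k" "entry r l" "entry p k" i] k miss[OF l] j seg True
        by (simp add: v_def)
    next
      case False
      then have "entry (tdom (vface p k i)) j = entry p j" using k jp by (simp add: dv)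
      then show ?thesis using V False by (simp add: v_def)
    qed
    fix j' assume "hor (vface p k i) (j - 1) < j'" "j' \<le> hor (vface p k i) j"
    then have j': "j' = j" using hv[of j] hv[of "j - 1"] jp by simp
    show "ver f j' = compose {..entry r l} (ver (vface p k i) j') (v j)"
    proof (cases "j = k")
      case True
      then show ?thesis
        using V coface_factor(2)[of "ver f k" "entry r l" "entry p k" i] k miss[OF l] j seg j'
        by (simp add: v_def vface_def)
    next
      case False
      then show ?thesis using V jp j' ord_maps_id(2)[OF V] by (simp add: v_def vface_def)
    qed
  qed
  moreover have "vface p k i \<in> vertical_hyperfaces p" using k by (auto simp: vertical_hyperfaces_def)
  ultimately show ?thesis by blast
qed

text \<open>If the first entry is positive, omitting vertex 0 has codimension greater than 1 and is
  not a hyperface. A map that misses 0 then has no component over the first column, so it passes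
  through a vertical face of that column.\<close>

lemma hface_first_factor:
  assumes f: "f \<in> theta_hom r p" and p: "1 \<le> length p" and miss: "0 \<notin> hor f ` {..length r}"
  shows "\<exists>\<phi> \<in> horizontal_hyperfaces p 0 \<union> vertical_hyperfaces p.
    \<exists>g \<in> theta_hom r (tdom \<phi>). f = theta_comp \<phi> g"
proof (cases "entry p 1 = 0")
  case False
  have "\<not> hor f (l - 1) < 1" if "l \<le> length r" for l
    using miss that by (metis atMost_iff diff_le_self image_eqI less_one order_trans)
  then show ?thesis using vface_factor[OF f, of 1 0] p False by fastforce
next
  case True
  note F = theta_homD[OF f]
  let ?h = "\<lambda>t\<in>{..length r}. if hor f t < 0 then hor f t else hor f t - 1"
  note C = coface_factor[OF F(3) _ miss]
  have d: "tdom (hface_first p) = tl p" by (simp add: hface_first_def)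
  have pos: "0 < hor f t" if "t \<le> length r" for t using miss that by force
  have hv: "hor (hface_first p) t = Suc t" if "t \<le> length p - 1" for t
    using that by (simp add: hface_first_def coface_val)
  have "\<exists>g \<in> theta_hom r (tl p). hor g = ?h \<and> f = theta_comp (hface_first p) g"
  proof (rule theta_factor[OF hface_first_in[OF p] f, of ?h "\<lambda>k. ver f (Suc k)"])
    show "?h \<in> ord_maps (length r) (length (tl p))" using C by simp
    show "hor (hface_first p) (?h t) = hor f t" if "t \<le> length r" for t
      using hv[of "hor f t - 1"] pos[OF that] ord_maps_le[OF F(3) that] that by simp
    fix l k assume l: "1 \<le> l" "l \<le> length r" and "?h (l - 1) < k" "k \<le> ?h l"
    moreover have "l - 1 \<le> length r" using l by simp
    ultimately have k: "hor f (l - 1) < Suc k" "Suc k \<le> hor f l" "1 \<le> k"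
      using pos[of "l - 1"] pos[of l] by auto
    have kp: "Suc k \<le> length p" using k ord_maps_le[OF F(3) l(2)] by auto
    note V = F(4)[OF l k(1,2)]
    show "ver f (Suc k) \<in> ord_maps (entry r l) (entry (tl p) k)"
      using V kp k by (simp add: nth_tl)
    fix j assume "hor (hface_first p) (k - 1) < j" "j \<le> hor (hface_first p) k"
    then have "j = Suc k" using hv[of k] hv[of "k - 1"] kp k by auto
    then show "ver f j = compose {..entry r l} (ver (hface_first p) j) (ver f (Suc k))"
      using kp k ord_maps_id(2)[OF V] by (simp add: hface_first_def)
  qed
  moreover have "hface_first p \<in> horizontal_hyperfaces p 0"
    using True p by (simp add: horizontal_hyperfaces_def)
  ultimately show ?thesis using d by fastforce
qed

lemma hface_last_factor:
  assumes f: "f \<in> theta_hom r p" and p: "1 \<le> length p" and miss: "length p \<notin> hor f ` {..length r}"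
  shows "\<exists>\<phi> \<in> horizontal_hyperfaces p (length p) \<union> vertical_hyperfaces p.
    \<exists>g \<in> theta_hom r (tdom \<phi>). f = theta_comp \<phi> g"
proof (cases "entry p (length p) = 0")
  case False
  have "\<not> length p \<le> hor f l" if "l \<le> length r" for l
    using miss that ord_maps_le[OF theta_homD(3)[OF f] that] by (auto simp: image_iff)
  then show ?thesis using vface_factor[OF f, of "length p" 0] p False by fastforce
next
  case True
  note F = theta_homD[OF f]
  have d: "tdom (hface_last p) = butlast p" by (simp add: hface_last_def)
  have lt: "hor f t < length p" if "t \<le> length r" for t
    using miss that ord_maps_le[OF F(3) that] by (metis atMost_iff image_eqI le_neq_implies_less)
  have hv: "hor (hface_last p) t = t" if "t < length p" for t
    using that by (simp add: hface_last_def coface_val)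
  have "\<exists>g \<in> theta_hom r (butlast p). hor g = hor f \<and> f = theta_comp (hface_last p) g"
  proof (rule theta_factor[OF hface_last_in[OF p] f, of "hor f" "ver f"])
    show "hor f \<in> ord_maps (length r) (length (butlast p))"
      using ord_maps_ext[OF F(3)] ord_maps_mono[OF F(3)] lt by (intro ord_mapsI) force+
    show "hor (hface_last p) (hor f t) = hor f t" if "t \<le> length r" for t
      using hv lt[OF that] by simp
    fix l k assume l: "1 \<le> l" "l \<le> length r" and k: "hor f (l - 1) < k" "k \<le> hor f l"
    have kp: "k < length p" "1 \<le> k" using k lt[OF l(2)] by auto
    note V = F(4)[OF l k(1,2)]
    show "ver f k \<in> ord_maps (entry r l) (entry (butlast p) k)"
      using V kp by (simp add: nth_butlast)
    fix j assume "hor (hface_last p) (k - 1) < j" "j \<le> hor (hface_last p) k"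
    then have "j = k" using hv[of k] hv[of "k - 1"] kp k by auto
    moreover have "k \<le> length p - 1" using kp by simp
    ultimately show "ver f j = compose {..entry r l} (ver (hface_last p) j) (ver f k)"
      using kp k ord_maps_id(2)[OF V] by (simp add: hface_last_def)
  qed
  moreover have "hface_last p \<in> horizontal_hyperfaces p (length p)"
    using True p by (simp add: horizontal_hyperfaces_def)
  ultimately show ?thesis using d by fastforce
qed

text \<open>By \<open>ends\<close> and \<open>miss\<close> the vertex \<open>j\<close> is skipped
  strictly inside one step \<open>l0\<close>, so the components over columns \<open>j\<close> and
  \<open>j + 1\<close> have the same source. Together they are a chain in the product of the two
  ordinals, and a maximal chain through it is the shuffle of the required face.\<close>

lemma hface_inner_factor:
  assumes f: "f \<in> theta_hom r p" and j: "1 \<le> j" "j < length p" and miss: "j \<notin> hor f ` {..length r}"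
    and ends: "0 \<in> hor f ` {..length r}" "length p \<in> hor f ` {..length r}"
  shows "\<exists>\<phi> \<in> horizontal_hyperfaces p j. \<exists>g \<in> theta_hom r (tdom \<phi>). f = theta_comp \<phi> g"
proof -
  note F = theta_homD[OF f]
  have "hor f 0 = 0" "hor f (length r) = length p"
    using ends ord_maps_mono[OF F(3)] ord_maps_le[OF F(3), of "length r"] by force+
  then obtain l0 where l0: "1 \<le> l0" "l0 \<le> length r" "hor f (l0 - 1) < j" "j \<le> hor f l0"
    "segment (length r) (hor f) j = l0"
    using segment_ex[OF F(3), of j] j by auto
  have jl: "Suc j \<le> hor f l0" using l0(2,4) miss by (metis Suc_leI atMost_iff image_eqI le_neq_implies_less)
  obtain \<beta> \<beta>' s where b: "(\<beta>, \<beta>') \<in> Shfl (entry p j) (entry p (j + 1))"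
    and s: "s \<in> ord_maps (entry r l0) (entry p j + entry p (j + 1))"
    and fs: "ver f j = compose {..entry r l0} \<beta> s" "ver f (j + 1) = compose {..entry r l0} \<beta>' s"
    using shuffle_factor[OF F(4)[OF l0(1-4)] F(4)[of l0 "j + 1"]] l0 jl by auto
  define \<phi> where "\<phi> = hface_inner p j \<beta> \<beta>'"
  let ?p = "take (j - 1) p @ [entry p j + entry p (j + 1)] @ drop (j + 1) p"
  let ?h = "\<lambda>t\<in>{..length r}. if hor f t < j then hor f t else hor f t - 1"
  note C = coface_factor[OF F(3) _ miss]
  have d: "tdom \<phi> = ?p" by (simp add: \<phi>_def hface_inner_def)
  have len: "length ?p = length p - 1" using j by auto
  have ne: "hor f t \<noteq> j" if "t \<le> length r" for t using miss that by auto
  have hv: "hor \<phi> t = (if t < j then t else Suc t)" if "t \<le> length p - 1" for t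
    using that by (simp add: \<phi>_def hface_inner_def coface_val)
  define v where "v k = (if k < j then ver f k else if k = j then s else ver f (Suc k))" for k
  have "\<exists>g \<in> theta_hom r (tdom \<phi>). hor g = ?h \<and> f = theta_comp \<phi> g"
  proof (rule theta_factor[OF hface_inner_in[OF j b, folded \<phi>_def] f, of ?h v])
    show "?h \<in> ord_maps (length r) (length (tdom \<phi>))" unfolding d len using C j by simp
    show "hor \<phi> (?h t) = hor f t" if "t \<le> length r" for t
      using hv[of "?h t"] ne[OF that] ord_maps_le[OF F(3) that] that j by auto
    fix l k assume l: "1 \<le> l" "l \<le> length r" and k: "?h (l - 1) < k" "k \<le> ?h l"
    have l1: "l - 1 \<le> length r" using l by simp
    have hl: "hor f l \<le> length p" using ord_maps_le[OF F(3) l(2)] .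
    have mono: "hor f (l - 1) \<le> hor f l" using ord_maps_mono[OF F(3), of "l - 1" l] l by simp
    have kp: "k < length p" "1 \<le> k" using k l hl j by (auto split: if_splits)
    note ne' = ne[OF l(2)] ne[OF l1]
    have k1: "hor f (l - 1) < k" "k \<le> hor f l" if "k < j"
      using that k l l1 ne' by (auto split: if_splits)
    have k2: "hor f (l - 1) < j" "j \<le> hor f l" if "k = j"
      using that k l l1 ne' by (auto split: if_splits)
    then have k2': "l = l0" if "k = j" using segment_eq[OF F(3) l] l0(5) that by simp
    have k3: "hor f (l - 1) < Suc k" "Suc k \<le> hor f l" if "j < k"
      using that k l l1 ne' by (auto split: if_splits)
    have ent: "entry ?p k = (if k < j then entry p k else if k = j then entry p j + entry p (j + 1) else entry p (Suc k))"
    proof -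
      have "j < k \<Longrightarrow> k - 1 - (j - 1) = Suc (k - Suc j)" "j < k \<Longrightarrow> Suc (j + (k - Suc j)) = k" using j by auto
      then show ?thesis using j kp by (auto simp: nth_append)
    qed
    show "v k \<in> ord_maps (entry r l) (entry (tdom \<phi>) k)"
      unfolding d ent using F(4)[OF l, of k] F(4)[OF l, of "Suc k"] k1 k2' k3 s
      by (auto simp: v_def)
    fix i assume i: "hor \<phi> (k - 1) < i" "i \<le> hor \<phi> k"
    have vi: "ver \<phi> i = (if i = j then \<beta> else if i = j + 1 then \<beta>' else ord_id (entry p i))"
      using i hv[of k] kp by (auto simp: \<phi>_def hface_inner_def split: if_splits)
    consider "k < j" "i = k" | "k = j" "i = j \<or> i = j + 1" | "k > j" "i = Suc k"
      using i hv[of k] hv[of "k - 1"] kp j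
      by (cases k j rule: linorder_cases) (simp_all split: if_splits, linarith)
    then show "ver f i = compose {..entry r l} (ver \<phi> i) (v k)"
    proof cases
      case 1
      then show ?thesis using vi ord_maps_id(2)[OF F(4)[OF l k1]] by (simp add: v_def)
    next
      case 2
      then show ?thesis using vi fs k2' by (auto simp: v_def)
    next
      case 3
      then show ?thesis using vi ord_maps_id(2)[OF F(4)[OF l k3]] by (simp add: v_def)
    qed
  qed
  moreover have "\<phi> \<in> horizontal_hyperfaces p j"
    using j b by (auto simp: horizontal_hyperfaces_def \<phi>_def)
  ultimately show ?thesis by blast
qed

text \<open>The possible horizontal indices are listed because a horn omits the faces of one index.
  The indices 0 and \<open>length p\<close> occur when the map misses an end: then the components
  over columns \<open>j\<close> and \<open>j + 1\<close> need not both exist, and an outer or a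
  vertical face is used instead.\<close>

lemma hyperface_factor_hor:
  assumes f: "f \<in> theta_hom r p" and p: "1 \<le> length p"
    and j: "j \<le> length p" "j \<notin> hor f ` {..length r}"
  shows "\<exists>\<phi> \<in> vertical_hyperfaces p \<union> (\<Union>i\<in>{0, length p, j}. horizontal_hyperfaces p i).
    \<exists>g \<in> theta_hom r (tdom \<phi>). f = theta_comp \<phi> g"
proof (cases "0 \<in> hor f ` {..length r} \<and> length p \<in> hor f ` {..length r}")
  case True
  then have "j \<noteq> 0" "j \<noteq> length p" using j(2) by metis+
  then show ?thesis using hface_inner_factor[OF f _ _ j(2)] True j(1) by auto
next
  case False
  then show ?thesis using hface_first_factor[OF f p] hface_last_factor[OF f p] by blast
qed

lemma hyperface_factor_ver:
  assumes f: "f \<in> theta_hom r p"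
    and l: "1 \<le> l" "l \<le> length r" "hor f (l - 1) < k" "k \<le> hor f l"
    and v: "ver f k ` {..entry r l} \<noteq> {..entry p k}"
  shows "\<exists>\<phi> \<in> vertical_hyperfaces p. \<exists>g \<in> theta_hom r (tdom \<phi>). f = theta_comp \<phi> g"
proof -
  note F = theta_homD[OF f]
  note V = F(4)[OF l]
  obtain i where i: "i \<le> entry p k" "i \<notin> ver f k ` {..entry r l}"
    using v ord_maps_le[OF V] by auto
  have "ver f k 0 \<noteq> i" using i by auto
  then have "entry p k \<ge> 1" using ord_maps_le[OF V, of 0] i by simp
  moreover have "k \<le> length p" using l ord_maps_le[OF F(3) l(2)] by simp
  moreover have "i \<notin> ver f k ` {..entry r l'}"
    if "1 \<le> l'" "l' \<le> length r" "hor f (l' - 1) < k" "k \<le> hor f l'" for l'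
    using segment_eq[OF F(3) that] segment_eq[OF F(3) l] i(2) by simp
  moreover have "1 \<le> k" using l(3) by simp
  ultimately show ?thesis using vface_factor[OF f _ _ _ i(1)] by blast
qed

section \<open>Surjective maps, boundaries and horns\<close>

definition theta_surj :: "theta_ob \<Rightarrow> theta_ob \<Rightarrow> theta_mor \<Rightarrow> bool" where
  "theta_surj r p f \<longleftrightarrow> hor f ` {..length r} = {..length p} \<and>
     (\<forall>l k. 1 \<le> l \<longrightarrow> l \<le> length r \<longrightarrow> hor f (l - 1) < k \<longrightarrow> k \<le> hor f l \<longrightarrow>
        ver f k ` {..entry r l} = {..entry p k})"

lemma ord_maps_surj_step:
  assumes f: "f \<in> ord_maps m n" and s: "f ` {..m} = {..n}" and i: "Suc i \<le> m"
  shows "f (Suc i) = f i \<or> f (Suc i) = Suc (f i)"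
proof (rule ccontr)
  assume "\<not> ?thesis"
  then have "Suc (f i) < f (Suc i)" using ord_maps_mono[OF f, of i "Suc i"] i by simp
  moreover then have "Suc (f i) \<in> f ` {..m}" using s ord_maps_le[OF f i] by simp
  then obtain j where "j \<le> m" "f j = Suc (f i)" by auto
  ultimately show False using ord_maps_mono[OF f, of j i] ord_maps_mono[OF f, of "Suc i" j] i
    by linarith
qed

lemma ord_maps_surj_ends:
  assumes f: "f \<in> ord_maps m n" and s: "f ` {..m} = {..n}"
  shows "f 0 = 0" "f m = n"
proof -
  have "0 \<in> f ` {..m}" "n \<in> f ` {..m}" using s by auto
  then obtain i j where "i \<le> m" "f i = 0" "j \<le> m" "f j = n" by fastforce
  then show "f 0 = 0" "f m = n"
    using ord_maps_mono[OF f, of 0 i] ord_maps_mono[OF f, of j m] ord_maps_le[OF f, of m] by simp_all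
qed

text \<open>A surjective horizontal part rises by at most 1 per step, so column \<open>k\<close> of
  \<open>p\<close> is entered at exactly one step \<open>L k\<close> of \<open>r\<close>, and its
  component is a surjection from that entry. Distinct columns use distinct steps, so the sum of
  entry plus 1 over columns can only be larger for \<open>r\<close>.\<close>

lemma theta_surj_dim:
  assumes f: "f \<in> theta_hom r p" and s: "theta_surj r p f"
  shows "dim p \<le> dim r"
proof -
  note F = theta_homD[OF f]
  have im: "hor f ` {..length r} = {..length p}" using s by (simp add: theta_surj_def)
  note E = ord_maps_surj_ends[OF F(3) im]
  define L where "L k = segment (length r) (hor f) k" for k
  have L: "1 \<le> L k" "L k \<le> length r" "hor f (L k) = k" "entry p k \<le> entry r (L k)"
    if k: "1 \<le> k" "k \<le> length p" for k
  proof -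
    obtain l where l: "1 \<le> l" "l \<le> length r" "hor f (l - 1) < k" "k \<le> hor f l"
      "segment (length r) (hor f) k = l"
      using segment_ex[OF F(3), of k] k E by auto
    have "ver f k ` {..entry r l} = {..entry p k}" using s l by (auto simp: theta_surj_def)
    then have "card {..entry p k} \<le> card {..entry r l}" by (metis card_image_le finite_atMost)
    moreover have "hor f l = k" using ord_maps_surj_step[OF F(3) im, of "l - 1"] l by auto
    ultimately show "1 \<le> L k" "L k \<le> length r" "hor f (L k) = k" "entry p k \<le> entry r (L k)"
      using l by (auto simp: L_def)
  qed
  have sums: "dim q = (\<Sum>k\<in>{1..length q}. entry q k + 1)" for q
  proof -
    have "sum_list q = (\<Sum>k\<in>{1..length q}. entry q k)"
      unfolding sum_list_sum_nth
      by (rule sum.reindex_bij_witness[of _ "\<lambda>k. k - 1" Suc]) auto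
    then show ?thesis unfolding dim_def by (subst sum.distrib) simp
  qed
  have inj: "inj_on L {1..length p}" by (rule inj_on_inverseI[of _ "hor f"]) (use L in auto)
  have "dim p \<le> (\<Sum>k\<in>{1..length p}. entry r (L k) + 1)"
    unfolding sums by (intro sum_mono add_mono) (use L in auto)
  also have "\<dots> = (\<Sum>l\<in>L ` {1..length p}. entry r l + 1)" by (subst sum.reindex[OF inj]) (simp add: o_def)
  also have "\<dots> \<le> dim r" unfolding sums by (rule sum_mono2) (use L in auto)
  finally show ?thesis .
qed

lemma theta_surj_comp:
  assumes f: "f \<in> theta_hom r p" and g: "g \<in> theta_hom p q" and s: "theta_surj r q (theta_comp g f)"
  shows "theta_surj p q g"
proof -
  note F = theta_homD[OF f] and G = theta_homD[OF g]
  have hc: "hor (theta_comp g f) i = hor g (hor f i)" if "i \<le> length r" for i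
    using that by (simp add: F(1) compose_def)
  have "{..length q} = hor (theta_comp g f) ` {..length r}" using s by (simp add: theta_surj_def)
  also have "\<dots> \<subseteq> hor g ` {..length p}" using hc ord_maps_le[OF F(3)] by (auto simp: image_iff)
  finally have im: "hor g ` {..length p} = {..length q}" using ord_maps_le[OF G(3)] by auto
  have imc: "hor (theta_comp g f) ` {..length r} = {..length q}" using s by (simp add: theta_surj_def)
  have "ver g k ` {..entry p l} = {..entry q k}"
    if l: "1 \<le> l" "l \<le> length p" "hor g (l - 1) < k" "k \<le> hor g l" for l k
  proof -
    have kq: "1 \<le> k" "k \<le> length q" using l ord_maps_le[OF G(3) l(2)] by auto
    note H = theta_comp_in[OF f g]
    obtain i where i: "1 \<le> i" "i \<le> length r" "hor (theta_comp g f) (i - 1) < k" "k \<le> hor (theta_comp g f) i"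
      using segment_ex[OF theta_homD(3)[OF H], of k] ord_maps_surj_ends[OF theta_homD(3)[OF H] imc] kq by auto
    have "i - 1 \<le> length r" using i by simp
    then have i': "hor g (hor f (i - 1)) < k" "k \<le> hor g (hor f i)" using i hc by simp_all
    have seg: "segment (length p) (hor g) k = l" by (rule segment_eq[OF G(3) l])
    note S = segment_comp[OF F(3) G(3) i(1,2) i', unfolded seg]
    have "{..entry q k} = ver (theta_comp g f) k ` {..entry r i}"
      using s i by (auto simp: theta_surj_def)
    also have "\<dots> \<subseteq> ver g k ` {..entry p l}"
      unfolding theta_comp_ver[OF f g i(1,2) i'] seg
      using ord_maps_le[OF F(4)[OF i(1,2) S(1,2)]] by (auto simp: compose_def)
    finally show ?thesis using ord_maps_le[OF G(4)[OF l]] by auto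
  qed
  with im show ?thesis by (simp add: theta_surj_def)
qed

text \<open>If a composite is surjective, so is its outer factor, which therefore cannot start at a
  smaller dimension. Conversely a missed vertex or a missed vertical value gives a lift to a
  hyperface.\<close>

lemma boundary_iff:
  assumes q: "q \<noteq> []" and f: "f \<in> theta_hom r q"
  shows "Mor f \<in> boundary q r \<longleftrightarrow> \<not> theta_surj r q f"
proof
  assume "Mor f \<in> boundary q r"
  then obtain g h s where "f = theta_comp h g" "g \<in> theta_hom r s" "h \<in> theta_hom s q" "dim s < dim q"
    by (auto simp: boundary_def Theta2_def)
  then show "\<not> theta_surj r q f" using theta_surj_comp theta_surj_dim by (metis not_le)
next
  assume "\<not> theta_surj r q f"
  moreover have "hor f ` {..length r} \<subseteq> {..length q}" using ord_maps_le[OF theta_homD(3)[OF f]] by auto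
  ultimately consider j where "j \<le> length q" "j \<notin> hor f ` {..length r}"
    | l k where "1 \<le> l" "l \<le> length r" "hor f (l - 1) < k" "k \<le> hor f l"
        "ver f k ` {..entry r l} \<noteq> {..entry q k}"
    unfolding theta_surj_def by blast
  then have "\<exists>\<phi> \<in> hyperfaces q. \<exists>g \<in> theta_hom r (tdom \<phi>). f = theta_comp \<phi> g"
  proof cases
    case 1
    moreover have "1 \<le> length q" using q by (simp add: Suc_le_eq)
    ultimately show ?thesis using hyperface_factor_hor[OF f _ 1] unfolding hyperfaces_def by auto
  next
    case 2
    then show ?thesis using hyperface_factor_ver[OF f] unfolding hyperfaces_def by blast
  qed
  then show "Mor f \<in> boundary q r"
    using hyperfaces_dim hyperfaces_in unfolding boundary_def Theta2_def by fastforce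
qed

lemma horizontal_hyperface_hor: "f \<in> horizontal_hyperfaces p k \<Longrightarrow> hor f = coface (length p) k"
  by (auto simp: horizontal_hyperfaces_def hface_first_def hface_last_def hface_inner_def)

lemma horizontal_hyperfaces_disjoint:
  assumes "f \<in> horizontal_hyperfaces p j" "j \<noteq> k" "j \<le> length p" "k \<le> length p"
  shows "f \<notin> horizontal_hyperfaces p k"
proof
  assume "f \<in> horizontal_hyperfaces p k"
  then have e: "coface (length p) j = coface (length p) k"
    using assms horizontal_hyperface_hor by metis
  show False
  proof (cases "j < k")
    case True
    then show False using fun_cong[OF e, of j] assms by (auto simp: coface_def split: if_splits)
  next
    case False
    then show False using fun_cong[OF e, of k] assms by (auto simp: coface_def split: if_splits)
  qed
qed

lemma vertical_not_horizontal:
  assumes "f \<in> vertical_hyperfaces p" "1 \<le> length p"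
  shows "f \<notin> horizontal_hyperfaces p k"
proof
  assume "f \<in> horizontal_hyperfaces p k"
  then have "length (tdom f) = length p - 1"
    by (auto simp: horizontal_hyperfaces_def hface_first_def hface_last_def hface_inner_def)
  moreover have "length (tdom f) = length p" using assms by (auto simp: vertical_hyperfaces_def vface_def)
  ultimately show False using assms(2) by simp
qed

lemma horn_memI:
  assumes "\<phi> \<in> hyperfaces p - horizontal_hyperfaces p k" "g \<in> theta_hom r (tdom \<phi>)"
  shows "Mor (theta_comp \<phi> g) \<in> horizontal_horn p k r"
  unfolding horizontal_horn_def generated_by_def
proof (intro InterI, elim CollectE exE conjE)
  fix X A assume X: "X = A r" and A: "is_subfunctor Theta2 (Theta_rep p) A"
    and G: "\<forall>b. {Mor f |f. f \<in> hyperfaces p - horizontal_hyperfaces p k \<and> tdom f = b} \<subseteq> A b"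
  have "Mor \<phi> \<in> A (tdom \<phi>)" using assms(1) G by blast
  then have "act (Theta_rep p) g (Mor \<phi>) \<in> A r"
    by (rule subfunctorD(2)[OF A, rotated]) (use assms(2) in simp)
  then show "Mor (theta_comp \<phi> g) \<in> X" using X by (simp add: Theta_rep_def Theta2_def)
qed

text \<open>Since \<open>k\<close> is inner, the indices 0 and \<open>length p\<close> differ from
  it. So every hyperface that \<open>hyperface_factor_hor\<close> can supply for some
  \<open>j \<noteq> k\<close> belongs to the horn, as do all vertical ones.\<close>

lemma not_in_horn:
  assumes f: "f \<in> theta_hom r p" and k: "1 \<le> k" "k < length p" and n: "Mor f \<notin> horizontal_horn p k r"
  shows "\<And>j. j \<le> length p \<Longrightarrow> j \<noteq> k \<Longrightarrow> j \<in> hor f ` {..length r}"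
    "\<And>l j. 1 \<le> l \<Longrightarrow> l \<le> length r \<Longrightarrow> hor f (l - 1) < j \<Longrightarrow> j \<le> hor f l \<Longrightarrow>
      ver f j ` {..entry r l} = {..entry p j}"
proof -
  have p: "1 \<le> length p" using k by simp
  have no: "\<not> (\<exists>g \<in> theta_hom r (tdom \<phi>). f = theta_comp \<phi> g)"
    if "\<phi> \<in> hyperfaces p - horizontal_hyperfaces p k" for \<phi>
    using horn_memI[OF that] n by blast
  have V: "vertical_hyperfaces p \<subseteq> hyperfaces p - horizontal_hyperfaces p k"
    using vertical_not_horizontal[OF _ p] by (auto simp: hyperfaces_def)
  show "j \<in> hor f ` {..length r}" if j: "j \<le> length p" "j \<noteq> k" for j
  proof (rule ccontr)
    assume "j \<notin> hor f ` {..length r}"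
    moreover have "horizontal_hyperfaces p i \<subseteq> hyperfaces p - horizontal_hyperfaces p k"
      if "i \<in> {0, length p, j}" for i
      using horizontal_hyperfaces_disjoint[of _ p i k] that j k by (auto simp: hyperfaces_def)
    ultimately show False using hyperface_factor_hor[OF f p j(1)] no V by blast
  qed
  show "ver f j ` {..entry r l} = {..entry p j}"
    if "1 \<le> l" "l \<le> length r" "hor f (l - 1) < j" "j \<le> hor f l" for l j
    using hyperface_factor_ver[OF f that] no V by blast
qed

section \<open>Words\<close>

subsection \<open>Reduction of a word\<close>

text \<open>The Eilenberg-Zilber decomposition for words: a sequence of vertices is its reduced word
  read along a surjection. \<open>remdups_adj_surj\<close> is the converse and
  \<open>reduced_index_unique\<close> the uniqueness of the surjection.\<close>

lemma remdups_adj_index: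
  assumes "remdups_adj (map L [0..<Suc a]) = ys"
  shows "\<exists>f \<in> ord_maps a (length ys - 1). f ` {..a} = {..length ys - 1} \<and> (\<forall>i\<le>a. L i = ys ! f i)"
proof -
  obtain f :: "nat \<Rightarrow> nat" where f: "mono f" "f ` {0..<Suc a} = {0..<length ys}"
    "\<And>i. i < Suc a \<Longrightarrow> map L [0..<Suc a] ! i = ys ! f i"
    using assms unfolding remdups_adj_altdef by auto
  have "ys \<noteq> []" using assms by (auto simp: remdups_adj_Nil_iff simp flip: assms)
  then have iv: "{0..<length ys} = {..length ys - 1}" by (cases ys) auto
  have im: "f ` {..a} = {..length ys - 1}" using f(2) iv by (simp add: atLeast0LessThan lessThan_Suc_atMost)
  let ?g = "restrict f {..a}"
  have "f i \<le> length ys - 1" if "i \<le> a" for i using im that by auto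
  then have "?g \<in> ord_maps a (length ys - 1)"
    using f(1) by (intro ord_mapsI) (auto simp: mono_def)
  moreover have "?g ` {..a} = {..length ys - 1}" using im by simp
  moreover have "L i = ys ! ?g i" if "i \<le> a" for i using f(3)[of i] that by (simp del: upt_Suc)
  ultimately show ?thesis by blast
qed

lemma remdups_adj_surj:
  assumes d: "distinct_adj ys" and ne: "ys \<noteq> []"
    and f: "f \<in> ord_maps a (length ys - 1)" and s: "f ` {..a} = {..length ys - 1}"
  shows "remdups_adj (map (\<lambda>i. ys ! f i) [0..<Suc a]) = ys"
  unfolding remdups_adj_altdef
proof (intro exI conjI allI impI)
  \<comment> \<open>The characterisation of \<open>remdups_adj\<close> asks for a function monotone
    on all of the naturals, so \<open>f\<close> is continued by its last value.\<close>
  let ?f = "\<lambda>i. f (min i a)"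
  show "mono ?f" by (rule monoI) (auto intro!: ord_maps_mono[OF f])
  have "?f ` {0..<Suc a} = f ` {..a}"
    by (intro image_cong) (auto simp: atLeast0LessThan lessThan_Suc_atMost)
  then show "?f ` {0..<length (map (\<lambda>i. ys ! f i) [0..<Suc a])} = {0..<length ys}"
    using s ne by (cases ys) (auto simp del: upt_Suc)
  show "map (\<lambda>i. ys ! f i) [0..<Suc a] ! i = ys ! ?f i"
    if "i < length (map (\<lambda>i. ys ! f i) [0..<Suc a])" for i
    using that by (simp add: min_def del: upt_Suc)
  fix i assume "i + 1 < length (map (\<lambda>i. ys ! f i) [0..<Suc a])"
  then have i: "Suc i \<le> a" by simp
  have "f (Suc i) < length ys" using ord_maps_le[OF f i] ne by (cases ys) auto
  then have "ys ! f i = ys ! f (Suc i) \<longleftrightarrow> f i = f (Suc i)"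
    using ord_maps_surj_step[OF f s i] distinct_adj_nth[OF d, of "f i"] by metis
  then show "(map (\<lambda>i. ys ! f i) [0..<Suc a] ! i = map (\<lambda>i. ys ! f i) [0..<Suc a] ! (i + 1)) \<longleftrightarrow> ?f i = ?f (i + 1)"
    using i by (simp add: min_def del: upt_Suc)
qed

lemma reduced_index_unique:
  assumes d: "distinct_adj ys" and ne: "ys \<noteq> []"
    and f: "f \<in> ord_maps a (length ys - 1)" "f ` {..a} = {..length ys - 1}"
    and g: "g \<in> ord_maps a (length ys - 1)" "g ` {..a} = {..length ys - 1}"
    and e: "\<And>i. i \<le> a \<Longrightarrow> ys ! f i = ys ! g i"
  shows "f = g"
proof (rule ord_maps_eqI[OF f(1) g(1)])
  show "f i = g i" if "i \<le> a" for i
    using that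
  proof (induction i)
    case 0
    then show ?case using ord_maps_surj_ends[OF f] ord_maps_surj_ends[OF g] by simp
  next
    case (Suc i)
    have "f (Suc i) < length ys" "g (Suc i) < length ys"
      using ord_maps_le[OF f(1) Suc.prems] ord_maps_le[OF g(1) Suc.prems] ne by (cases ys; auto)+
    then show ?case
      using Suc e[of "Suc i"] ord_maps_surj_step[OF f Suc.prems] ord_maps_surj_step[OF g Suc.prems]
        distinct_adj_nth[OF d, of "f i"] by auto
  qed
qed

lemma remdups_adj_map_remdups_adj: "remdups_adj (map f (remdups_adj xs)) = remdups_adj (map f xs)"
proof (induction xs rule: remdups_adj.induct)
  case (3 x y xs)
  obtain zs where zs: "remdups_adj (y # xs) = y # zs" by (metis remdups_adj_Cons')
  show ?case
  proof (cases "x = y")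
    case False
    have "remdups_adj (map f (y # zs)) = remdups_adj (map f (y # xs))" using 3(2)[OF False] zs by simp
    then show ?thesis using False zs by simp
  qed (use 3 in simp)
qed auto

lemma subseq_remdups_adj: "subseq (remdups_adj xs) xs"
  by (induction xs rule: remdups_adj.induct) auto

lemma sorted_map_remdups_adj: "sorted (map f xs) \<Longrightarrow> sorted (map f (remdups_adj xs))"
  by (induction xs rule: remdups_adj.induct) auto

lemma sorted_distinct_adj:
  fixes xs :: "'b::linorder list"
  shows "sorted xs \<Longrightarrow> distinct_adj xs \<Longrightarrow> distinct xs"
proof (induction xs)
  case (Cons x xs)
  then show ?case by (cases xs) (auto simp: distinct_adj_Cons)
qed auto

text \<open>The indices that are hit, without repetitions, form a strictly increasing list and so
  select a subsequence of \<open>U\<close>. Erasing equal neighbours among the selected letters is a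
  further passage to a subsequence.\<close>

lemma subseq_reindex:
  assumes h: "h \<in> ord_maps a (length U - 1)" and ne: "U \<noteq> []"
  shows "subseq (remdups_adj (map (\<lambda>i. U ! h i) [0..<Suc a])) U"
proof -
  define hs where "hs = remdups_adj (map h [0..<Suc a])"
  have set: "set hs \<subseteq> set [0..<length U]"
  proof
    fix j assume "j \<in> set hs"
    then obtain i where "i \<le> a" "j = h i" by (auto simp: hs_def less_Suc_eq_le simp del: upt_Suc)
    moreover have "0 < length U" using ne by simp
    ultimately have "j < length U" using ord_maps_le[OF h, of i] by linarith
    then show "j \<in> set [0..<length U]" by simp
  qed
  have "sorted (map h [0..<Suc a])"
    unfolding sorted_iff_nth_mono using ord_maps_mono[OF h] by (auto simp del: upt_Suc)
  then have srt: "sorted hs" unfolding hs_def by (rule sorted_remdups_adj)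
  then have "distinct hs" by (rule sorted_distinct_adj) (simp add: hs_def)
  then have "hs = filter (\<lambda>i. i \<in> set hs) [0..<length U]"
    using srt set by (intro sorted_distinct_set_unique) (auto intro: sorted_wrt_filter)
  then have "subseq hs [0..<length U]" by (metis subseq_filter_left)
  then have "subseq (map ((!) U) hs) (map ((!) U) [0..<length U])" by (rule subseq_map)
  then have "subseq (remdups_adj (map ((!) U) hs)) U"
    using subseq_remdups_adj subseq_order.trans by (metis map_nth)
  then show ?thesis unfolding hs_def remdups_adj_map_remdups_adj by (simp add: o_def del: upt_Suc)
qed

subsection \<open>The pairing of words\<close>

text \<open>The word of a cell \<open>(w, [\<alpha>; \<alpha>\<^sub>k])\<close> of \<open>J \<times> \<Theta>\<^sub>2[n; q]\<close> lists the vertices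
  \<open>(w(i), \<alpha>(i))\<close>.\<close>

type_synonym word = "(job \<times> nat) list"

definition valid :: "nat \<Rightarrow> word \<Rightarrow> bool" where
  "valid n V \<longleftrightarrow>
     distinct_adj V \<and> sorted (map snd V) \<and> snd ` set V = {..n} \<and> Bullet \<in> fst ` set V"

definition bullet_column :: "word \<Rightarrow> nat" where
  "bullet_column V = (LEAST i. (Bullet, i) \<in> set V)"

text \<open>\<open>cut i as bs\<close> says that \<open>(Lozenge, i)\<close> may be inserted between \<open>as\<close> and \<open>bs\<close>, where \<open>i\<close> is
  the first column that contains \<open>Bullet\<close>: at the end of this column if \<open>i = 0\<close>, and at its
  beginning otherwise.  So it becomes an inner vertex.\<close>

definition cut :: "nat \<Rightarrow> word \<Rightarrow> word \<Rightarrow> bool" where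
  "cut i as bs \<longleftrightarrow>
     (if i = 0 then as \<noteq> [] \<and> last as = (Bullet, 0) \<and> (\<forall>x\<in>set as. snd x = 0) \<and> (\<forall>y\<in>set bs. 0 < snd y)
      else as = map (Product_Type.Pair Lozenge) [0..<i] \<and> bs \<noteq> [] \<and> hd bs = (Bullet, i) \<and> (\<forall>y\<in>set bs. i \<le> snd y))"

lemma sorted_filter_split:
  assumes "sorted (map snd V)"
  shows "V = filter (\<lambda>x. snd x < (c::nat)) V @ filter (\<lambda>x. \<not> snd x < c) V"
  using assms
proof (induction V)
  case (Cons x V)
  show ?case
  proof (cases "snd x < c")
    case False
    then have "filter (\<lambda>x. snd x < c) V = []" using Cons.prems by (auto simp: filter_empty_conv)
    then show ?thesis using False Cons by simp
  qed (use Cons in simp)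
qed simp

lemma validD:
  assumes "valid n V"
  shows "distinct_adj V" "sorted (map snd V)" "snd ` set V = {..n}" "V \<noteq> []"
    "(Bullet, bullet_column V) \<in> set V" "\<And>i. (Bullet, i) \<in> set V \<Longrightarrow> bullet_column V \<le> i"
    "bullet_column V \<le> n"
proof -
  show V: "distinct_adj V" "sorted (map snd V)" "snd ` set V = {..n}" "V \<noteq> []"
    using assms by (auto simp: valid_def)
  show b: "(Bullet, bullet_column V) \<in> set V"
    using assms unfolding bullet_column_def by (auto simp: valid_def intro: LeastI)
  show "\<And>i. (Bullet, i) \<in> set V \<Longrightarrow> bullet_column V \<le> i"
    unfolding bullet_column_def by (rule Least_le)
  show "bullet_column V \<le> n" using V(3) b by force
qed

lemma valid_cut:
  assumes "valid n V"
  obtains i as bs where "cut i as bs" "V = as @ bs \<or> V = as @ (Lozenge, i) # bs"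
proof -
  note V = validD[OF assms]
  define i where "i = bullet_column V"
  \<comment> \<open>The place of the cut as a column boundary: after column 0 if
    \<open>i = 0\<close>, before column \<open>i\<close> otherwise. Only a \<open>Lozenge\<close> of
    column \<open>i\<close> that already stands at this boundary has to be removed from
    \<open>as\<close> or \<open>bs\<close>.\<close>
  define c where "c = (if i = 0 then 1 else i)"
  define as where "as = filter (\<lambda>x. snd x < c) V"
  define bs where "bs = filter (\<lambda>x. \<not> snd x < c) V"
  have Vs: "V = as @ bs" unfolding as_def bs_def by (rule sorted_filter_split[OF V(2)])
  have as: "distinct_adj as" "sorted (map snd as)" and bs: "distinct_adj bs" "sorted (map snd bs)"
    using V(1,2) unfolding Vs by (auto simp: sorted_append)
  have aslt: "snd x < c" if "x \<in> set as" for x using that by (simp add: as_def)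
  have bsge: "c \<le> snd x" if "x \<in> set bs" for x using that by (simp add: bs_def)
  show ?thesis
  proof (cases "i = 0")
    case True
    then have c: "c = 1" by (simp add: c_def)
    have "(Bullet, 0) \<in> set as" using V(5) c True by (simp add: as_def i_def)
    then obtain xs x where xs: "as = xs @ [x]" by (cases as rule: rev_cases) auto
    have as0: "snd y = 0" if "y \<in> set as" for y using aslt[OF that] c by simp
    have bs0: "0 < snd y" if "y \<in> set bs" for y using bsge[OF that] c by simp
    show ?thesis
    proof (cases "fst x")
      case Bullet
      then have "x = (Bullet, 0)" using as0[of x] xs by (cases x) auto
      then have "cut 0 as bs" using as0 bs0 xs unfolding cut_def by auto
      then show ?thesis using that Vs by blast
    next
      case Lozenge
      then have x: "x = (Lozenge, 0)" using as0[of x] xs by (cases x) auto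
      then have "xs \<noteq> []" using \<open>(Bullet, 0) \<in> set as\<close> xs by auto
      then have "last xs \<noteq> x" "snd (last xs) = 0"
        using as(1) as0[of "last xs"] xs by (auto simp: distinct_adj_append_iff)
      then have "last xs = (Bullet, 0)" using x by (cases "last xs"; cases "fst (last xs)") auto
      then have "cut 0 xs bs" using as0 bs0 xs \<open>xs \<noteq> []\<close> unfolding cut_def by auto
      then show ?thesis using that Vs xs x by auto
    qed
  next
    case False
    then have c: "c = i" by (simp add: c_def)
    \<comment> \<open>Columns before the first \<open>Bullet\<close> contain only
      \<open>Lozenge\<close>, and by \<open>distinct_adj\<close> just one each. So \<open>as\<close>
      is determined by \<open>i\<close>.\<close>
    have loz: "fst x = Lozenge" if "x \<in> set as" for x
    proof (cases "fst x")
      case Bullet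
      then have "(Bullet, snd x) \<in> set V" using that Vs by (metis UnI1 prod.collapse set_append)
      then show ?thesis using V(6) aslt[OF that] c i_def by fastforce
    qed
    have "inj_on snd (set as)" using loz by (auto simp: inj_on_def prod_eq_iff)
    then have "distinct (map snd as)" using as by (intro sorted_distinct_adj distinct_adj_mapI)
    moreover have "snd ` set as = {..<i}"
    proof -
      have "j \<in> snd ` set as" if "j < i" for j
      proof -
        have "j \<in> snd ` set V" using V(3,7) that i_def by simp
        then show ?thesis using that c by (auto simp: as_def)
      qed
      then show ?thesis using aslt c by auto
    qed
    ultimately have "map snd as = [0..<i]"
      using as(2) by (intro sorted_distinct_set_unique) auto
    moreover have "as = map (Product_Type.Pair Lozenge) (map snd as)"
      using loz by (auto simp: list_eq_iff_nth_eq prod_eq_iff)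
    ultimately have asl: "as = map (Product_Type.Pair Lozenge) [0..<i]" by simp
    have bi: "(Bullet, i) \<in> set bs" using V(5) c by (simp add: bs_def i_def)
    then obtain w ws where w: "bs = w # ws" by (cases bs) auto
    have wi: "snd w = i" using bs(2) bi bsge[of w] c unfolding w by fastforce
    show ?thesis
    proof (cases "fst w")
      case Bullet
      then have "cut i as bs" using asl wi w bsge c False unfolding cut_def by (auto simp: prod_eq_iff)
      then show ?thesis using that Vs by blast
    next
      case Lozenge
      then have wl: "w = (Lozenge, i)" using wi by (cases w) auto
      then have b': "(Bullet, i) \<in> set ws" using bi w by auto
      then obtain v vs where v: "ws = v # vs" by (cases ws) auto
      have "snd v = i" using bs(2) b' bsge[of v] c unfolding w v by fastforce
      moreover have "v \<noteq> w" using bs(1) w v by auto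
      ultimately have "v = (Bullet, i)" using wl by (cases v; cases "fst v") auto
      then have "cut i as ws" using asl w v bsge c False unfolding cut_def by auto
      then show ?thesis using that Vs w wl by blast
    qed
  qed
qed

lemma cut_bullet_column:
  assumes "cut i as bs" "V = as @ bs \<or> V = as @ (Lozenge, i) # bs"
  shows "bullet_column V = i"
  unfolding bullet_column_def
proof (rule Least_equality)
  show "(Bullet, i) \<in> set V" using assms by (auto simp: cut_def split: if_splits)
    (metis last_in_set hd_in_set)+
  show "i \<le> j" if "(Bullet, j) \<in> set V" for j
    using assms that by (fastforce simp: cut_def split: if_splits)
qed

lemma cut_zero_filter:
  assumes "cut 0 as bs"
  shows "filter (\<lambda>x. 0 < snd x) (as @ bs) = bs" "filter (\<lambda>x. snd x = 0) (as @ bs) = as"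
    "filter (\<lambda>x. 0 < snd x) (as @ (Lozenge, 0) # bs) = bs"
    "filter (\<lambda>x. snd x = 0) (as @ (Lozenge, 0) # bs) = as @ [(Lozenge, 0)]"
proof -
  have "filter (\<lambda>x. snd x = 0) as = as" "filter (\<lambda>x. 0 < snd x) bs = bs"
    by (rule filter_True, use assms in \<open>simp add: cut_def\<close>)+
  moreover have "filter (\<lambda>x. 0 < snd x) as = []" "filter (\<lambda>x. snd x = 0) bs = []"
    by (rule filter_False, use assms in \<open>simp add: cut_def\<close>)+
  ultimately show "filter (\<lambda>x. 0 < snd x) (as @ bs) = bs" "filter (\<lambda>x. snd x = 0) (as @ bs) = as"
    "filter (\<lambda>x. 0 < snd x) (as @ (Lozenge, 0) # bs) = bs"
    "filter (\<lambda>x. snd x = 0) (as @ (Lozenge, 0) # bs) = as @ [(Lozenge, 0)]"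
    by simp_all
qed

text \<open>Both words of a pair have \<open>i\<close> as their bullet column. For
  \<open>i = 0\<close> the letters of column 0 are \<open>as\<close> with or without a final
  \<open>Lozenge\<close>, and the two are told apart because \<open>as\<close> ends in a
  \<open>Bullet\<close>. Otherwise \<open>as\<close> depends on \<open>i\<close> alone, and
  \<open>bs\<close> begins with a \<open>Bullet\<close>.\<close>

lemma cut_unique:
  assumes 1: "cut i as bs" "V = as @ bs \<or> V = as @ (Lozenge, i) # bs"
    and 2: "cut j cs ds" "V = cs @ ds \<or> V = cs @ (Lozenge, j) # ds"
  shows "i = j" "as = cs" "bs = ds"
proof -
  show ij: "i = j" using cut_bullet_column[OF 1] cut_bullet_column[OF 2] by simp
  have "as = cs \<and> bs = ds"
  proof (cases "i = 0")
    case True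
    have c: "cut 0 as bs" "cut 0 cs ds" using 1(1) 2(1) True ij by auto
    note F = cut_zero_filter[OF c(1)] cut_zero_filter[OF c(2)]
    have V: "V = as @ bs \<or> V = as @ (Lozenge, 0) # bs" "V = cs @ ds \<or> V = cs @ (Lozenge, 0) # ds"
      using 1(2) 2(2) True ij by simp_all
    have "filter (\<lambda>x. 0 < snd x) V = bs"
      "filter (\<lambda>x. snd x = 0) V = as \<or> filter (\<lambda>x. snd x = 0) V = as @ [(Lozenge, 0)]"
      using V(1) F by metis+
    moreover have "filter (\<lambda>x. 0 < snd x) V = ds"
      "filter (\<lambda>x. snd x = 0) V = cs \<or> filter (\<lambda>x. snd x = 0) V = cs @ [(Lozenge, 0)]"
      using V(2) F by metis+
    moreover have "last as = (Bullet, 0)" "last cs = (Bullet, 0)" using c by (auto simp: cut_def)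
    ultimately show ?thesis by (auto simp: last_snoc)
  next
    case False
    then show ?thesis using 1 2 ij by (auto simp: cut_def)
  qed
  then show "as = cs" "bs = ds" by auto
qed

text \<open>The larger word of the pair of \<open>V\<close>. The disjunct \<open>V = U\<close> lets
  it fix larger words, so two valid words belong to the same pair iff their values agree.\<close>

definition fill :: "word \<Rightarrow> word" where
  "fill V = (THE U. \<exists>i as bs. cut i as bs \<and> (V = as @ bs \<or> V = U) \<and> U = as @ (Lozenge, i) # bs)"

lemma fill_eq:
  assumes "cut i as bs" "V = as @ bs \<or> V = as @ (Lozenge, i) # bs"
  shows "fill V = as @ (Lozenge, i) # bs"
  unfolding fill_def using assms cut_unique[OF assms] by (intro the_equality) metis+

lemma cut_nonempty:
  assumes c: "cut i as bs" and V: "valid n (as @ bs) \<or> valid n (as @ (Lozenge, i) # bs)" and n: "n \<noteq> 0"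
  shows "as \<noteq> []" "bs \<noteq> []"
proof -
  show "as \<noteq> []" using c by (auto simp: cut_def split: if_splits)
  show "bs \<noteq> []"
  proof
    assume "bs = []"
    with c have "i = 0" "\<forall>x\<in>set as. snd x = 0" by (auto simp: cut_def split: if_splits)
    with \<open>bs = []\<close> have sub: "snd ` set (as @ (Lozenge, i) # bs) \<subseteq> {0}" by auto
    have "snd ` set (as @ bs) = {..n} \<or> snd ` set (as @ (Lozenge, i) # bs) = {..n}"
      using V unfolding valid_def by blast
    then have "n \<in> snd ` set (as @ bs) \<or> n \<in> snd ` set (as @ (Lozenge, i) # bs)" by blast
    moreover have "snd ` set (as @ bs) \<subseteq> snd ` set (as @ (Lozenge, i) # bs)" by auto
    ultimately have "n \<in> snd ` set (as @ (Lozenge, i) # bs)" by blast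
    then have "n \<in> {0}" using sub by (rule subsetD[rotated])
    then show False using n by simp
  qed
qed

text \<open>The inserted letter stands between a \<open>Bullet\<close> of its own column and a
  letter of a neighbouring column. It equals neither, these two differ from each other, and without
  it the \<open>Bullet\<close> still occupies column \<open>i\<close>.\<close>

lemma cut_valid_iff:
  assumes c: "cut i as bs" and bs: "bs \<noteq> []"
  shows "valid n (as @ (Lozenge, i) # bs) \<longleftrightarrow> valid n (as @ bs)"
proof -
  have sep: "last as \<noteq> (Lozenge, i)" "hd bs \<noteq> (Lozenge, i)" "last as \<noteq> hd bs"
    "\<forall>x\<in>set as. snd x \<le> i" "\<forall>y\<in>set bs. i \<le> snd y" "i \<in> snd ` set (as @ bs)"
    "Bullet \<in> fst ` set (as @ bs)"
  proof -
    have h: "hd bs \<in> set bs" using bs by simp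
    then have "i = 0 \<Longrightarrow> hd bs \<noteq> (x, 0)" for x using c by (auto simp: cut_def)
    then show "last as \<noteq> (Lozenge, i)" "hd bs \<noteq> (Lozenge, i)" "last as \<noteq> hd bs"
      using c by (auto simp: cut_def last_map split: if_splits) metis
    show "\<forall>x\<in>set as. snd x \<le> i" "\<forall>y\<in>set bs. i \<le> snd y"
      using c by (auto simp: cut_def split: if_splits)
    have "(Bullet, i) \<in> set (as @ bs)"
      using c h last_in_set[of as] unfolding cut_def by (metis UnI1 UnI2 set_append)
    then show "i \<in> snd ` set (as @ bs)" "Bullet \<in> fst ` set (as @ bs)" by force+
  qed
  have "distinct_adj (as @ (Lozenge, i) # bs) \<longleftrightarrow> distinct_adj (as @ bs)"
    using sep(1-3) bs by (auto simp: distinct_adj_append_iff distinct_adj_Cons)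
  moreover have "sorted (map snd (as @ (Lozenge, i) # bs)) \<longleftrightarrow> sorted (map snd (as @ bs))"
    using sep(4,5) by (fastforce simp: sorted_append)
  moreover have "snd ` set (as @ (Lozenge, i) # bs) = snd ` set (as @ bs)" using sep(6) by auto
  moreover have "Bullet \<in> fst ` set (as @ (Lozenge, i) # bs)" using sep(7) by auto
  ultimately show ?thesis unfolding valid_def using sep(7) by simp
qed

lemma valid_fill:
  assumes V: "valid n V" and n: "n \<noteq> 0"
  shows "valid n (fill V)" "fill (fill V) = fill V" "bullet_column (fill V) = bullet_column V"
    "length (fill V) \<le> Suc (length V)" "subseq V (fill V)"
proof -
  obtain i as bs where c: "cut i as bs" "V = as @ bs \<or> V = as @ (Lozenge, i) # bs"
    using valid_cut[OF V] .
  note f = fill_eq[OF c]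
  have bs: "bs \<noteq> []" using cut_nonempty(2)[OF c(1) _ n] c(2) V by metis
  show "valid n (fill V)" using cut_valid_iff[OF c(1) bs] c(2) V f by metis
  show "fill (fill V) = fill V" using fill_eq[OF c(1), of "fill V"] f by simp
  show "bullet_column (fill V) = bullet_column V"
    using cut_bullet_column[OF c] cut_bullet_column[OF c(1), of "fill V"] f by simp
  show "length (fill V) \<le> Suc (length V)" using c(2) f by auto
  show "subseq V (fill V)" using c(2) f by (auto intro: list_emb_append_mono)
qed

section \<open>The order of attachment\<close>

definition rank :: "nat \<Rightarrow> word \<Rightarrow> nat" where
  "rank n V = length (fill V) * (n + 1) + (n - bullet_column V)"

text \<open>The second summand of \<open>rank\<close> is at most \<open>n\<close>, so the weight
  \<open>n + 1\<close> makes the comparison lexicographic.\<close>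

lemma rank_less:
  assumes "length (fill V) < length (fill U)"
  shows "rank n V < rank n U"
proof -
  have "rank n V < Suc (length (fill V)) * (n + 1)" by (simp add: rank_def)
  also have "\<dots> \<le> length (fill U) * (n + 1)" using assms by (intro mult_right_mono) auto
  finally show ?thesis by (simp add: rank_def)
qed

text \<open>The letters of \<open>V\<close> occur in \<open>U\<close>, so its first
  \<open>Bullet\<close> cannot lie further left. In the critical case \<open>V\<close> is a smaller
  word, one letter shorter than \<open>U\<close>. If its bullet column moves right, the rank drops;
  if it stays, both words are cut at the same place, and the letter lost can only be the inserted
  one.\<close>

lemma fill_subseq:
  assumes V: "valid n V" and U: "valid n U" and fU: "fill U = U" and s: "subseq V U" and n: "n \<noteq> 0"
  shows "fill V = U \<or> rank n V < rank n U"
proof -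
  obtain i as bs where "cut i as bs" "U = as @ bs \<or> U = as @ (Lozenge, i) # bs"
    using valid_cut[OF U] .
  then have c: "cut i as bs" "U = as @ (Lozenge, i) # bs" using fill_eq fU by auto
  obtain j cs ds where d: "cut j cs ds" "V = cs @ ds \<or> V = cs @ (Lozenge, j) # ds"
    using valid_cut[OF V] .
  have len: "length V \<le> length U" using s by (rule list_emb_length)
  have set: "set V \<subseteq> set U" using s by (auto elim: list_emb_set)
  have bc: "bullet_column U \<le> bullet_column V" using validD(5)[OF V] validD(6)[OF U] set by blast
  have i: "bullet_column U = i" by (rule cut_bullet_column[OF c(1)]) (use c in simp)
  have j: "bullet_column V = j" by (rule cut_bullet_column[OF d])
  consider "length V = length U" | "length (fill V) < length U"
    | "V = cs @ ds" "length (fill V) = length U" 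
    using len d fill_eq[OF d] by fastforce
  then show ?thesis
  proof cases
    case 1
    then have "V = U" using s subseq_same_length by blast
    then show ?thesis using fU by simp
  next
    case 2
    then show ?thesis using rank_less fU by metis
  next
    case 3
    show ?thesis
    proof (cases "i < j")
      case True
      then have "rank n V < rank n U" using 3 fU i j validD(7)[OF V] by (simp add: rank_def)
      then show ?thesis ..
    next
      case False
      then have ij: "j = i" using bc i j by simp
      have len': "length cs + length ds = length as + length bs"
        using 3 c(2) fill_eq[OF d] by simp
      have "cs = as \<and> ds = bs"
      proof (cases "i = 0")
        case True
        have c0: "cut 0 as bs" "cut 0 cs ds" using c(1) d(1) True ij by auto
        note F = cut_zero_filter[OF c0(1)] cut_zero_filter[OF c0(2)]
        have "subseq (filter (\<lambda>x. 0 < snd x) V) (filter (\<lambda>x. 0 < snd x) U)"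
          "subseq (filter (\<lambda>x. snd x = 0) V) (filter (\<lambda>x. snd x = 0) U)"
          using s by (rule subseq_filter)+
        then have ds: "subseq ds bs" and cs: "subseq cs (as @ [(Lozenge, 0)])"
          using 3(1) c(2) True F by metis+
        \<comment> \<open>Since \<open>cs\<close> ends in a \<open>Bullet\<close>, it embeds in
          \<open>as\<close> without the final \<open>Lozenge\<close>. Now \<open>cs\<close> and
          \<open>ds\<close> embed in \<open>as\<close> and \<open>bs\<close>, and equal total length
          forces equality.\<close>
        have "last cs = (Bullet, 0)" "cs \<noteq> []" using c0 by (auto simp: cut_def)
        moreover obtain xs ys where xy: "cs = xs @ ys" "subseq xs as" "subseq ys [(Lozenge, 0)]"
          using cs subseq_append_iff by metis
        moreover have "ys = [] \<or> ys = [(Lozenge, 0)]" using xy(3) by (cases ys) (auto split: if_splits)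
        ultimately have "subseq cs as" by (elim disjE) simp_all
        then show ?thesis
          using ds len' list_emb_length[of "(=)" cs as] list_emb_length[of "(=)" ds bs]
          by (intro conjI subseq_same_length) auto
      next
        case False
        then have "cs = as" "ds \<noteq> []" "hd ds = (Bullet, i)" using c(1) d(1) ij by (auto simp: cut_def)
        moreover then have "subseq ds ((Lozenge, i) # bs)" using s c(2) 3(1) by (simp add: subseq_append')
        ultimately have "subseq ds bs" by (cases ds) auto
        then show ?thesis using \<open>cs = as\<close> len' subseq_same_length by force
      qed
      then show ?thesis using fill_eq[OF d] ij c(2) by simp
    qed
  qed
qed

text \<open>Finite sublevel sets make \<open>X\<close> countable. Ties of \<open>rk\<close> are
  broken by an enumeration, and each element is numbered by how many precede it, a finite number
  again by the hypothesis.\<close>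

lemma ex_injective_refinement:
  fixes rk :: "'b \<Rightarrow> nat"
  assumes fin: "\<And>N. finite {x \<in> X. rk x \<le> N}"
  shows "\<exists>code :: 'b \<Rightarrow> nat. inj_on code X \<and> (\<forall>x\<in>X. \<forall>y\<in>X. rk x < rk y \<longrightarrow> code x < code y)"
proof -
  have "countable (\<Union>N. {x \<in> X. rk x \<le> N})" using fin by (intro countable_UN) (auto intro: countable_finite)
  moreover have "(\<Union>N. {x \<in> X. rk x \<le> N}) = X" by auto
  ultimately obtain e :: "'b \<Rightarrow> nat" where e: "inj_on e X" by (auto simp: countable_def)
  define below where "below x = {y \<in> X. rk y < rk x \<or> rk y = rk x \<and> e y < e x}" for x
  have fb: "finite (below x)" for x
    by (rule finite_subset[OF _ fin[of "rk x"]]) (auto simp: below_def)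
  have lt: "card (below x) < card (below y)"
    if "x \<in> X" "y \<in> X" "rk x < rk y \<or> rk x = rk y \<and> e x < e y" for x y
  proof (rule psubset_card_mono[OF fb], rule psubsetI)
    show "below x \<subseteq> below y" using that by (auto simp: below_def)
    have "x \<in> below y" "x \<notin> below x" using that by (auto simp: below_def)
    then show "below x \<noteq> below y" by blast
  qed
  have "inj_on (\<lambda>x. card (below x)) X"
  proof (rule inj_onI, rule ccontr)
    fix x y assume xy: "x \<in> X" "y \<in> X" "card (below x) = card (below y)" "x \<noteq> y"
    then have "e x \<noteq> e y" using e by (auto dest: inj_onD)
    then have "(rk x < rk y \<or> rk x = rk y \<and> e x < e y) \<or> (rk y < rk x \<or> rk y = rk x \<and> e y < e x)"
      by linarith
    then show False using lt[of x y] lt[of y x] xy by auto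
  qed
  then show ?thesis using lt by blast
qed

text \<open>Monotonicity along \<open>subseq\<close> will make every stage of the filtration a
  subfunctor. Equality of stages exactly within a pair will make each step the attachment of a
  single horn.\<close>

lemma ex_stage:
  assumes n: "n \<noteq> 0"
  shows "\<exists>stage :: word \<Rightarrow> nat.
    (\<forall>V W. valid n V \<longrightarrow> valid n W \<longrightarrow> subseq V W \<longrightarrow> stage V \<le> stage W) \<and>
    (\<forall>V W. valid n V \<longrightarrow> valid n W \<longrightarrow> (stage V = stage W \<longleftrightarrow> fill V = fill W))"
proof -
  define X where "X = {U. valid n U \<and> fill U = U}"
  have J: "(UNIV :: job set) = {Lozenge, Bullet}" using job.exhaust by blast
  have "finite {U \<in> X. rank n U \<le> N}" for N
  proof (rule finite_subset)
    have "length U \<le> N" if "U \<in> X" "rank n U \<le> N" for U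
      using that by (simp add: X_def rank_def)
    moreover have "set U \<subseteq> UNIV \<times> {..n}" if "U \<in> X" for U
    proof
      fix x assume "x \<in> set U"
      then have "snd x \<in> {..n}" using that unfolding X_def valid_def by blast
      then show "x \<in> UNIV \<times> {..n}" by (simp add: mem_Times_iff)
    qed
    ultimately show "{U \<in> X. rank n U \<le> N} \<subseteq> {U. set U \<subseteq> UNIV \<times> {..n} \<and> length U \<le> N}"
      by blast
    show "finite {U :: word. set U \<subseteq> UNIV \<times> {..n} \<and> length U \<le> N}"
      by (intro finite_lists_length_le finite_cartesian_product) (simp_all add: J)
  qed
  then obtain code :: "word \<Rightarrow> nat" where code: "inj_on code X"
    "\<And>x y. x \<in> X \<Longrightarrow> y \<in> X \<Longrightarrow> rank n x < rank n y \<Longrightarrow> code x < code y"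
    using ex_injective_refinement[of X "rank n"] by blast
  have X: "fill V \<in> X" if "valid n V" for V using valid_fill[OF that n] by (simp add: X_def)
  have "code (fill V) \<le> code (fill W)" if V: "valid n V" and W: "valid n W" and s: "subseq V W" for V W
  proof -
    have "subseq V (fill W)" using s valid_fill(5)[OF W n] by (rule subseq_order.trans)
    then consider "fill V = fill W" | "rank n V < rank n (fill W)"
      using fill_subseq[OF V valid_fill(1,2)[OF W n] _ n] by blast
    then show ?thesis
    proof cases
      case 2
      then have "rank n (fill V) < rank n (fill W)" using valid_fill[OF V n] by (simp add: rank_def)
      then show ?thesis using code(2)[OF X[OF V] X[OF W]] by simp
    qed simp
  qed
  then show ?thesis using X inj_on_eq_iff[OF code(1)] by (intro exI[of _ "\<lambda>V. code (fill V)"]) blast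
qed

section \<open>Cells of \<open>J \<times> \<Theta>\<^sub>2[n; q]\<close>\<close>

abbreviation cylinder :: "theta_ob \<Rightarrow> 'u univ cellular_set" where
  "cylinder q \<equiv> J \<otimes> Theta_rep q"

definition corner :: "theta_ob \<Rightarrow> theta_ob \<Rightarrow> 'u univ set" where
  "corner q r = {Pair (Simp w) (Mor \<tau>) | w \<tau>. w \<in> {..length r} \<rightarrow>\<^sub>E UNIV \<and> \<tau> \<in> theta_hom r q \<and>
     ((\<forall>i\<le>length r. w i = Lozenge) \<or> Mor \<tau> \<in> (boundary q r :: 'u univ set))}"

definition reduced_word :: "theta_ob \<Rightarrow> 'u univ \<Rightarrow> word" where
  "reduced_word r y =
     remdups_adj (map (\<lambda>i. (the_simp (pfst y) i, hor (the_mor (psnd y)) i)) [0..<Suc (length r)])"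

lemma J_cells: "x \<in> cells J r \<longleftrightarrow> (\<exists>w. x = Simp w \<and> w \<in> {..length r} \<rightarrow>\<^sub>E UNIV)"
  by (auto simp: J_def cellular_of_simplicial_def J_simplicial_def)

lemma J_act: "act J g (Simp w) = Simp (compose {..length (tdom g)} w (hor g))"
  by (simp add: J_def cellular_of_simplicial_def J_simplicial_def theta_to_delta_def)

lemma cylinder_cells:
  "y \<in> cells (cylinder q) r \<longleftrightarrow>
     (\<exists>w \<tau>. y = Pair (Simp w) (Mor \<tau>) \<and> w \<in> {..length r} \<rightarrow>\<^sub>E UNIV \<and> \<tau> \<in> theta_hom r q)"
  unfolding cprod_def by (auto simp: J_cells Theta_rep_def)

lemma cylinder_act:
  "act (cylinder q) g (Pair (Simp w) (Mor \<tau>)) =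
     Pair (Simp (compose {..length (tdom g)} w (hor g))) (Mor (theta_comp \<tau> g))"
  by (simp add: J_act)

lemma is_presheaf_cylinder: "is_presheaf Theta2 (cylinder q)"
  by (intro is_presheaf_cprod is_presheaf_J is_presheaf_Theta_rep)

lemma corner_sub: "corner q r \<subseteq> cells (cylinder q) r"
  by (auto simp: corner_def cylinder_cells)

lemma is_subfunctor_corner: "is_subfunctor Theta2 (cylinder q) (corner q)"
  unfolding is_subfunctor_def
proof (intro conjI allI impI)
  fix a b g and y :: "'u univ" assume g: "g \<in> Hom Theta2 a b" and y: "y \<in> corner q b"
  then obtain w \<tau> where y': "y = Pair (Simp w) (Mor \<tau>)" "w \<in> {..length b} \<rightarrow>\<^sub>E UNIV" "\<tau> \<in> theta_hom b q"
    "(\<forall>i\<le>length b. w i = Lozenge) \<or> Mor \<tau> \<in> (boundary q b :: 'u univ set)" by (auto simp: corner_def)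
  have g': "g \<in> theta_hom a b" using g by simp
  note G = theta_homD[OF g']
  have "Mor (theta_comp \<tau> g) \<in> (boundary q a :: 'u univ set)" if "Mor \<tau> \<in> (boundary q b :: 'u univ set)"
    using subfunctorD(2)[OF is_subfunctor_boundary g that] by simp
  moreover have "\<forall>i\<le>length a. compose {..length a} w (hor g) i = Lozenge" if "\<forall>i\<le>length b. w i = Lozenge"
    using that ord_maps_le[OF G(3)] by (simp add: compose_def)
  moreover have "compose {..length a} w (hor g) \<in> {..length a} \<rightarrow>\<^sub>E UNIV"
    by (simp add: compose_def PiE_iff)
  ultimately show "act (cylinder q) g y \<in> corner q a"
    using y'(4) theta_comp_in[OF g' y'(3)] unfolding corner_def y'(1) cylinder_act G(1) by blast
qed (rule corner_sub)

lemma free_cell: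
  assumes y: "y \<in> cells (cylinder q) r" "y \<notin> corner q r" and q: "q \<noteq> []"
  obtains w \<tau> i where "y = Pair (Simp w) (Mor \<tau>)" "w \<in> {..length r} \<rightarrow>\<^sub>E UNIV" "\<tau> \<in> theta_hom r q"
    "theta_surj r q \<tau>" "i \<le> length r" "w i = Bullet"
proof -
  obtain w \<tau> where 1: "y = Pair (Simp w) (Mor \<tau>)" "w \<in> {..length r} \<rightarrow>\<^sub>E UNIV" "\<tau> \<in> theta_hom r q"
    using y(1) unfolding cylinder_cells by blast
  then have "\<not> (\<forall>i\<le>length r. w i = Lozenge)" and s: "theta_surj r q \<tau>"
    using y(2) boundary_iff[OF q 1(3)] unfolding corner_def by blast+
  then obtain i where "i \<le> length r" "w i \<noteq> Lozenge" by blast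
  moreover then have "w i = Bullet" by (cases "w i") auto
  ultimately show ?thesis using that[OF 1 s] by blast
qed

lemma not_corner:
  assumes "\<tau> \<in> theta_hom r q" "theta_surj r q \<tau>" "i \<le> length r" "w i = Bullet" "q \<noteq> []"
  shows "Pair (Simp w) (Mor \<tau>) \<notin> corner q r"
  using assms boundary_iff[OF assms(5,1)] by (auto simp: corner_def)

lemma valid_reduced_word:
  assumes y: "y \<in> cells (cylinder q) r" "y \<notin> corner q r" and q: "q \<noteq> []"
  shows "valid (length q) (reduced_word r y)"
proof -
  obtain w \<tau> i where f: "y = Pair (Simp w) (Mor \<tau>)" "\<tau> \<in> theta_hom r q"
    "theta_surj r q \<tau>" "i \<le> length r" "w i = Bullet"
    using free_cell[OF y q] .
  let ?L = "map (\<lambda>i. (w i, hor \<tau> i)) [0..<Suc (length r)]"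
  have e: "reduced_word r y = remdups_adj ?L" by (simp add: reduced_word_def f)
  have "sorted (map snd ?L)"
    unfolding sorted_iff_nth_mono using ord_maps_mono[OF theta_homD(3)[OF f(2)]] by (auto simp del: upt_Suc)
  then have "sorted (map snd (remdups_adj ?L))" by (rule sorted_map_remdups_adj)
  moreover have "snd ` set ?L = {..length q}"
    using f(3) by (simp add: theta_surj_def image_image atLeast0LessThan lessThan_Suc_atMost del: upt_Suc)
  moreover have "Bullet \<in> fst ` set ?L"
    using f(4,5) by (simp add: image_image image_iff Bex_def less_Suc_eq_le del: upt_Suc) metis
  ultimately show ?thesis unfolding valid_def e by simp
qed

text \<open>If \<open>h\<close> reads the vertices of \<open>y\<close> off its reduced word, then
  \<open>h\<close> after \<open>hor g\<close> reads off those of the restricted cell.\<close>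

lemma reduced_word_act:
  assumes y: "y \<in> cells (cylinder q) b" and g: "g \<in> theta_hom a b"
  shows "subseq (reduced_word a (act (cylinder q) g y)) (reduced_word b y)"
proof -
  obtain w \<tau> where f: "y = Pair (Simp w) (Mor \<tau>)" "\<tau> \<in> theta_hom b q"
    using y by (auto simp: cylinder_cells)
  note G = theta_homD[OF g] and T = theta_homD[OF f(2)]
  let ?N = "reduced_word b y"
  have "remdups_adj (map (\<lambda>i. (w i, hor \<tau> i)) [0..<Suc (length b)]) = ?N"
    by (simp add: reduced_word_def f(1))
  from remdups_adj_index[OF this] obtain h where h: "h \<in> ord_maps (length b) (length ?N - 1)"
    "\<And>i. i \<le> length b \<Longrightarrow> (w i, hor \<tau> i) = ?N ! h i"
    by blast
  have "(compose {..length a} w (hor g) i, hor (theta_comp \<tau> g) i) = ?N ! compose {..length a} h (hor g) i"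
    if "i \<le> length a" for i
    using h(2)[of "hor g i"] ord_maps_le[OF G(3) that] that G(1) by (simp add: compose_def)
  then have "map (\<lambda>i. (compose {..length a} w (hor g) i, hor (theta_comp \<tau> g) i)) [0..<Suc (length a)] =
      map (\<lambda>i. ?N ! compose {..length a} h (hor g) i) [0..<Suc (length a)]"
    by (intro map_cong refl) (simp add: less_Suc_eq_le del: upt_Suc theta_comp_sel)
  moreover have "reduced_word a (act (cylinder q) g y) = remdups_adj
      (map (\<lambda>i. (compose {..length a} w (hor g) i, hor (theta_comp \<tau> g) i)) [0..<Suc (length a)])"
    unfolding f(1) cylinder_act G(1) reduced_word_def by (simp del: upt_Suc theta_comp_sel)
  ultimately have "reduced_word a (act (cylinder q) g y) =
      remdups_adj (map (\<lambda>i. ?N ! compose {..length a} h (hor g) i) [0..<Suc (length a)])"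
    by (simp only:)
  moreover have "?N \<noteq> []" by (simp add: reduced_word_def remdups_adj_Nil_iff)
  ultimately show ?thesis using subseq_reindex[OF ord_maps_comp[OF G(3) h(1)]] by simp
qed

definition filtration :: "theta_ob \<Rightarrow> (word \<Rightarrow> nat) \<Rightarrow> nat \<Rightarrow> theta_ob \<Rightarrow> 'u univ set" where
  "filtration q stage i r =
     corner q r \<union> {y \<in> cells (cylinder q) r. stage (reduced_word r y) < i}"

lemma is_subfunctor_filtration:
  assumes q: "q \<noteq> []"
    and stage: "\<And>V W. valid (length q) V \<Longrightarrow> valid (length q) W \<Longrightarrow> subseq V W \<Longrightarrow> stage V \<le> stage W"
  shows "is_subfunctor Theta2 (cylinder q) (filtration q stage i :: _ \<Rightarrow> 'u univ set)"
  unfolding is_subfunctor_def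
proof (intro conjI allI impI)
  show "filtration q stage i a \<subseteq> cells (cylinder q) a" for a
    using corner_sub by (auto simp: filtration_def)
  fix a b g and y :: "'u univ" assume g: "g \<in> Hom Theta2 a b" and y: "y \<in> filtration q stage i b"
  let ?z = "act (cylinder q) g y"
  have yc: "y \<in> cells (cylinder q) b" using y corner_sub by (auto simp: filtration_def)
  have zc: "?z \<in> cells (cylinder q) a" by (rule presheafD(1)[OF is_presheaf_cylinder g yc])
  show "?z \<in> filtration q stage i a"
  proof (cases "?z \<in> corner q a")
    case False
    then have "y \<notin> corner q b" using subfunctorD(2)[OF is_subfunctor_corner g] by blast
    then have "valid (length q) (reduced_word b y)" "stage (reduced_word b y) < i"
      using valid_reduced_word[OF yc _ q] y by (auto simp: filtration_def)
    moreover have "valid (length q) (reduced_word a ?z)" by (rule valid_reduced_word[OF zc False q])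
    moreover have "subseq (reduced_word a ?z) (reduced_word b y)"
      using reduced_word_act[OF yc, of g a] g by simp
    ultimately have "stage (reduced_word a ?z) < i"
      using stage[of "reduced_word a ?z" "reduced_word b y"] by linarith
    then show ?thesis using zc by (simp add: filtration_def)
  qed (simp add: filtration_def)
qed

subsection \<open>The nondegenerate cell with a given word\<close>

text \<open>A step within a column carries no vertical data, so its entry is 0 and the cell is
  nondegenerate. A step entering column \<open>k\<close> carries the whole \<open>k\<close>-th entry
  of \<open>q\<close>, which is why \<open>word_mor\<close> has only identities as
  components.\<close>

definition word_ob :: "theta_ob \<Rightarrow> word \<Rightarrow> theta_ob" where
  "word_ob q U = map (\<lambda>l. if snd (U ! l) = snd (U ! Suc l) then 0 else entry q (snd (U ! Suc l)))
     [0..<length U - 1]"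

definition word_mor :: "theta_ob \<Rightarrow> word \<Rightarrow> theta_mor" where
  "word_mor q U = ThMor (word_ob q U) q (\<lambda>i\<in>{..length U - 1}. snd (U ! i))
     (\<lambda>k\<in>{0<..length q}. ord_id (entry q k))"

definition word_cell :: "theta_ob \<Rightarrow> word \<Rightarrow> 'u univ" where
  "word_cell q U = Pair (Simp (\<lambda>i\<in>{..length U - 1}. fst (U ! i))) (Mor (word_mor q U))"

lemma word_ob_length [simp]: "length (word_ob q U) = length U - 1"
  by (simp add: word_ob_def)

lemma word_ob_entry:
  "1 \<le> l \<Longrightarrow> l \<le> length U - 1 \<Longrightarrow>
     entry (word_ob q U) l = (if snd (U ! (l - 1)) = snd (U ! l) then 0 else entry q (snd (U ! l)))"
  by (simp add: word_ob_def)

lemma word_hor: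
  assumes U: "valid n U"
  shows "(\<lambda>i\<in>{..length U - 1}. snd (U ! i)) \<in> ord_maps (length U - 1) n" (is "?h \<in> _")
    "(\<lambda>i\<in>{..length U - 1}. snd (U ! i)) ` {..length U - 1} = {..n}"
proof -
  note V = validD[OF U]
  have iv: "{..length U - 1} = {..<length U}" using V(4) by (cases U) auto
  have "?h ` {..length U - 1} = (\<lambda>i. snd (U ! i)) ` {..<length U}" using iv by simp
  also have "\<dots> = snd ` set U" by (auto simp: set_conv_nth)
  finally show im: "?h ` {..length U - 1} = {..n}" using V(3) by simp
  show "?h \<in> ord_maps (length U - 1) n"
  proof (rule ord_mapsI)
    show "?h i \<le> n" if "i \<le> length U - 1" for i using im that by blast
    show "?h i \<le> ?h j" if "i \<le> j" "j \<le> length U - 1" for i j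
    proof -
      have "j < length U" using that V(4) by (cases U) auto
      then show ?thesis using V(2) that sorted_nth_mono[of "map snd U" i j] by simp
    qed
  qed simp
qed

lemma word_step:
  assumes U: "valid n U" and l: "1 \<le> l" "l \<le> length U - 1"
    and k: "snd (U ! (l - 1)) < k" "k \<le> snd (U ! l)"
  shows "k = snd (U ! l)"
  using ord_maps_surj_step[OF word_hor[OF U], of "l - 1"] l k by (simp split: if_splits)

lemma word_jump:
  assumes U: "valid n U" and l: "1 \<le> l" "l \<le> length U - 1" and ne: "snd (U ! (l - 1)) \<noteq> snd (U ! l)"
  shows "snd (U ! (l - 1)) < snd (U ! l)"
    "segment (length U - 1) (\<lambda>i\<in>{..length U - 1}. snd (U ! i)) (snd (U ! l)) = l"
proof -
  have "l - 1 \<le> length U - 1" using l by simp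
  then show "snd (U ! (l - 1)) < snd (U ! l)"
    using ord_maps_mono[OF word_hor(1)[OF U], of "l - 1" l] l ne by simp
  then show "segment (length U - 1) (\<lambda>i\<in>{..length U - 1}. snd (U ! i)) (snd (U ! l)) = l"
    using \<open>l - 1 \<le> length U - 1\<close> by (intro segment_eq[OF word_hor(1)[OF U] l]) (use l in simp_all)
qed

lemma word_mono:
  assumes U: "valid n U" and ij: "i \<le> j" "j \<le> length U - 1"
  shows "snd (U ! i) \<le> snd (U ! j)"
  using ord_maps_mono[OF word_hor(1)[OF U] ij] ij by simp

lemma word_mor_in:
  assumes U: "valid (length q) U"
  shows "word_mor q U \<in> theta_hom (word_ob q U) q"
proof -
  note H = word_hor[OF U]
  have "ver (word_mor q U) k \<in> ord_maps (entry (word_ob q U) l) (entry q k)"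
    if l: "1 \<le> l" "l \<le> length U - 1"
      and k: "hor (word_mor q U) (l - 1) < k" "k \<le> hor (word_mor q U) l" for l k
  proof -
    have "l - 1 \<le> length U - 1" using l by simp
    then have k': "snd (U ! (l - 1)) < k" "k \<le> snd (U ! l)" using k l by (simp_all add: word_mor_def)
    have "snd (U ! l) \<le> length q" using ord_maps_le[OF H(1) l(2)] l by simp
    then show ?thesis
      using word_step[OF U l k'] k' ord_id_in word_ob_entry[OF l, of q] by (simp add: word_mor_def)
  qed
  moreover have "hor (word_mor q U) 0 = 0" "hor (word_mor q U) (length U - 1) = length q"
    using ord_maps_surj_ends[OF H] by (simp_all add: word_mor_def)
  ultimately show ?thesis
    using H(1) unfolding theta_hom_def by (simp add: word_mor_def)
qed

lemma word_cell_in: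
  assumes "valid (length q) U"
  shows "word_cell q U \<in> cells (cylinder q) (word_ob q U)"
  using word_mor_in[OF assms] by (auto simp: word_cell_def cylinder_cells)

lemma word_cell_act:
  assumes g: "g \<in> theta_hom r (word_ob q U)"
  shows "act (cylinder q) g (word_cell q U) =
    Pair (Simp (\<lambda>i\<in>{..length r}. fst (U ! hor g i))) (Mor (theta_comp (word_mor q U) g))"
    "i \<le> length r \<Longrightarrow> hor (theta_comp (word_mor q U) g) i = snd (U ! hor g i)"
    "reduced_word r (act (cylinder q) g (word_cell q U)) =
      remdups_adj (map (\<lambda>i. U ! hor g i) [0..<Suc (length r)])"
proof -
  note G = theta_homD[OF g]
  have le: "hor g i \<le> length U - 1" if "i \<le> length r" for i using ord_maps_le[OF G(3) that] by simp
  show hor: "hor (theta_comp (word_mor q U) g) i = snd (U ! hor g i)" if "i \<le> length r" for i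
    using that le G(1) by (simp add: compose_def word_mor_def)
  show 1: "act (cylinder q) g (word_cell q U) =
    Pair (Simp (\<lambda>i\<in>{..length r}. fst (U ! hor g i))) (Mor (theta_comp (word_mor q U) g))"
    unfolding word_cell_def cylinder_act using le G(1) by (auto simp: compose_def fun_eq_iff)
  show "reduced_word r (act (cylinder q) g (word_cell q U)) =
      remdups_adj (map (\<lambda>i. U ! hor g i) [0..<Suc (length r)])"
    unfolding reduced_word_def 1
    by (intro arg_cong[of _ _ remdups_adj] map_cong)
      (use hor in \<open>auto simp: less_Suc_eq_le simp del: upt_Suc theta_comp_sel\<close>)
qed

text \<open>Where \<open>U\<close> changes column, \<open>word_mor\<close> is vertically the
  identity, so the component of \<open>g\<close> can be recovered from the composite. At the other
  steps the entry is 0 and there is nothing to recover.\<close>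

lemma word_cell_ver:
  assumes U: "valid (length q) U" and g: "g \<in> theta_hom r (word_ob q U)"
    and l: "1 \<le> l" "l \<le> length r" "hor g (l - 1) < j" "j \<le> hor g l"
    and ne: "snd (U ! (j - 1)) \<noteq> snd (U ! j)"
  shows "hor (theta_comp (word_mor q U) g) (l - 1) < snd (U ! j)"
    "snd (U ! j) \<le> hor (theta_comp (word_mor q U) g) l"
    "ver (theta_comp (word_mor q U) g) (snd (U ! j)) = ver g j"
    "entry (word_ob q U) j = entry q (snd (U ! j))"
proof -
  note G = theta_homD[OF g]
  have le: "hor g i \<le> length U - 1" if "i \<le> length r" for i using ord_maps_le[OF G(3) that] by simp
  have l1: "l - 1 \<le> length r" using l by simp
  have j: "1 \<le> j" "j \<le> length U - 1" using l le[OF l(2)] by auto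
  note jump = word_jump[OF U j ne]
  have lo: "snd (U ! hor g (l - 1)) < snd (U ! j)"
  proof -
    have "hor g (l - 1) \<le> j - 1" "j - 1 \<le> length U - 1" using l(3) j by auto
    then show ?thesis using word_mono[OF U] jump(1) le_less_trans by blast
  qed
  have hi: "snd (U ! j) \<le> snd (U ! hor g l)" using word_mono[OF U l(4) le[OF l(2)]] .
  show "hor (theta_comp (word_mor q U) g) (l - 1) < snd (U ! j)"
    "snd (U ! j) \<le> hor (theta_comp (word_mor q U) g) l"
    using lo hi word_cell_act(2)[OF g] l(2) l1 by simp_all
  show ent: "entry (word_ob q U) j = entry q (snd (U ! j))" using word_ob_entry[OF j] ne by simp
  have "hor (word_mor q U) (hor g (l - 1)) < snd (U ! j)" "snd (U ! j) \<le> hor (word_mor q U) (hor g l)"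
    using lo hi le[OF l1] le[OF l(2)] by (simp_all add: word_mor_def)
  note v = theta_comp_ver[OF g word_mor_in[OF U] l(1,2) this]
  have "snd (U ! j) \<le> length q" using word_hor(2)[OF U] j by force
  moreover have "0 < snd (U ! j)" using jump(1) by simp
  ultimately have "ver (word_mor q U) (snd (U ! j)) = ord_id (entry q (snd (U ! j)))"
    by (simp add: word_mor_def)
  moreover have "segment (length (word_ob q U)) (hor (word_mor q U)) (snd (U ! j)) = j"
    using jump(2) by (simp add: word_mor_def)
  ultimately show "ver (theta_comp (word_mor q U) g) (snd (U ! j)) = ver g j"
    unfolding v using ord_maps_id(2)[OF G(4)[OF l]] ent by simp
qed

lemma word_cell_factor:
  assumes U: "valid (length q) U" and y: "y = Pair (Simp w) (Mor \<tau>)" "w \<in> {..length r} \<rightarrow>\<^sub>E UNIV"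
    and \<tau>: "\<tau> \<in> theta_hom r q"
    and h: "h \<in> ord_maps (length r) (length U - 1)" "\<And>i. i \<le> length r \<Longrightarrow> U ! h i = (w i, hor \<tau> i)"
  shows "\<exists>g \<in> theta_hom r (word_ob q U). y = act (cylinder q) g (word_cell q U)"
proof -
  note T = theta_homD[OF \<tau>]
  have le: "h i \<le> length U - 1" if "i \<le> length r" for i using ord_maps_le[OF h(1) that] .
  \<comment> \<open>Over a step within a column the entry is 0, so the constant map is the only
    choice.\<close>
  define v where "v j = (if snd (U ! (j - 1)) = snd (U ! j)
    then \<lambda>t\<in>{..entry r (segment (length r) h j)}. 0 else ver \<tau> (snd (U ! j)))" for j
  have "\<exists>g \<in> theta_hom r (word_ob q U). hor g = h \<and> \<tau> = theta_comp (word_mor q U) g"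
  proof (rule theta_factor[OF word_mor_in[OF U] \<tau>, of h v])
    show "h \<in> ord_maps (length r) (length (word_ob q U))" using h(1) by simp
    show "hor (word_mor q U) (h i) = hor \<tau> i" if "i \<le> length r" for i
      using h(2)[OF that] le[OF that] by (simp add: word_mor_def)
    fix l j assume l: "1 \<le> l" "l \<le> length r" and j: "h (l - 1) < j" "j \<le> h l"
    have l1: "l - 1 \<le> length r" using l by simp
    have jU: "1 \<le> j" "j \<le> length U - 1" "h (l - 1) \<le> j - 1" "j - 1 \<le> length U - 1"
      using j le[OF l(2)] by auto
    have seg: "segment (length r) h j = l" by (rule segment_eq[OF h(1) l j])
    have ht: "hor \<tau> (l - 1) = snd (U ! h (l - 1))" "hor \<tau> l = snd (U ! h l)"
      using h(2)[OF l1] h(2)[OF l(2)] by simp_all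
    have lo: "hor \<tau> (l - 1) \<le> snd (U ! (j - 1))" and hi: "snd (U ! j) \<le> hor \<tau> l"
      unfolding ht using word_mono[OF U] jU j(2) le[OF l(2)] by blast+
    have V: "ver \<tau> (snd (U ! j)) \<in> ord_maps (entry r l) (entry q (snd (U ! j)))"
      if "snd (U ! (j - 1)) \<noteq> snd (U ! j)"
      using T(4)[OF l] word_jump(1)[OF U jU(1,2) that] lo hi by simp
    show "v j \<in> ord_maps (entry r l) (entry (word_ob q U) j)"
      unfolding word_ob_entry[OF jU(1,2)] using V seg by (auto simp: v_def intro!: ord_mapsI)
    fix k assume "hor (word_mor q U) (j - 1) < k" "k \<le> hor (word_mor q U) j"
    then have k: "snd (U ! (j - 1)) < k" "k \<le> snd (U ! j)" using jU by (simp_all add: word_mor_def)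
    have e: "k = snd (U ! j)" by (rule word_step[OF U jU(1,2) k])
    then have ne: "snd (U ! (j - 1)) \<noteq> snd (U ! j)" using k by simp
    have "snd (U ! j) \<le> length q" using word_hor(2)[OF U] jU(2) by force
    then show "ver \<tau> k = compose {..entry r l} (ver (word_mor q U) k) (v j)"
      using ord_maps_id(2)[OF V[OF ne]] ne k e by (simp add: word_mor_def v_def)
  qed
  then obtain g where g: "g \<in> theta_hom r (word_ob q U)" "\<tau> = theta_comp (word_mor q U) g" "hor g = h"
    by blast
  have "(\<lambda>i\<in>{..length r}. fst (U ! h i)) = w"
    using h(2) y(2) by (auto simp: fun_eq_iff PiE_iff extensional_def)
  then have "y = act (cylinder q) g (word_cell q U)"
    unfolding word_cell_act(1)[OF g(1)] using g(2,3) y(1) by simp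
  then show ?thesis using g(1) by blast
qed


subsection \<open>Attaching a cell and its face\<close>

text \<open>One pair: \<open>U\<close> is the larger word and \<open>V\<close> the smaller.
  \<open>k\<close> is the position of the inserted letter, hence the vertex of \<open>p\<close> at
  which the horn is open, and \<open>m\<close> is the horizontal length of \<open>p\<close>.\<close>

locale filled_word =
  fixes q :: theta_ob and U as bs :: word and c :: nat
  assumes q: "q \<noteq> []" and U: "valid (length q) U"
    and cut: "cut c as bs" and U_eq: "U = as @ (Lozenge, c) # bs"
begin

abbreviation "p \<equiv> word_ob q U"
abbreviation "k \<equiv> length as"
abbreviation "m \<equiv> length U - 1"
abbreviation "V \<equiv> as @ bs"
abbreviation "face_word r g \<equiv> remdups_adj (map (\<lambda>i. U ! hor g i) [0..<Suc (length r)])"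

lemma n: "length q \<noteq> 0"
  using q by simp

lemma k: "1 \<le> k" "k < m"
proof -
  have "as \<noteq> []" "bs \<noteq> []" using cut_nonempty[OF cut _ n] U U_eq by auto
  then show "1 \<le> k" "k < m" by (simp_all add: U_eq Suc_le_eq)
qed

lemma V: "valid (length q) V" "length V = m" "length U = Suc m"
proof -
  have "bs \<noteq> []" using cut_nonempty(2)[OF cut _ n] U U_eq by auto
  then show "valid (length q) V" using cut_valid_iff[OF cut] U U_eq by simp
qed (simp_all add: U_eq)

lemma V_nth: "j \<le> m - 1 \<Longrightarrow> V ! j = U ! coface m k j"
  by (auto simp: U_eq nth_append coface_val Suc_diff_le)

lemma fill_V: "fill V = U" and fill_U: "fill U = U"
  using fill_eq[OF cut] U_eq by simp_all

lemma fill_eq_U: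
  assumes W: "valid (length q) W" "fill W = U"
  shows "W = U \<or> W = V"
proof -
  obtain j cs ds where d: "cut j cs ds" "W = cs @ ds \<or> W = cs @ (Lozenge, j) # ds"
    using valid_cut[OF W(1)] .
  have e: "U = cs @ (Lozenge, j) # ds" using fill_eq[OF d] W(2) by simp
  have "c = j" "as = cs" "bs = ds"
    using cut_unique[OF cut _ d(1), of U] U_eq e by auto
  then show ?thesis using d(2) e by auto
qed

text \<open>Off the horn only vertex \<open>k\<close> can be missed. If it is hit, the vertices run
  through all of \<open>U\<close>; if not, they run through \<open>U\<close> without its letter
  \<open>k\<close>, which is \<open>V\<close>, and this word is again reduced.\<close>

lemma off_horn_reduced:
  assumes g: "g \<in> theta_hom r p" and off: "Mor g \<notin> horizontal_horn p k r"
  obtains "face_word r g = U" "hor g ` {..length r} = {..m}"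
  | f where "face_word r g = V"
      "f \<in> ord_maps (length r) (m - 1)" "f ` {..length r} = {..m - 1}"
      "\<And>i. i \<le> length r \<Longrightarrow> hor g i = coface m k (f i)"
proof -
  note G = theta_homD[OF g]
  have h: "hor g \<in> ord_maps (length r) m" using G(3) by simp
  have im: "j \<in> hor g ` {..length r}" if "j \<le> m" "j \<noteq> k" for j
    using not_in_horn(1)[OF g _ _ off] k that by simp
  show ?thesis
  proof (cases "k \<in> hor g ` {..length r}")
    case True
    then have "hor g ` {..length r} = {..m}" using im ord_maps_le[OF h] by auto
    then show ?thesis
      using that(1) remdups_adj_surj[OF validD(1)[OF U] validD(4)[OF U] h] by blast
  next
    case False
    define f where "f = (\<lambda>t\<in>{..length r}. if hor g t < k then hor g t else hor g t - 1)"
    have km: "k \<le> m" using k by simp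
    have f: "f \<in> ord_maps (length r) (m - 1)" "hor g = compose {..length r} (coface m k) f"
      using coface_factor[OF h km False] by (simp_all add: f_def)
    have hf: "hor g i = coface m k (f i)" if "i \<le> length r" for i
      using fun_cong[OF f(2), of i] that by (simp add: compose_def)
    have "j \<in> f ` {..length r}" if j: "j \<le> m - 1" for j
    proof -
      have "coface m k j \<le> m" "coface m k j \<noteq> k" using j k by (auto simp: coface_val)
      then obtain i where i: "i \<le> length r" "coface m k j = hor g i" using im by fastforce
      then have "f i = j" using j k by (auto simp: f_def coface_val split: if_splits)
      then show ?thesis using i by auto
    qed
    then have imf: "f ` {..length r} = {..m - 1}" using ord_maps_le[OF f(1)] by auto
    have "U ! hor g i = V ! f i" if "i \<le> length r" for i
      using V_nth[OF ord_maps_le[OF f(1) that]] hf[OF that] by simp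
    then have "map (\<lambda>i. U ! hor g i) [0..<Suc (length r)] = map (\<lambda>i. V ! f i) [0..<Suc (length r)]"
      by (intro map_cong) (auto simp: less_Suc_eq_le simp del: upt_Suc)
    moreover have "remdups_adj (map (\<lambda>i. V ! f i) [0..<Suc (length r)]) = V"
      by (rule remdups_adj_surj[OF validD(1)[OF V(1)] validD(4)[OF V(1)]]) (use f imf V in simp_all)
    ultimately have "face_word r g = V" by (simp only:)
    then show ?thesis using that(2) f(1) imf hf by blast
  qed
qed

text \<open>Validity of the word \<open>U\<close> or \<open>V\<close> gives horizontal surjectivity
  and a \<open>Bullet\<close>. Vertical surjectivity passes from \<open>g\<close> to the composite
  because over each column that composite has a component of \<open>g\<close>.\<close>

lemma off_horn_free:
  assumes g: "g \<in> theta_hom r p" and off: "Mor g \<notin> horizontal_horn p k r"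
  shows "act (cylinder q) g (word_cell q U) \<notin> corner q r"
proof -
  let ?W = "remdups_adj (map (\<lambda>i. U ! hor g i) [0..<Suc (length r)])"
  let ?\<tau> = "theta_comp (word_mor q U) g"
  note G = theta_homD[OF g] and M = theta_homD[OF word_mor_in[OF U]]
  have "?W = U \<or> ?W = V"
    using off_horn_reduced[OF g off] by metis
  then have W: "valid (length q) ?W" using U V(1) by metis
  have set: "set ?W = (\<lambda>i. U ! hor g i) ` {..length r}"
    by (simp add: atLeast0LessThan lessThan_Suc_atMost del: upt_Suc)
  have "hor ?\<tau> ` {..length r} = snd ` set ?W"
    unfolding set image_image by (intro image_cong) (auto simp: word_cell_act(2)[OF g] simp del: theta_comp_sel)
  then have im: "hor ?\<tau> ` {..length r} = {..length q}" using validD(3)[OF W] by simp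
  have "ver ?\<tau> x ` {..entry r l} = {..entry q x}"
    if l: "1 \<le> l" "l \<le> length r" "hor ?\<tau> (l - 1) < x" "x \<le> hor ?\<tau> l" for l x
  proof -
    have "l - 1 \<le> length r" using l by simp
    then have x: "hor (word_mor q U) (hor g (l - 1)) < x" "x \<le> hor (word_mor q U) (hor g l)"
      using l G(1) by (simp_all add: compose_def)
    define j where "j = segment (length p) (hor (word_mor q U)) x"
    note S = segment_comp[OF G(3) M(3) l(1,2) x, folded j_def]
    have jm: "j \<le> m" "j - 1 \<le> m" using S(4) by auto
    have xj: "snd (U ! (j - 1)) < x" "x \<le> snd (U ! j)"
      using S(5,6) jm by (simp_all add: word_mor_def)
    have "x = snd (U ! j)" by (rule word_step[OF U S(3) jm(1) xj])
    then show ?thesis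
      using word_cell_ver(3,4)[OF U g l(1,2) S(1,2)] not_in_horn(2)[OF g _ _ off l(1,2) S(1,2)] xj k
      by simp
  qed
  then have surj: "theta_surj r q ?\<tau>" using im unfolding theta_surj_def by blast
  have "Bullet \<in> (\<lambda>i. fst (U ! hor g i)) ` {..length r}"
    using W unfolding valid_def set image_image by blast
  then obtain i where "i \<le> length r" "fst (U ! hor g i) = Bullet" by fastforce
  then show ?thesis
    unfolding word_cell_act(1)[OF g]
    by (intro not_corner[OF theta_comp_in[OF g word_mor_in[OF U]] surj _ _ q]) auto
qed

text \<open>Equal cells have equal words, so both maps hit vertex \<open>k\<close> or both miss it,
  and uniqueness of the index surjection gives equal horizontal parts. Vertical components are
  recovered where \<open>U\<close> changes column and have target 0 elsewhere; so even maps missing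
  \<open>k\<close> are not confused by the choice of a shuffle.\<close>

lemma off_horn_inj:
  fixes g g' :: theta_mor
  assumes gg': "g \<in> theta_hom r p" "g' \<in> theta_hom r p"
      "Mor g \<notin> horizontal_horn p k r" "Mor g' \<notin> horizontal_horn p k r"
    and eq: "act (cylinder q) g (word_cell q U :: 'u univ) = act (cylinder q) g' (word_cell q U)"
  shows "g = g'"
proof -
  note g = gg'(1,3) and g' = gg'(2,4)
  note G = theta_homD[OF g(1)] and G' = theta_homD[OF g'(1)]
  have e1: "(\<lambda>i\<in>{..length r}. fst (U ! hor g i)) = (\<lambda>i\<in>{..length r}. fst (U ! hor g' i))"
    and e2: "theta_comp (word_mor q U) g = theta_comp (word_mor q U) g'"
    using eq unfolding word_cell_act(1)[OF g(1)] word_cell_act(1)[OF g'(1)] by simp_all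
  have nth: "U ! hor g i = U ! hor g' i" if "i \<le> length r" for i
    using fun_cong[OF e1, of i] word_cell_act(2)[OF g(1) that] word_cell_act(2)[OF g'(1) that] e2 that
    by (simp add: prod_eq_iff)
  have "U \<noteq> V" using V by auto
  have red: "face_word r g = face_word r g'"
    using nth by (intro arg_cong[of _ _ remdups_adj] map_cong) (auto simp: less_Suc_eq_le simp del: upt_Suc)
  have "hor g = hor g'"
  proof (rule off_horn_reduced[OF g])
    assume 1: "face_word r g = U" "hor g ` {..length r} = {..m}"
    then have 2: "hor g' ` {..length r} = {..m}"
      using red off_horn_reduced[OF g'] \<open>U \<noteq> V\<close> by metis
    show ?thesis
      by (rule reduced_index_unique[OF validD(1,4)[OF U], of _ "length r"])
        (use 1(2) 2 G(3) G'(3) nth in simp_all)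
  next
    fix f assume f: "face_word r g = V"
      "f \<in> ord_maps (length r) (m - 1)" "f ` {..length r} = {..m - 1}"
      "\<And>i. i \<le> length r \<Longrightarrow> hor g i = coface m k (f i)"
    obtain f' where f': "f' \<in> ord_maps (length r) (m - 1)" "f' ` {..length r} = {..m - 1}"
      "\<And>i. i \<le> length r \<Longrightarrow> hor g' i = coface m k (f' i)"
      using off_horn_reduced[OF g'] red f(1) \<open>U \<noteq> V\<close> by metis
    have "V ! f i = V ! f' i" if "i \<le> length r" for i
      using nth[OF that] f(4)[OF that] f'(3)[OF that] V_nth[OF ord_maps_le[OF f(2) that]]
        V_nth[OF ord_maps_le[OF f'(1) that]] by simp
    then have "f = f'"
      by (intro reduced_index_unique[OF validD(1,4)[OF V(1)], of _ "length r"])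
        (use f(2,3) f'(1,2) V(2) in simp_all)
    then show ?thesis using f(4) f'(3) by (intro ord_maps_eqI[OF G(3) G'(3)]) simp
  qed
  then show ?thesis
  proof (intro theta_eqI[OF g(1) g'(1)])
    fix l j assume h: "hor g = hor g'" and l: "1 \<le> l" "l \<le> length r" "hor g (l - 1) < j" "j \<le> hor g l"
    show "ver g j = ver g' j"
    proof (cases "snd (U ! (j - 1)) = snd (U ! j)")
      case True
      have "1 \<le> j" "j \<le> m" using l ord_maps_le[OF G(3) l(2)] by auto
      then have z: "entry p j = 0" using word_ob_entry True by simp
      have v: "ver g j \<in> ord_maps (entry r l) 0" "ver g' j \<in> ord_maps (entry r l) 0"
        using G(4)[OF l] G'(4)[OF l[unfolded h]] z by simp_all
      then show ?thesis by (rule ord_maps_eqI) (metis ord_maps_le le_zero_eq v)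
    next
      case False
      then show ?thesis
        using word_cell_ver(3)[OF U g(1) l] word_cell_ver(3)[OF U g'(1) l[unfolded h]] e2 by simp
    qed
  qed simp
qed

text \<open>Vertical faces fall into the corner. A horizontal face that drops another letter is too
  short for \<open>U\<close>, and it could only be \<open>V\<close> if two neighbouring letters of
  \<open>U\<close> were equal.\<close>

lemma hyperface_reduced:
  fixes f :: theta_mor
  assumes f: "f \<in> hyperfaces p - horizontal_hyperfaces p k"
    and free: "act (cylinder q) f (word_cell q U :: 'u univ) \<notin> corner q (tdom f)"
  shows "reduced_word (tdom f) (act (cylinder q) f (word_cell q U :: 'u univ)) \<notin> {U, V}"
proof -
  let ?r = "tdom f" and ?z = "act (cylinder q) f (word_cell q U) :: 'u univ"
  have fi: "f \<in> theta_hom ?r p" using f hyperfaces_in by blast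
  note F = theta_homD[OF fi]
  consider l i where "1 \<le> l" "l \<le> length p" "entry p l \<ge> 1" "i \<le> entry p l" "f = vface p l i"
    | j where "j \<le> length p" "j \<noteq> k" "f \<in> horizontal_hyperfaces p j"
    using f unfolding hyperfaces_def vertical_hyperfaces_def by blast
  then show ?thesis
  proof cases
    case 1
    have r: "?r = p[l - 1 := entry p l - 1]" using 1 by (simp add: vface_def)
    have lm: "l \<le> m" "l - 1 \<le> m" using 1 by auto
    have hf: "hor f t = t" if "t \<le> m" for t using 1 that by (simp add: vface_def ord_id_def)
    \<comment> \<open>A positive entry occurs only where \<open>U\<close> changes column. There the
      component of the composite is that of the face, which omits \<open>i\<close>, against the
      surjectivity of a cell outside the corner.\<close>
    have ne: "snd (U ! (l - 1)) \<noteq> snd (U ! l)" using 1(3) word_ob_entry[OF 1(1) lm(1), of q] by auto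
    have lr: "l \<le> length ?r" "hor f (l - 1) < l" "l \<le> hor f l" using lm 1(1) r hf by simp_all
    note v = word_cell_ver[OF U fi 1(1) lr ne]
    have "theta_surj ?r q (theta_comp (word_mor q U) f)"
      using free boundary_iff[OF q theta_comp_in[OF fi word_mor_in[OF U]]]
        theta_comp_in[OF fi word_mor_in[OF U]]
      unfolding word_cell_act(1)[OF fi] corner_def by auto
    then have "ver f l ` {..entry ?r l} = {..entry p l}"
      using v 1(1) lr(1) unfolding theta_surj_def by metis
    then have "i \<in> coface (entry p l) i ` {..entry p l - 1}"
      using 1 r by (simp add: vface_def)
    then show ?thesis by (auto simp: coface_val split: if_splits)
  next
    case 2
    have hf: "hor f = coface m j" using horizontal_hyperface_hor[OF 2(3)] by simp
    have "length ?r = m - 1" using 2(3)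
      by (auto simp: horizontal_hyperfaces_def hface_first_def hface_last_def hface_inner_def)
    then have len: "length (map (\<lambda>i. U ! hor f i) [0..<Suc (length ?r)]) = m" using k by simp
    have "V = map (\<lambda>i. U ! hor f i) [0..<Suc (length ?r)]"
      if "remdups_adj (map (\<lambda>i. U ! hor f i) [0..<Suc (length ?r)]) = V"
    proof -
      have "distinct_adj (map (\<lambda>i. U ! hor f i) [0..<Suc (length ?r)])"
        unfolding distinct_adj_conv_length_remdups_adj that len using V(2) by simp
      then show ?thesis using that by (simp add: distinct_adj_altdef del: upt_Suc)
    qed
    \<comment> \<open>Deleting letter \<open>j\<close> and deleting letter \<open>k\<close> first
      differ at position \<open>min j k\<close>: one result has the letter of \<open>U\<close>
      there, the other its successor.\<close>
    moreover have "V \<noteq> map (\<lambda>i. U ! hor f i) [0..<Suc (length ?r)]" 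
    proof
      assume e: "V = map (\<lambda>i. U ! hor f i) [0..<Suc (length ?r)]"
      have e': "V ! i = U ! coface m j i" if "i \<le> m - 1" for i
        using that \<open>length ?r = m - 1\<close> hf unfolding e by (simp del: upt_Suc)
      note d = distinct_adj_nth[OF validD(1)[OF U]]
      show False
      proof (cases "j < k")
        case True
        then have "j \<le> m - 1" "Suc j < length U" using k by auto
        then show False using e'[of j] V_nth[of j] d[of j] True by (simp add: coface_val)
      next
        case False
        then have "k < j" "k \<le> m - 1" "Suc k < length U" using 2(2) k by auto
        then show False using e'[of k] V_nth[of k] d[of k] by (simp add: coface_val)
      qed
    qed
    moreover have "remdups_adj (map (\<lambda>i. U ! hor f i) [0..<Suc (length ?r)]) \<noteq> U"
      using remdups_adj_length[of "map (\<lambda>i. U ! hor f i) [0..<Suc (length ?r)]"] len k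
      by (metis V(3) Suc_n_not_le_n)
    ultimately show ?thesis unfolding word_cell_act(3)[OF fi] by blast
  qed
qed

text \<open>The cells new at this stage are those outside the corner with word \<open>U\<close> or
  \<open>V\<close>. They are exactly the restrictions of \<open>word_cell q U\<close> along maps off
  the horn, which is the situation of \<open>attach_cell\<close>.\<close>

lemma attach_word:
  fixes stage :: "word \<Rightarrow> nat"
  assumes mono: "\<And>V W. valid (length q) V \<Longrightarrow> valid (length q) W \<Longrightarrow> subseq V W \<Longrightarrow> stage V \<le> stage W"
    and eq: "\<And>V W. valid (length q) V \<Longrightarrow> valid (length q) W \<Longrightarrow> stage V = stage W \<longleftrightarrow> fill V = fill W"
  shows "inclusion (sub_cellular_set (cylinder q) (filtration q stage (Suc (stage U))))
    (filtration q stage (stage U) :: _ \<Rightarrow> 'u univ set) \<in> cell \<H>\<^sub>h"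
proof -
  let ?Y = "cylinder q :: 'u univ cellular_set" and ?x = "word_cell q U :: 'u univ"
  let ?H = "horizontal_horn p k :: _ \<Rightarrow> 'u univ set"
  let ?B = "filtration q stage (stage U) :: _ \<Rightarrow> 'u univ set"
  let ?B' = "filtration q stage (Suc (stage U)) :: _ \<Rightarrow> 'u univ set"
  note x = word_cell_in[OF U] and Y = is_presheaf_cylinder[of q]
  have B: "is_subfunctor Theta2 ?Y ?B" and B': "is_subfunctor Theta2 ?Y ?B'"
    using is_subfunctor_filtration[OF q] mono by blast+
  have stageU: "stage W = stage U \<longleftrightarrow> W = U \<or> W = V" if "valid (length q) W" for W
    using eq[OF that U] fill_eq_U[OF that] fill_U fill_V by metis
  have cell: "act ?Y g ?x \<in> cells ?Y r" if "g \<in> theta_hom r p" for g r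
    using presheafD(1)[OF Y _ x] that by simp
  have gen: "act ?Y f ?x \<in> ?B (tdom f)" if f: "f \<in> hyperfaces p - horizontal_hyperfaces p k" for f
  proof (cases "act ?Y f ?x \<in> corner q (tdom f)")
    case False
    have fi: "f \<in> theta_hom (tdom f) p" using f hyperfaces_in by blast
    let ?W = "reduced_word (tdom f) (act ?Y f ?x)"
    have W: "valid (length q) ?W" by (rule valid_reduced_word[OF cell[OF fi] False q])
    have "hor f \<in> ord_maps (length (tdom f)) m" using theta_homD(3)[OF fi] by simp
    then have "subseq ?W U"
      unfolding word_cell_act(3)[OF fi] using subseq_reindex validD(4)[OF U] by blast
    then have "stage ?W \<le> stage U" by (rule mono[OF W U])
    moreover have "stage ?W \<noteq> stage U" using hyperface_reduced[OF f False] stageU[OF W] by blast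
    ultimately show ?thesis using cell[OF fi] by (simp add: filtration_def)
  qed (simp add: filtration_def)
  have in_horn: "act ?Y g ?x \<in> ?B r" if g: "Mor g \<in> ?H r" for g r
  proof -
    \<comment> \<open>The preimage of the earlier stage under the cell. It is a subfunctor
      containing the generating hyperfaces, hence contains the horn.\<close>
    define A where "A b = {Mor f :: 'u univ | f. f \<in> theta_hom b p \<and> act ?Y f ?x \<in> ?B b}" for b
    have "is_subfunctor Theta2 (Theta_rep p) A"
      unfolding is_subfunctor_def
    proof (intro conjI allI impI)
      show "A a \<subseteq> cells (Theta_rep p) a" for a by (auto simp: A_def Theta_rep_cells)
      fix a b f and z :: "'u univ" assume f: "f \<in> Hom Theta2 a b" and z: "z \<in> A b"
      then obtain g where g: "z = Mor g" "g \<in> theta_hom b p" "act ?Y g ?x \<in> ?B b" by (auto simp: A_def)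
      have "act ?Y (theta_comp g f) ?x = act ?Y f (act ?Y g ?x)"
        using presheafD(3)[OF Y f _ x, of g] g(2) by simp
      then have "act ?Y (theta_comp g f) ?x \<in> ?B a" using subfunctorD(2)[OF B f g(3)] by simp
      then show "act (Theta_rep p) f z \<in> A a" using g f theta_comp_in by (auto simp: A_def)
    qed
    moreover have "{Mor f |f. f \<in> hyperfaces p - horizontal_hyperfaces p k \<and> tdom f = b} \<subseteq> A b" for b
      using gen hyperfaces_in by (auto simp: A_def)
    ultimately have "?H r \<subseteq> A r" unfolding horizontal_horn_def generated_by_def by blast
    then show ?thesis using g by (auto simp: A_def)
  qed
  have off_horn: "act ?Y g ?x \<in> ?B' r - ?B r" if g: "g \<in> theta_hom r p" "Mor g \<notin> ?H r" for g r
  proof -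
    have "reduced_word r (act ?Y g ?x) = U \<or> reduced_word r (act ?Y g ?x) = V"
      unfolding word_cell_act(3)[OF g(1)] using off_horn_reduced[OF g] by metis
    then have "stage (reduced_word r (act ?Y g ?x)) = stage U" using stageU U V(1) by metis
    then show ?thesis using cell[OF g(1)] off_horn_free[OF g] by (simp add: filtration_def)
  qed
  have cover: "\<exists>g \<in> theta_hom r p. y = act ?Y g ?x" if y: "y \<in> ?B' r" "y \<notin> ?B r" for r y
  proof -
    have yc: "y \<in> cells ?Y r" "y \<notin> corner q r" "stage (reduced_word r y) = stage U"
      using y corner_sub by (auto simp: filtration_def)
    obtain w \<tau> where f: "y = Pair (Simp w) (Mor \<tau>)" "w \<in> {..length r} \<rightarrow>\<^sub>E UNIV" "\<tau> \<in> theta_hom r q"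
      using free_cell[OF yc(1,2) q] .
    let ?W = "reduced_word r y"
    have W: "?W = U \<or> ?W = V" using stageU[OF valid_reduced_word[OF yc(1,2) q]] yc(3) by blast
    have "remdups_adj (map (\<lambda>i. (w i, hor \<tau> i)) [0..<Suc (length r)]) = ?W"
      by (simp add: reduced_word_def f(1))
    from remdups_adj_index[OF this] obtain h where h: "h \<in> ord_maps (length r) (length ?W - 1)"
      "\<And>i. i \<le> length r \<Longrightarrow> (w i, hor \<tau> i) = ?W ! h i"
      by blast
    show ?thesis using W
    proof
      assume "?W = U"
      then show ?thesis using h by (intro word_cell_factor[OF U f]) simp_all
    next
      assume WV: "?W = V"
      then have h1: "h \<in> ord_maps (length r) (m - 1)" using h(1) V(2) by simp
      \<comment> \<open>An index into \<open>V\<close> becomes an index into \<open>U\<close> by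
        skipping position \<open>k\<close>.\<close>
      have "coface m k \<in> ord_maps (m - 1) m" using k by (intro coface_in) auto
      from ord_maps_comp[OF h1 this] show ?thesis
      proof (rule word_cell_factor[OF U f])
        show "U ! compose {..length r} (coface m k) h i = (w i, hor \<tau> i)" if "i \<le> length r" for i
          using h(2)[OF that] V_nth[OF ord_maps_le[OF h1 that]] WV that by (simp add: compose_def)
      qed
    qed
  qed
  have "?B r \<subseteq> ?B' r" for r by (auto simp: filtration_def)
  then have "\<exists>g i. is_pushout (inclusion (Theta_rep p) ?H) g i (inclusion (sub_cellular_set ?Y ?B') ?B)"
    by (rule attach_cell[OF Y x is_subfunctor_horn B B']) (fact in_horn off_horn off_horn_inj cover)+
  then obtain g i where
    "is_pushout (inclusion (Theta_rep p) ?H) g i (inclusion (sub_cellular_set ?Y ?B') ?B)" by blast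
  moreover have "inclusion (Theta_rep p) ?H \<in> cell \<H>\<^sub>h"
  proof (rule cell.base)
    have "k < length p" using k(2) by (subst word_ob_length)
    then show "inclusion (Theta_rep p) ?H \<in> \<H>\<^sub>h"
      using k(1) unfolding inner_horizontal_horn_inclusions_def by blast
  qed
  ultimately show ?thesis by (rule cell.pushout[rotated])
qed

end

section \<open>Composing the stages\<close>

lemma corner_inclusion_cell:
  assumes q: "q \<noteq> []"
  shows "inclusion (cylinder q) (corner q :: _ \<Rightarrow> 'u univ set) \<in> cell \<H>\<^sub>h"
proof -
  let ?Y = "cylinder q :: 'u univ cellular_set"
  have n: "length q \<noteq> 0" using q by simp
  obtain stage :: "word \<Rightarrow> nat" where
    mono: "\<And>V W. valid (length q) V \<Longrightarrow> valid (length q) W \<Longrightarrow> subseq V W \<Longrightarrow> stage V \<le> stage W" and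
    eq: "\<And>V W. valid (length q) V \<Longrightarrow> valid (length q) W \<Longrightarrow> stage V = stage W \<longleftrightarrow> fill V = fill W"
    using ex_stage[OF n] by blast
  let ?B = "filtration q stage :: nat \<Rightarrow> _ \<Rightarrow> 'u univ set"
  have sub: "is_subfunctor Theta2 ?Y (?B i)" for i using is_subfunctor_filtration[OF q] mono by blast
  have step: "inclusion (sub_cellular_set ?Y (?B (Suc i))) (?B i) \<in> cell \<H>\<^sub>h" for i
  proof (cases "\<exists>W. valid (length q) W \<and> stage W = i")
    case True
    then obtain W where W: "valid (length q) W" "stage W = i" by blast
    let ?U = "fill W"
    have U: "valid (length q) ?U" "fill ?U = ?U" using valid_fill[OF W(1) n] by blast+
    have i: "stage ?U = i" using eq[OF U(1) W(1)] U(2) W(2) by simp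
    obtain c as bs where c: "cut c as bs" "?U = as @ bs \<or> ?U = as @ (Lozenge, c) # bs"
      using valid_cut[OF U(1)] .
    interpret filled_word q ?U as bs c
      using q U(1) c(1) fill_eq[OF c] U(2) by unfold_locales simp_all
    show ?thesis using attach_word[OF mono eq, where 'u = 'u] i by simp
  next
    case none: False
    have "?B (Suc i) r = ?B i r" for r
    proof
      show "?B (Suc i) r \<subseteq> ?B i r"
      proof
        fix y assume y: "y \<in> ?B (Suc i) r"
        show "y \<in> ?B i r"
        proof (cases "y \<in> corner q r")
          case False
          then have "y \<in> cells ?Y r" "stage (reduced_word r y) < Suc i" using y by (auto simp: filtration_def)
          moreover then have "stage (reduced_word r y) \<noteq> i"
            using valid_reduced_word[OF _ False q] none by blast
          ultimately show ?thesis by (simp add: filtration_def)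
        qed (simp add: filtration_def)
      qed
      show "?B i r \<subseteq> ?B (Suc i) r" by (auto simp: filtration_def)
    qed
    then have "?B (Suc i) = ?B i" by blast
    then show ?thesis
      using cid_in_cell[OF is_presheaf_sub[OF is_presheaf_cylinder sub]] by (simp add: inclusion_self)
  qed
  have "inclusion ?Y (?B 0) \<in> cell \<H>\<^sub>h"
  proof (rule omega_composition[of ?Y ?B, OF is_presheaf_cylinder sub _ _ step])
    show "?B i r \<subseteq> ?B (Suc i) r" for i r by (auto simp: filtration_def)
    show "cells ?Y r \<subseteq> (\<Union>i. ?B i r)" for r by (auto simp: filtration_def)
  qed
  moreover have "?B 0 = corner q" by (auto simp: filtration_def)
  ultimately show ?thesis by simp
qed

section \<open>The corner inclusion as a Leibniz product\<close>

lemma Theta_rep_Nil: "\<exists>f. f \<in> theta_hom r []"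
proof
  show "ThMor r [] (\<lambda>i\<in>{..length r}. 0) (\<lambda>_. undefined) \<in> theta_hom r []"
    by (auto simp: theta_hom_def intro!: ord_mapsI)
qed

lemma e_map_app:
  assumes "f \<in> theta_hom r []"
  shows "app e_map r (Mor f) = Simp (\<lambda>i\<in>{..length r}. Lozenge)"
proof -
  note F = theta_homD[OF assms]
  have "hor f i = 0" if "i \<le> length r" for i using ord_maps_le[OF F(3) that] by simp
  then show ?thesis
    using assms F(1) by (auto simp: e_map_def Theta_rep_cells J_act compose_def fun_eq_iff)
qed

lemma e_map_range: "app e_map r ` cells (Theta_rep []) r = {Simp (\<lambda>i\<in>{..length r}. Lozenge)}"
proof
  show "app e_map r ` cells (Theta_rep []) r \<subseteq> {Simp (\<lambda>i\<in>{..length r}. Lozenge)}"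
    by (auto simp: e_map_app elim!: Theta_rep_cellsE)
  obtain f where "f \<in> theta_hom r []" using Theta_rep_Nil by blast
  then show "{Simp (\<lambda>i\<in>{..length r}. Lozenge)} \<subseteq> app e_map r ` cells (Theta_rep []) r"
    using e_map_app[of f r] Theta_rep_cells[of f "[]" r] by (metis empty_subsetI image_eqI insert_subset)
qed

text \<open>Both factors are injective, so their Leibniz product is the inclusion of a union inside
  the product. The image of \<open>e_map\<close> is the constant \<open>Lozenge\<close>, which turns
  this union into \<open>corner\<close>.\<close>

lemma corner_leibniz:
  "is_leibniz_product e_map (boundary_inclusion q) (inclusion (cylinder q) (corner q :: _ \<Rightarrow> 'u univ set))"
proof -
  let ?e = "e_map :: 'u univ cellular_map" and ?b = "boundary_inclusion q :: 'u univ cellular_map"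
  have e: "inj_on (app ?e p) (cells (Theta_rep []) p)" for p
  proof (rule inj_onI)
    fix x y :: "'u univ" assume xy: "x \<in> cells (Theta_rep []) p" "y \<in> cells (Theta_rep []) p"
    obtain f g where fg: "x = Mor f" "f \<in> theta_hom p []" "y = Mor g" "g \<in> theta_hom p []"
      using xy by (auto elim!: Theta_rep_cellsE)
    note F = theta_homD[OF fg(2)] and G = theta_homD[OF fg(4)]
    have "f = g"
      by (rule theta_eqI[OF fg(2,4)]) (use ord_maps_le[OF F(3)] ord_maps_le[OF G(3)] in force)+
    then show "x = y" using fg by simp
  qed
  have brange: "app ?b r ` boundary q r = boundary q r" for r
    by (auto simp: boundary_inclusion_def)
  have b: "inj_on (app ?b p) (cells (sub_cellular_set (Theta_rep q) (boundary q)) p)" for p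
    by (auto simp: boundary_inclusion_def inj_on_def)
  have "{Pair b d | b d. b \<in> cells J r \<and> d \<in> cells (Theta_rep q) r \<and>
        (b \<in> app ?e r ` cells (Theta_rep []) r \<or>
         d \<in> app ?b r ` cells (sub_cellular_set (Theta_rep q) (boundary q)) r)} = corner q r" for r
  proof -
    have "(\<forall>i\<le>length r. w i = Lozenge) \<longleftrightarrow> w = (\<lambda>i\<in>{..length r}. Lozenge)"
      if "w \<in> {..length r} \<rightarrow>\<^sub>E UNIV" for w
      using that by (auto simp: fun_eq_iff PiE_iff extensional_def)
    then show ?thesis
      unfolding e_map_range sub_sel brange corner_def J_cells
      by (auto simp: Theta_rep_cells elim!: Theta_rep_cellsE)
  qed
  then show ?thesis
    using leibniz_product_mono[OF e_map_in_maps boundary_inclusion_in_maps e b] by simp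
qed

theorem lemma5p1:
  fixes q :: theta_ob and h :: "'u univ cellular_map"
  assumes "q \<noteq> []"
    and "is_leibniz_product e_map (boundary_inclusion q) h"
  shows "h \<in> cell \<H>\<^sub>h"
  by (rule leibniz_product_cell[OF assms(2) corner_leibniz corner_inclusion_cell[OF assms(1)]])

end
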